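(* Let $p_1,\dots,p_N\in\mathbb D$ be source locations in the open unit disk with source strengths $q_1,\dots,q_N$, and for $m\ge 1$ let $H_m=(\mathcal M_{r+c})_{r,c=0}^{m-1}$ be the Hankel matrix of the low-frequency boundary-flux moments $\mathcal M_n$, $n\ge 0$, defined in the context. Assume that the source locations are distinct and that the source strengths are nonzero. Equivalently, writing $p_j=\rho_je^{i\phi_j}$ with $0\le\rho_j<1$ and setting $\lambda_j:=\rho_je^{-i\phi_j}$ and $w_j:=-\frac{q_j}{2\pi}$, assume $\lambda_i\neq\lambda_j$ for $i\neq j$ and $w_j\neq 0$ for all $j$. Then, for every $m\ge N$, $$\operatorname{rank} H_m = N .$$ Consequently, if $m$ is chosen no smaller than the true source number $N$, then the number of point sources is determined by the rank of the Hankel matrix $H_m$.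
   Context: $\mathbb D$ is the open unit disk in $\mathbb R^2$, with $\mathbb R^2$ identified with $\mathbb C$. Consider the heat equation with $N$ time-independent point sources $$\partial_t u-\Delta u=\sum_{j=1}^N q_j\,\delta(x-p_j)\ \text{ in }\mathbb D\times(0,\infty),\qquad u=0\ \text{ on }\partial\mathbb D\times(0,\infty),\qquad u(\cdot,0)=0\ \text{ in }\mathbb D .$$ The boundary flux is $f(\theta,t)=\frac{\partial u}{\partial\nu}(e^{i\theta},t)$, $0\le\theta<2\pi$, with $\nu$ the outward unit normal, and $\widehat f(\theta,s)$ is its Laplace transform in $t$. Let $G_s(x,y)$ be the Green's function of $s-\Delta$ on $\mathbb D$ with homogeneous Dirichlet boundary conditions (so $G_0$ is the Dirichlet Green's function of $-\Delta$). The Laplace-transformed flux is $$\widehat f(\theta,s)=\frac1s\sum_{j=1}^N q_j\frac{\partial G_s}{\partial\nu}(e^{i\theta},p_j),$$ where the normal derivative is taken in the first variable. The normalized boundary flux is $\mathcal F(\theta,s)=s\,\widehat f(\theta,s)$, and its low-frequency limit is $$g(\theta)=\lim_{s\to 0}\mathcal F(\theta,s)=\sum_{j=1}^N q_j\frac{\partial G_0}{\partial\nu}(e^{i\theta},p_j).$$ The moments are $$\mathcal M_n=\frac1{2\pi}\int_0^{2\pi} g(\theta)e^{-in\theta}\,d\theta,\qquad n=0,1,2,\dots,$$ and they have the finite exponential-sum form $\mathcal M_n=\sum_{j=1}^N w_j\lambda_j^n$ (with $0^0=1$). *)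

theory Defs
  imports "HOL-Analysis.Analysis" "Jordan_Normal_Form.DL_Rank"
begin

definition dir_deriv :: "'a::real_normed_vector \<Rightarrow> ('a \<Rightarrow> real) \<Rightarrow> 'a \<Rightarrow> real" where
  "dir_deriv v \<phi> z = frechet_derivative \<phi> (at z) v"

primrec times_cont_diff :: "nat \<Rightarrow> ('a::euclidean_space \<Rightarrow> real) \<Rightarrow> bool" where
  "times_cont_diff 0 \<phi> \<longleftrightarrow> continuous_on UNIV \<phi>"
| "times_cont_diff (Suc k) \<phi> \<longleftrightarrow>
     (\<forall>z. \<phi> differentiable (at z)) \<and> (\<forall>b\<in>Basis. times_cont_diff k (dir_deriv b \<phi>))"

text \<open>Smooth functions on space-time with compact support in (open unit disk) \<open>\<times>\<close> \<open>\<real>\<close>.\<close>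

definition test_function :: "(complex \<times> real \<Rightarrow> real) \<Rightarrow> bool" where
  "test_function \<phi> \<longleftrightarrow>
     (\<forall>k. times_cont_diff k \<phi>) \<and>
     compact (closure {z. \<phi> z \<noteq> 0}) \<and> closure {z. \<phi> z \<noteq> 0} \<subseteq> ball 0 1 \<times> UNIV"

definition time_deriv :: "(complex \<times> real \<Rightarrow> real) \<Rightarrow> complex \<times> real \<Rightarrow> real" where
  "time_deriv = dir_deriv (0, 1)"

definition space_laplacian :: "(complex \<times> real \<Rightarrow> real) \<Rightarrow> complex \<times> real \<Rightarrow> real" where
  "space_laplacian \<phi> z =
     dir_deriv (1, 0) (dir_deriv (1, 0) \<phi>) z + dir_deriv (\<i>, 0) (dir_deriv (\<i>, 0) \<phi>) z"

text \<open>
  The initial-boundary value problem for the heat equation with right-hand side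
  \<open>\<Sum>j. q j * \<delta>(x - p j)\<close>, homogeneous Dirichlet data and zero initial data.  Away from the
  sources \<open>u\<close> is continuous up to the boundary and up to \<open>t = 0\<close>, and it attains its boundary
  and initial values pointwise.  The equation is read in the sense of distributions.

  The test functions in the last clause need not vanish at \<open>t = 0\<close>.  Integrating by parts in
  time would produce a term with \<open>u x 0\<close> there; its absence says that the initial datum is zero
  as a distribution on the whole disk, the points \<open>p j\<close> included.  With test functions supported
  in \<open>t > 0\<close> only, one could add to \<open>u\<close> the Dirichlet heat kernel issuing from \<open>(p j, 0)\<close>,
  which vanishes at \<open>t = 0\<close> everywhere except at \<open>p j\<close>.
\<close>

definition heat_point_source_solution ::
    "nat \<Rightarrow> (nat \<Rightarrow> complex) \<Rightarrow> (nat \<Rightarrow> real) \<Rightarrow> (complex \<Rightarrow> real \<Rightarrow> real) \<Rightarrow> bool" where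
  "heat_point_source_solution N p q u \<longleftrightarrow>
     continuous_on ((cball 0 1 - p ` {1..N}) \<times> {0..}) (\<lambda>(x, t). u x t) \<and>
     (\<forall>x\<in>sphere 0 1. \<forall>t>0. u x t = 0) \<and>
     (\<forall>x\<in>ball 0 1 - p ` {1..N}. u x 0 = 0) \<and>
     (\<forall>T>0. set_integrable lborel (ball 0 1 \<times> {0..T}) (\<lambda>(x, t). u x t)) \<and>
     (\<forall>\<phi>. test_function \<phi> \<longrightarrow>
        (LINT z:ball 0 1 \<times> {0..}|lborel.
           u (fst z) (snd z) * (- time_deriv \<phi> z - space_laplacian \<phi> z)) =
        (\<Sum>j\<in>{1..N}. q j * (LINT t:{0..}|lborel. \<phi> (p j, t))))"

text \<open>\<open>f \<theta> t\<close> is the outward normal derivative of \<open>u\<close> at \<open>cis \<theta>\<close>, i.e. the radial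
  derivative taken from inside the disk.\<close>

definition boundary_flux :: "(complex \<Rightarrow> real \<Rightarrow> real) \<Rightarrow> (real \<Rightarrow> real \<Rightarrow> real) \<Rightarrow> bool" where
  "boundary_flux u f \<longleftrightarrow>
     (\<forall>\<theta>\<in>{0..<2*pi}. \<forall>t>0.
        ((\<lambda>r. u (of_real r * cis \<theta>) t) has_real_derivative f \<theta> t) (at_left 1))"

definition laplace_transform :: "(real \<Rightarrow> real) \<Rightarrow> real \<Rightarrow> real" where
  "laplace_transform h s = (LINT t:{0<..}|lborel. exp (- s * t) * h t)"

definition normalized_flux :: "(real \<Rightarrow> real \<Rightarrow> real) \<Rightarrow> real \<Rightarrow> real \<Rightarrow> real" where
  "normalized_flux f \<theta> s = s * laplace_transform (f \<theta>) s"

definition low_frequency_flux :: "(real \<Rightarrow> real \<Rightarrow> real) \<Rightarrow> real \<Rightarrow> real" where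
  "low_frequency_flux f \<theta> = Lim (at_right 0) (normalized_flux f \<theta>)"

definition flux_moment :: "(real \<Rightarrow> real \<Rightarrow> real) \<Rightarrow> nat \<Rightarrow> complex" where
  "flux_moment f n =
     1 / (2 * of_real pi) *
     (LINT \<theta>:{0..2*pi}|lborel.
        complex_of_real (low_frequency_flux f \<theta>) * exp (- \<i> * of_nat n * of_real \<theta>))"

definition flux_hankel :: "(real \<Rightarrow> real \<Rightarrow> real) \<Rightarrow> nat \<Rightarrow> complex mat" where
  "flux_hankel f m = mat m m (\<lambda>(r, c). flux_moment f (r + c))"

text \<open>\<open>u\<close> is the temperature and \<open>f\<close> the boundary flux generated by sources of strengths
  \<open>q 1, \<dots>, q N\<close> at the points \<open>p 1, \<dots>, p N\<close> of the open unit disk.\<close>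

definition point_source_data ::
    "nat \<Rightarrow> (nat \<Rightarrow> complex) \<Rightarrow> (nat \<Rightarrow> real) \<Rightarrow> (complex \<Rightarrow> real \<Rightarrow> real) \<Rightarrow>
     (real \<Rightarrow> real \<Rightarrow> real) \<Rightarrow> bool" where
  "point_source_data N p q u f \<longleftrightarrow>
     (\<forall>j\<in>{1..N}. p j \<in> ball 0 1) \<and> heat_point_source_solution N p q u \<and> boundary_flux u f"

definition distinct_nonzero_sources :: "nat \<Rightarrow> (nat \<Rightarrow> complex) \<Rightarrow> (nat \<Rightarrow> real) \<Rightarrow> bool" where
  "distinct_nonzero_sources N p q \<longleftrightarrow> inj_on p {1..N} \<and> (\<forall>j\<in>{1..N}. q j \<noteq> 0)"

end

theory Submission
  imports Defs "HOL-Computational_Algebra.Polynomial"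
begin

text \<open>
  The steady state of the problem is a combination \<open>U = \<Sum>j. q j / kappa * green (p j)\<close> of Green's
  functions \<open>green p x = ln (cmod (1 - cnj p * x)) - ln (cmod (x - p))\<close>.  Adding
  \<open>cmod (1 - cnj p * x) - cmod (x - p)\<close> to \<open>green p\<close> gives a function that vanishes on the
  circle, dominates \<open>green p\<close>, and satisfies \<open>\<Delta> b + c * b \<le> 0\<close> with \<open>c > 0\<close>.  The matching combination
  \<open>\<Psi>\<close> of these barriers makes \<open>exp (- c * t) * \<Psi> \<plusminus> (U - u)\<close> weak supersolutions of the heat
  equation that are nonnegative initially and on the circle.  By the minimum principle
  \<open>\<bar>U - u\<bar> \<le> exp (- c * t) * \<Psi>\<close>, so at each boundary point the flux of \<open>u\<close> tends
  exponentially to that of \<open>U\<close>, and so does \<open>s\<close> times its Laplace transform as \<open>s \<rightarrow> 0\<close>.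
  The flux of \<open>U\<close> is a combination of Poisson kernels, whose \<open>n\<close>th moments are \<open>cnj (p j) ^ n\<close>.
  The Vandermonde vectors of distinct nodes are a basis of the column space of the Hankel matrix of
  an exponential sum with nonzero weights.

  The constant \<open>kappa\<close> is \<open>2 * pi\<close>, but only \<open>kappa > 0\<close> matters: it rescales all weights and
  does not change the rank, so its value is never computed.
\<close>

text \<open>The obstacle is that \<open>u\<close> solves the equation only as a distribution: it is
  integrable and continuous off the sources, with nothing known about its derivatives inside the
  disk or its size near a source. So comparison is done weakly and becomes classical only after
  mollification, where all derivatives fall on the kernel. The two moduli in the barrier are what
  yields a decay rate. In the plane the Laplacian of \<open>cmod (x - p)\<close> is
  \<open>1 / cmod (x - p)\<close>, so subtracting this modulus gives a negative term that beats the
  logarithmic pole of \<open>green p\<close>. The reflected modulus restores zero boundary values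
  and costs \<open>(cmod p)^2 / cmod (1 - cnj p * x)\<close>, at most
  \<open>(cmod p)^2 / cmod (x - p)\<close>. A surplus of
  \<open>(1 - (cmod p)^2) / cmod (x - p)\<close> remains, while the barrier is at most
  \<open>6 / cmod (x - p)\<close>; hence the rate \<open>(1 - (cmod p)^2) / 6\<close>. Barriers
  vanish on the circle and have a radial derivative there, so division by \<open>1 - r\<close> turns
  the bound on \<open>U - u\<close> into a bound on the flux. Only pointwise existence of the normal
  derivative of \<open>u\<close> enters.\<close>

section \<open>Smooth test functions of product form\<close>

text \<open>A set of functions closed under differentiation replaces the iterated derivatives.\<close>

definition smooth_real :: "(real \<Rightarrow> real) \<Rightarrow> bool" where
  "smooth_real f \<longleftrightarrow> (\<exists>S. f \<in> S \<and> (\<forall>g\<in>S. \<exists>g'\<in>S. \<forall>x. (g has_real_derivative g' x) (at x)))"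

lemma smooth_real_deriv:
  assumes "smooth_real f"
  obtains f' where "smooth_real f'" "\<And>x. (f has_real_derivative f' x) (at x)"
  using assms unfolding smooth_real_def by metis

text \<open>Each differentiation brings out a factor \<open>a\<close>, so the witnessing family must
  be closed under scalar multiples; hence the extra constant \<open>k\<close> in
  \<open>?T\<close>.\<close>

lemma smooth_real_affine:
  assumes "smooth_real f"
  shows "smooth_real (\<lambda>x. f (a * x + b))"
proof -
  obtain S where S: "f \<in> S" "\<And>g. g \<in> S \<Longrightarrow> \<exists>g'\<in>S. \<forall>x. (g has_real_derivative g' x) (at x)"
    using assms unfolding smooth_real_def by blast
  let ?T = "{\<lambda>x. k * g (a * x + b) | k g. g \<in> S}"
  have "\<exists>h'\<in>?T. \<forall>x. (h has_real_derivative h' x) (at x)" if hT: "h \<in> ?T" for h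
  proof -
    obtain k g where h: "h = (\<lambda>x. k * g (a * x + b))" "g \<in> S"
      using hT by blast
    obtain g' where g': "g' \<in> S" "\<And>x. (g has_real_derivative g' x) (at x)"
      using S(2)[OF h(2)] by blast
    have "(h has_real_derivative (k * a) * g' (a * x + b)) (at x)" for x
      unfolding h(1) by (rule derivative_eq_intros DERIV_chain2[OF g'(2)] refl | simp)+
    moreover have "(\<lambda>x. (k * a) * g' (a * x + b)) \<in> ?T"
      using g'(1) by blast
    ultimately show ?thesis
      by (intro bexI[of _ "\<lambda>x. (k * a) * g' (a * x + b)"] allI)
  qed
  moreover have "(\<lambda>x. f (a * x + b)) \<in> ?T"
    using S(1) by (auto intro!: exI[of _ 1] exI[of _ f])
  ultimately show ?thesis
    unfolding smooth_real_def by (intro exI[of _ ?T]) blast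
qed

text \<open>The product rule turns one product into two, so the witnessing family consists of finite
  sums of products. Lists keep repeated summands apart, and the rule acts on them entry by
  entry.\<close>

lemma smooth_real_mult:
  assumes "smooth_real f" "smooth_real g"
  shows "smooth_real (\<lambda>x. f x * g x)"
proof -
  obtain S where S: "f \<in> S" "\<And>g. g \<in> S \<Longrightarrow> \<exists>g'\<in>S. \<forall>x. (g has_real_derivative g' x) (at x)"
    using assms(1) unfolding smooth_real_def by blast
  obtain T where T: "g \<in> T" "\<And>g. g \<in> T \<Longrightarrow> \<exists>g'\<in>T. \<forall>x. (g has_real_derivative g' x) (at x)"
    using assms(2) unfolding smooth_real_def by blast
  define R where "R = {\<lambda>x. \<Sum>(u, v)\<leftarrow>ps. u x * v x | ps. set ps \<subseteq> S \<times> T}"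
  have R: "\<exists>ps'. set ps' \<subseteq> S \<times> T \<and>
      (\<forall>x. ((\<lambda>x. \<Sum>(u, v)\<leftarrow>ps. u x * v x) has_real_derivative (\<Sum>(u, v)\<leftarrow>ps'. u x * v x)) (at x))"
    if "set ps \<subseteq> S \<times> T" for ps
    using that
  proof (induction ps)
    case Nil
    then show ?case by (intro exI[of _ "[]"]) simp
  next
    case (Cons p ps)
    obtain u v where p: "p = (u, v)" "u \<in> S" "v \<in> T"
      using Cons.prems by (cases p) auto
    obtain u' where u': "u' \<in> S" "\<And>x. (u has_real_derivative u' x) (at x)"
      using S(2)[OF p(2)] by blast
    obtain v' where v': "v' \<in> T" "\<And>x. (v has_real_derivative v' x) (at x)"
      using T(2)[OF p(3)] by blast
    obtain ps' where ps': "set ps' \<subseteq> S \<times> T"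
      "\<And>x. ((\<lambda>x. \<Sum>(u, v)\<leftarrow>ps. u x * v x) has_real_derivative (\<Sum>(u, v)\<leftarrow>ps'. u x * v x)) (at x)"
      using Cons by auto
    show ?case
      using p u' v' ps'(1)
      by (intro exI[of _ "(u', v) # (u, v') # ps'"])
         (auto intro!: derivative_eq_intros ps'(2) simp: mult_ac)
  qed
  have "\<exists>h'\<in>R. \<forall>x. (h has_real_derivative h' x) (at x)" if hR: "h \<in> R" for h
  proof -
    obtain ps where ps: "h = (\<lambda>x. \<Sum>(u, v)\<leftarrow>ps. u x * v x)" "set ps \<subseteq> S \<times> T"
      using hR unfolding R_def by blast
    obtain ps' where "set ps' \<subseteq> S \<times> T"
      "\<And>x. (h has_real_derivative (\<Sum>(u, v)\<leftarrow>ps'. u x * v x)) (at x)"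
      using R[OF ps(2)] unfolding ps(1) by auto
    then show ?thesis
      unfolding R_def by (intro bexI[of _ "\<lambda>x. \<Sum>(u, v)\<leftarrow>ps'. u x * v x"]) auto
  qed
  moreover have "(\<lambda>x. f x * g x) \<in> R"
    using S(1) T(1) unfolding R_def by (intro CollectI exI[of _ "[(f, g)]"]) auto
  ultimately show ?thesis
    unfolding smooth_real_def by (intro exI[of _ R]) blast
qed

text \<open>Derivatives of \<open>exp (- 1 / t)\<close> stay in this family, with \<open>P\<close> a polynomial in \<open>1 / t\<close>.\<close>

definition flat_function :: "real poly \<Rightarrow> real \<Rightarrow> real" where
  "flat_function P t = (if t > 0 then poly P (1 / t) * exp (- (1 / t)) else 0)"

lemma poly_times_exp_minus_tendsto_0:
  "((\<lambda>y::real. poly P y * exp (- y)) \<longlongrightarrow> 0) at_top"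
proof -
  have "((\<lambda>y. \<Sum>i\<le>degree P. coeff P i * (y ^ i / exp y)) \<longlongrightarrow> (\<Sum>i\<le>degree P. coeff P i * 0)) at_top"
    by (intro tendsto_intros tendsto_power_div_exp_0)
  then show ?thesis
    by (simp add: poly_altdef exp_minus sum_distrib_left divide_inverse mult_ac)
qed

text \<open>With \<open>y = 1 / t\<close> the derivative of \<open>P(y) * exp (-y)\<close> is
  \<open>y^2 * (P - P')(y) * exp (-y)\<close>, and \<open>monom 1 2\<close> is the factor
  \<open>y^2\<close>. At 0 the exponential beats every polynomial in \<open>y\<close>.\<close>

lemma flat_function_deriv:
  "(flat_function P has_real_derivative flat_function (monom 1 2 * (P - pderiv P)) t) (at t)"
proof -
  consider "t > 0" | "t < 0" | "t = 0" by linarith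
  then show ?thesis
  proof cases
    case 1
    have "((\<lambda>t. poly P (1 / t) * exp (- (1 / t))) has_real_derivative
        flat_function (monom 1 2 * (P - pderiv P)) t) (at t)"
      using 1 by (auto intro!: derivative_eq_intros DERIV_chain2[OF poly_DERIV]
          simp: flat_function_def poly_monom field_simps power2_eq_square)
    then show ?thesis
      by (rule has_field_derivative_transform_within_open[of _ _ _ "{0<..}"])
         (use 1 in \<open>auto simp: flat_function_def\<close>)
  next
    case 2
    have "((\<lambda>t. 0) has_real_derivative flat_function (monom 1 2 * (P - pderiv P)) t) (at t)"
      using 2 by (simp add: flat_function_def)
    then show ?thesis
      by (rule has_field_derivative_transform_within_open[of _ _ _ "{..<0}"])
         (use 2 in \<open>auto simp: flat_function_def\<close>)
  next
    case 3
    \<comment> \<open>\<open>pCons 0 P\<close> is the polynomial \<open>y * P(y)\<close>; the extra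
      factor \<open>y\<close> is the division by \<open>h\<close> in the difference quotient at
      0.\<close>
    have "((\<lambda>h. poly (pCons 0 P) (inverse h) * exp (- inverse h)) \<longlongrightarrow> 0) (at_right 0)"
      using poly_times_exp_minus_tendsto_0 filterlim_inverse_at_top_right by (rule filterlim_compose)
    moreover have "\<forall>\<^sub>F h in at_right 0. poly (pCons 0 P) (inverse h) * exp (- inverse h) = flat_function P h / h"
      by (auto simp: eventually_at_filter flat_function_def divide_simps)
    ultimately have right: "((\<lambda>h. flat_function P h / h) \<longlongrightarrow> 0) (at_right 0)"
      by (rule Lim_transform_eventually)
    have "\<forall>\<^sub>F h in at_left 0. 0 = flat_function P h / h"
      by (auto simp: eventually_at_filter flat_function_def)
    then have left: "((\<lambda>h. flat_function P h / h) \<longlongrightarrow> 0) (at_left 0)"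
      by (rule Lim_transform_eventually[OF tendsto_const])
    have "((\<lambda>h. flat_function P h / h) \<longlongrightarrow> 0) (at 0)"
      using left right by (simp add: filterlim_at_split)
    moreover have "flat_function P 0 = 0" "flat_function (monom 1 2 * (P - pderiv P)) 0 = 0"
      by (simp_all add: flat_function_def)
    ultimately show ?thesis
      using 3 by (simp add: DERIV_def)
  qed
qed

lemma smooth_flat_function: "smooth_real (flat_function P)"
  unfolding smooth_real_def
  by (intro exI[of _ "range flat_function"]) (use flat_function_deriv in blast)

text \<open>\<open>exp (-1 / (1 + x))\<close> and \<open>exp (-1 / (1 - x))\<close>, each cut off
  where its denominator is not positive, multiply to a bump on (-1, 1). Reflection exchanges the two
  factors, which is the evenness.\<close>

lemma smooth_bump:
  "\<exists>\<eta>. smooth_real \<eta> \<and> (\<forall>x. \<eta> (- x) = \<eta> x) \<and> (\<forall>x. 0 \<le> \<eta> x) \<and>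
    (\<forall>x. \<bar>x\<bar> < 1 \<longrightarrow> 0 < \<eta> x) \<and> (\<forall>x. 1 \<le> \<bar>x\<bar> \<longrightarrow> \<eta> x = 0)"
proof (intro exI conjI)
  let ?\<eta> = "\<lambda>x. flat_function 1 (1 * x + 1) * flat_function 1 (-1 * x + 1)"
  show "smooth_real ?\<eta>"
    by (intro smooth_real_mult smooth_real_affine smooth_flat_function)
qed (auto simp: flat_function_def)

text \<open>Products are enough because the mollifier will be a product. A partial derivative
  changes a single factor, so smoothness in space-time reduces to one real variable.\<close>

definition tensor :: "(real \<Rightarrow> real) \<Rightarrow> (real \<Rightarrow> real) \<Rightarrow> (real \<Rightarrow> real) \<Rightarrow> complex \<times> real \<Rightarrow> real" where
  "tensor \<alpha> \<beta> \<gamma> z = \<alpha> (Re (fst z)) * \<beta> (Im (fst z)) * \<gamma> (snd z)"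

lemma has_derivative_tensor:
  assumes "\<And>x. (\<alpha> has_real_derivative \<alpha>' x) (at x)" "\<And>x. (\<beta> has_real_derivative \<beta>' x) (at x)"
    "\<And>x. (\<gamma> has_real_derivative \<gamma>' x) (at x)"
  shows "(tensor \<alpha> \<beta> \<gamma> has_derivative
    (\<lambda>h. Re (fst h) * tensor \<alpha>' \<beta> \<gamma> z + Im (fst h) * tensor \<alpha> \<beta>' \<gamma> z + snd h * tensor \<alpha> \<beta> \<gamma>' z)) (at z)"
proof -
  have a: "((\<lambda>z. \<alpha> (Re (fst z))) has_derivative (\<lambda>h. \<alpha>' (Re (fst z)) * Re (fst h))) (at z)"
    by (rule has_derivative_compose[of "\<lambda>z. Re (fst z)" "\<lambda>h. Re (fst h)", OF _ assms(1)[unfolded has_field_derivative_def]])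
       (auto intro!: derivative_eq_intros)
  have b: "((\<lambda>z. \<beta> (Im (fst z))) has_derivative (\<lambda>h. \<beta>' (Im (fst z)) * Im (fst h))) (at z)"
    by (rule has_derivative_compose[of "\<lambda>z. Im (fst z)" "\<lambda>h. Im (fst h)", OF _ assms(2)[unfolded has_field_derivative_def]])
       (auto intro!: derivative_eq_intros)
  have c: "((\<lambda>z. \<gamma> (snd z)) has_derivative (\<lambda>h. \<gamma>' (snd z) * snd h)) (at z)"
    by (rule has_derivative_compose[of "\<lambda>z. snd z" "\<lambda>h. snd h", OF _ assms(3)[unfolded has_field_derivative_def]])
       (auto intro!: derivative_eq_intros)
  show ?thesis
    unfolding tensor_def[abs_def]
    by (rule has_derivative_eq_rhs[OF has_derivative_mult[OF has_derivative_mult[OF a b] c]])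
       (simp add: fun_eq_iff algebra_simps)
qed

lemma dir_deriv_tensor:
  assumes "\<And>x. (\<alpha> has_real_derivative \<alpha>' x) (at x)" "\<And>x. (\<beta> has_real_derivative \<beta>' x) (at x)"
    "\<And>x. (\<gamma> has_real_derivative \<gamma>' x) (at x)"
  shows "dir_deriv (1, 0) (tensor \<alpha> \<beta> \<gamma>) = tensor \<alpha>' \<beta> \<gamma>"
    "dir_deriv (\<i>, 0) (tensor \<alpha> \<beta> \<gamma>) = tensor \<alpha> \<beta>' \<gamma>"
    "dir_deriv (0, 1) (tensor \<alpha> \<beta> \<gamma>) = tensor \<alpha> \<beta> \<gamma>'"
  unfolding dir_deriv_def fun_eq_iff
  by (simp_all add: frechet_derivative_at[OF has_derivative_tensor[OF assms], symmetric])

lemma Basis_complex_real: "(Basis :: (complex \<times> real) set) = {(1, 0), (\<i>, 0), (0, 1)}"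
  by (auto simp: Basis_prod_def Basis_complex_def)

lemma times_cont_diff_tensor:
  assumes "smooth_real \<alpha>" "smooth_real \<beta>" "smooth_real \<gamma>"
  shows "times_cont_diff k (tensor \<alpha> \<beta> \<gamma>)"
  using assms
proof (induction k arbitrary: \<alpha> \<beta> \<gamma>)
  case 0
  obtain \<alpha>' \<beta>' \<gamma>' where "\<And>x. (\<alpha> has_real_derivative \<alpha>' x) (at x)" "\<And>x. (\<beta> has_real_derivative \<beta>' x) (at x)"
    "\<And>x. (\<gamma> has_real_derivative \<gamma>' x) (at x)"
    using 0 by (metis smooth_real_deriv)
  then have "isCont (tensor \<alpha> \<beta> \<gamma>) z" for z
    by (intro has_derivative_continuous[OF has_derivative_tensor])
  then show ?case
    by (simp add: continuous_on_eq_continuous_at del: split_paired_All)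
next
  case (Suc k)
  obtain \<alpha>' \<beta>' \<gamma>' where d: "\<And>x. (\<alpha> has_real_derivative \<alpha>' x) (at x)" "\<And>x. (\<beta> has_real_derivative \<beta>' x) (at x)"
    "\<And>x. (\<gamma> has_real_derivative \<gamma>' x) (at x)"
    and s: "smooth_real \<alpha>'" "smooth_real \<beta>'" "smooth_real \<gamma>'"
    using Suc.prems by (metis smooth_real_deriv)
  show ?case
    using Suc s dir_deriv_tensor[OF d] differentiableI[OF has_derivative_tensor[OF d]]
    by (simp add: Basis_complex_real)
qed

text \<open>The closed rectangle lies in the open disk, so the compact image \<open>?K\<close>
  contains the closure of the support and keeps it away from the circle.\<close>

lemma test_function_tensor:
  assumes smooth: "smooth_real \<alpha>" "smooth_real \<beta>" "smooth_real \<gamma>"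
    and van: "\<And>x. x \<notin> {l1..r1} \<Longrightarrow> \<alpha> x = 0" "\<And>x. x \<notin> {l2..r2} \<Longrightarrow> \<beta> x = 0"
      "\<And>x. x \<notin> {l3..r3} \<Longrightarrow> \<gamma> x = 0"
    and disk: "\<And>a b. a \<in> {l1..r1} \<Longrightarrow> b \<in> {l2..r2} \<Longrightarrow> Complex a b \<in> ball 0 1"
  shows "test_function (tensor \<alpha> \<beta> \<gamma>)"
proof -
  let ?K = "(\<lambda>(a, b, t). (Complex a b, t)) ` ({l1..r1} \<times> {l2..r2} \<times> {l3..r3})"
  have K: "compact ?K"
    by (intro compact_continuous_image compact_Times compact_Icc)
       (auto simp: case_prod_beta Complex_eq intro!: continuous_intros)
  have sub: "closure {z. tensor \<alpha> \<beta> \<gamma> z \<noteq> 0} \<subseteq> ?K"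
  proof (rule closure_minimal)
    show "{z. tensor \<alpha> \<beta> \<gamma> z \<noteq> 0} \<subseteq> ?K"
    proof
      fix z assume "z \<in> {z. tensor \<alpha> \<beta> \<gamma> z \<noteq> 0}"
      then have "(Re (fst z), Im (fst z), snd z) \<in> {l1..r1} \<times> {l2..r2} \<times> {l3..r3}"
        using van unfolding tensor_def by fastforce
      then show "z \<in> ?K"
        by (rule rev_image_eqI) simp
    qed
  qed (use K compact_imp_closed in blast)
  moreover have "?K \<subseteq> ball 0 1 \<times> UNIV"
    using disk by auto
  moreover have "compact (closure {z. tensor \<alpha> \<beta> \<gamma> z \<noteq> 0})"
    using sub K by (metis closed_closure compact_Int_closed inf.absorb_iff2)
  ultimately show ?thesis
    using times_cont_diff_tensor[OF smooth] unfolding test_function_def by blast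
qed

lemma time_deriv_tensor:
  assumes "smooth_real \<alpha>" "smooth_real \<beta>" "\<And>x. (\<gamma> has_real_derivative \<gamma>' x) (at x)"
  shows "time_deriv (tensor \<alpha> \<beta> \<gamma>) = tensor \<alpha> \<beta> \<gamma>'"
  using assms dir_deriv_tensor(3) unfolding time_deriv_def by (metis smooth_real_deriv)

lemma space_laplacian_tensor:
  assumes \<alpha>: "\<And>x. (\<alpha> has_real_derivative \<alpha>1 x) (at x)" "\<And>x. (\<alpha>1 has_real_derivative \<alpha>2 x) (at x)"
    and \<beta>: "\<And>x. (\<beta> has_real_derivative \<beta>1 x) (at x)" "\<And>x. (\<beta>1 has_real_derivative \<beta>2 x) (at x)"
    and \<gamma>: "smooth_real \<gamma>"
  shows "space_laplacian (tensor \<alpha> \<beta> \<gamma>) z = tensor \<alpha>2 \<beta> \<gamma> z + tensor \<alpha> \<beta>2 \<gamma> z"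
proof -
  obtain \<gamma>' where \<gamma>': "\<And>x. (\<gamma> has_real_derivative \<gamma>' x) (at x)"
    using \<gamma> by (metis smooth_real_deriv)
  show ?thesis
    unfolding space_laplacian_def
    by (simp add: dir_deriv_tensor(1)[OF \<alpha>(1) \<beta>(1) \<gamma>'] dir_deriv_tensor(1)[OF \<alpha>(2) \<beta>(1) \<gamma>']
      dir_deriv_tensor(2)[OF \<alpha>(1) \<beta>(1) \<gamma>'] dir_deriv_tensor(2)[OF \<alpha>(1) \<beta>(2) \<gamma>'])
qed

section \<open>Convolution and integration by parts\<close>

text \<open>Dominated convergence for difference quotients along sequences; the mean value
  inequality bounds them by \<open>B\<close>. The bound on \<open>H'\<close> is local, so a general
  null sequence is first shifted past the terms of size 1 or more.\<close>

lemma has_real_derivative_integral: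
  fixes H :: "real \<Rightarrow> 'b \<Rightarrow> real"
  assumes int: "\<And>a. integrable M (H a)"
    and der: "\<And>a y. ((\<lambda>a. H a y) has_real_derivative H' a y) (at a)"
    and bound: "\<And>a y. \<bar>a - a0\<bar> < 1 \<Longrightarrow> \<bar>H' a y\<bar> \<le> B y" and B: "integrable M B"
  shows "((\<lambda>a. \<integral>y. H a y \<partial>M) has_real_derivative (\<integral>y. H' a0 y \<partial>M)) (at a0)"
proof -
  have lim: "(\<lambda>n. ((\<integral>y. H (a0 + X n) y \<partial>M) - (\<integral>y. H a0 y \<partial>M)) / X n) \<longlonglongrightarrow> (\<integral>y. H' a0 y \<partial>M)"
    if X: "\<And>n. X n \<noteq> 0" "X \<longlonglongrightarrow> 0" "\<And>n. \<bar>X n\<bar> < 1" for X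
  proof -
    let ?Q = "\<lambda>n y. (H (a0 + X n) y - H a0 y) / X n"
    have pt: "(\<lambda>n. ?Q n y) \<longlonglongrightarrow> H' a0 y" for y
    proof -
      have "((\<lambda>h. (H (a0 + h) y - H a0 y) / h) \<longlongrightarrow> H' a0 y) (at 0)"
        using der by (simp add: DERIV_def)
      then show ?thesis
        unfolding tendsto_at_iff_sequentially comp_def using X by auto
    qed
    have "(\<lambda>n. \<integral>y. ?Q n y \<partial>M) \<longlonglongrightarrow> (\<integral>y. H' a0 y \<partial>M)"
    proof (rule integral_dominated_convergence)
      show meas: "?Q n \<in> borel_measurable M" for n
        using int by (intro borel_measurable_divide borel_measurable_diff) auto
      show "H' a0 \<in> borel_measurable M"
        using pt meas by (rule borel_measurable_LIMSEQ_real)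
      show "AE y in M. norm (?Q n y) \<le> B y" for n
      proof (intro always_eventually allI)
        fix y
        have "\<bar>H (a0 + X n) y - H a0 y\<bar> \<le> B y * \<bar>a0 + X n - a0\<bar>"
          using field_differentiable_bound[of "{a0 - \<bar>X n\<bar>..a0 + \<bar>X n\<bar>}" "\<lambda>a. H a y" "\<lambda>a. H' a y" "B y" "a0 + X n" a0]
            der bound X(3)[of n] by (force intro: DERIV_subset)
        then show "norm (?Q n y) \<le> B y"
          using X(1)[of n] by (simp add: divide_simps)
      qed
    qed (use B pt in auto)
    then show ?thesis
      using int by simp
  qed
  have "((\<lambda>h. ((\<integral>y. H (a0 + h) y \<partial>M) - (\<integral>y. H a0 y \<partial>M)) / h) \<longlongrightarrow> (\<integral>y. H' a0 y \<partial>M)) (at 0)"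
    unfolding tendsto_at_iff_sequentially comp_def
  proof (intro allI impI)
    fix X :: "nat \<Rightarrow> real" assume X: "\<forall>n. X n \<in> UNIV - {0}" "X \<longlonglongrightarrow> 0"
    then obtain N where N: "\<And>n. n \<ge> N \<Longrightarrow> \<bar>X n\<bar> < 1"
      using LIMSEQ_D[of X 0 1] by auto
    show "(\<lambda>n. ((\<integral>y. H (a0 + X n) y \<partial>M) - (\<integral>y. H a0 y \<partial>M)) / X n) \<longlonglongrightarrow> (\<integral>y. H' a0 y \<partial>M)"
      by (rule LIMSEQ_offset[of _ N], rule lim) (use X N in \<open>auto intro: LIMSEQ_ignore_initial_segment\<close>)
  qed
  then show ?thesis
    by (simp add: DERIV_def)
qed

section \<open>Compactly supported smooth functions and their bounds\<close>

definition smooth_compact :: "(real \<Rightarrow> real) \<Rightarrow> bool" where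
  "smooth_compact f \<longleftrightarrow> smooth_real f \<and> (\<exists>R. \<forall>x. R < \<bar>x\<bar> \<longrightarrow> f x = 0)"

lemma DERIV_eq_0_of_vanishing:
  fixes f :: "real \<Rightarrow> real"
  assumes "(f has_real_derivative D) (at x)" "open U" "x \<in> U" "\<And>y. y \<in> U \<Longrightarrow> f y = 0"
  shows "D = 0"
proof -
  have "((\<lambda>_. 0) has_real_derivative D) (at x)"
    by (rule has_field_derivative_transform_within_open[OF assms(1,2,3)]) (use assms(4) in auto)
  then show ?thesis
    using DERIV_unique DERIV_const by blast
qed

lemma smooth_compact_deriv:
  assumes "smooth_compact f"
  obtains f' where "smooth_compact f'" "\<And>x. (f has_real_derivative f' x) (at x)"
proof -
  obtain R where R: "smooth_real f" "\<And>x. R < \<bar>x\<bar> \<Longrightarrow> f x = 0"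
    using assms unfolding smooth_compact_def by blast
  obtain f' where f': "smooth_real f'" "\<And>x. (f has_real_derivative f' x) (at x)"
    using smooth_real_deriv[OF R(1)] by blast
  have "f' x = 0" if "R < \<bar>x\<bar>" for x
    by (rule DERIV_eq_0_of_vanishing[OF f'(2), of "{x. R < \<bar>x\<bar>}"])
       (use that R in \<open>auto intro!: open_Collect_less continuous_intros\<close>)
  then show ?thesis
    using f' that unfolding smooth_compact_def by blast
qed

lemma smooth_real_continuous:
  assumes "smooth_real f" shows "continuous_on A f"
  using assms by (metis smooth_real_deriv DERIV_isCont continuous_at_imp_continuous_on)

lemma bounded_if_compact_support:
  fixes g :: "'a::euclidean_space \<Rightarrow> real"
  assumes g: "continuous_on UNIV g" "\<And>z. R < norm z \<Longrightarrow> g z = 0"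
  obtains M where "\<And>z. \<bar>g z\<bar> \<le> M" "M \<ge> 0"
proof -
  have "compact (g ` cball 0 R)"
    by (intro compact_continuous_image continuous_on_subset[OF g(1)]) auto
  then obtain M where M: "\<forall>y\<in>g ` cball 0 R. norm y \<le> M"
    using compact_imp_bounded bounded_iff by blast
  have "\<bar>g z\<bar> \<le> max M 0" for z
    using M g(2)[of z] by (cases "R < norm z") (auto simp: le_max_iff_disj)
  then show ?thesis
    using that[of "max M 0"] by auto
qed

lemma smooth_compact_bounded:
  assumes "smooth_compact f"
  obtains M where "\<And>x. \<bar>f x\<bar> \<le> M" "M \<ge> 0"
proof -
  obtain R where R: "smooth_real f" "\<And>x. R < \<bar>x\<bar> \<Longrightarrow> f x = 0"
    using assms unfolding smooth_compact_def by blast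
  have "continuous_on UNIV f" "\<And>x. R < norm x \<Longrightarrow> f x = 0"
    using R smooth_real_continuous by auto
  from bounded_if_compact_support[OF this] show ?thesis
    using that by blast
qed

lemma continuous_on_tensor:
  assumes "smooth_real \<alpha>" "smooth_real \<beta>" "smooth_real \<gamma>"
  shows "continuous_on A (tensor \<alpha> \<beta> \<gamma>)"
  unfolding tensor_def
  by (intro continuous_intros continuous_on_compose2[OF smooth_real_continuous[OF assms(1), of UNIV]]
      continuous_on_compose2[OF smooth_real_continuous[OF assms(2), of UNIV]]
      continuous_on_compose2[OF smooth_real_continuous[OF assms(3), of UNIV]]) auto

lemma tensor_bounded:
  assumes "smooth_compact \<alpha>" "smooth_compact \<beta>" "smooth_compact \<gamma>"
  obtains M where "\<And>z. \<bar>tensor \<alpha> \<beta> \<gamma> z\<bar> \<le> M" "M \<ge> 0"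
proof -
  obtain A B C where "\<And>x. \<bar>\<alpha> x\<bar> \<le> A" "A \<ge> 0" "\<And>x. \<bar>\<beta> x\<bar> \<le> B" "B \<ge> 0" "\<And>x. \<bar>\<gamma> x\<bar> \<le> C" "C \<ge> 0"
    using assms smooth_compact_bounded by metis
  then show ?thesis
    by (intro that[of "A * B * C"]) (auto simp: tensor_def abs_mult intro!: mult_mono)
qed

lemma tensor_compact_support:
  assumes "smooth_compact \<alpha>" "smooth_compact \<beta>" "smooth_compact \<gamma>"
  obtains R where "\<And>z. R < norm z \<Longrightarrow> tensor \<alpha> \<beta> \<gamma> z = 0"
proof -
  obtain A B C where ABC: "\<And>x. A < \<bar>x\<bar> \<Longrightarrow> \<alpha> x = 0" "\<And>x. B < \<bar>x\<bar> \<Longrightarrow> \<beta> x = 0" "\<And>x. C < \<bar>x\<bar> \<Longrightarrow> \<gamma> x = 0"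
    using assms unfolding smooth_compact_def by metis
  have "tensor \<alpha> \<beta> \<gamma> z = 0" if "A + B + C < norm z" for z
  proof -
    have "norm z \<le> norm (fst z) + norm (snd z)"
      by (metis norm_Pair_le prod.collapse)
    also have "\<dots> \<le> \<bar>Re (fst z)\<bar> + \<bar>Im (fst z)\<bar> + \<bar>snd z\<bar>"
      using cmod_le[of "fst z"] by simp
    finally have "A < \<bar>Re (fst z)\<bar> \<or> B < \<bar>Im (fst z)\<bar> \<or> C < \<bar>snd z\<bar>"
      using that by linarith
    then show ?thesis
      using ABC by (auto simp: tensor_def)
  qed
  then show ?thesis
    using that by blast
qed

lemma tensor_measurable [measurable]:
  assumes "smooth_real \<alpha>" "smooth_real \<beta>" "smooth_real \<gamma>"
  shows "tensor \<alpha> \<beta> \<gamma> \<in> borel_measurable borel"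
  using continuous_on_tensor[OF assms] by (rule borel_measurable_continuous_onI)

lemma integrable_mult_bounded:
  fixes f g :: "'b \<Rightarrow> real"
  assumes "integrable M f" "g \<in> borel_measurable M" "\<And>x. \<bar>g x\<bar> \<le> C"
  shows "integrable M (\<lambda>x. f x * g x)"
proof (rule Bochner_Integration.integrable_bound)
  show "integrable M (\<lambda>x. C * f x)"
    using assms(1) by simp
  show "AE x in M. norm (f x * g x) \<le> norm (C * f x)"
  proof (intro always_eventually allI)
    fix x
    have "\<bar>g x\<bar> * \<bar>f x\<bar> \<le> \<bar>C\<bar> * \<bar>f x\<bar>"
      using assms(3)[of x] by (intro mult_right_mono) auto
    then show "norm (f x * g x) \<le> norm (C * f x)"
      by (simp add: abs_mult mult_ac)
  qed
qed (use assms in auto)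

section \<open>Mollification of integrable functions\<close>

definition convolve :: "(complex \<times> real \<Rightarrow> real) \<Rightarrow> (complex \<times> real \<Rightarrow> real) \<Rightarrow> complex \<times> real \<Rightarrow> real" where
  "convolve Z \<eta> w = (\<integral>y. Z y * \<eta> (w - y) \<partial>lborel)"

lemma integrable_convolve:
  assumes "integrable lborel Z" and \<eta>: "smooth_compact \<alpha>" "smooth_compact \<beta>" "smooth_compact \<gamma>"
  shows "integrable lborel (\<lambda>y. Z y * tensor \<alpha> \<beta> \<gamma> (w - y))"
proof -
  obtain M where M: "\<And>z. \<bar>tensor \<alpha> \<beta> \<gamma> z\<bar> \<le> M"
    using tensor_bounded[OF \<eta>] by blast
  have [measurable]: "tensor \<alpha> \<beta> \<gamma> \<in> borel_measurable borel"
    using \<eta> by (intro tensor_measurable) (auto simp: smooth_compact_def)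
  show ?thesis
    by (rule integrable_mult_bounded[OF assms(1) _ M]) simp
qed

lemma convolve_continuous:
  assumes Z: "integrable lborel Z" and \<eta>: "smooth_compact \<alpha>" "smooth_compact \<beta>" "smooth_compact \<gamma>"
  shows "continuous_on A (convolve Z (tensor \<alpha> \<beta> \<gamma>))"
  unfolding continuous_on_sequentially comp_def
proof (intro ballI allI impI)
  fix w X assume "w \<in> A" "(\<forall>n. X n \<in> A) \<and> X \<longlonglongrightarrow> w"
  then have X: "X \<longlonglongrightarrow> w" by simp
  obtain M where M: "\<And>z. \<bar>tensor \<alpha> \<beta> \<gamma> z\<bar> \<le> M"
    using tensor_bounded[OF \<eta>] by blast
  have cont: "continuous_on UNIV (tensor \<alpha> \<beta> \<gamma>)"
    using \<eta> by (intro continuous_on_tensor) (auto simp: smooth_compact_def)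
  show "(\<lambda>n. convolve Z (tensor \<alpha> \<beta> \<gamma>) (X n)) \<longlonglongrightarrow> convolve Z (tensor \<alpha> \<beta> \<gamma>) w"
    unfolding convolve_def
  proof (rule integral_dominated_convergence)
    show "integrable lborel (\<lambda>y. M * \<bar>Z y\<bar>)"
      using Z by simp
    show "AE y in lborel. (\<lambda>n. Z y * tensor \<alpha> \<beta> \<gamma> (X n - y)) \<longlonglongrightarrow> Z y * tensor \<alpha> \<beta> \<gamma> (w - y)"
      by (intro always_eventually allI tendsto_mult tendsto_const
          continuous_on_tendsto_compose[OF cont] tendsto_diff X) auto
    show "AE y in lborel. norm (Z y * tensor \<alpha> \<beta> \<gamma> (X n - y)) \<le> M * \<bar>Z y\<bar>" for n
      using M by (intro always_eventually allI) (simp add: abs_mult mult.commute[of "\<bar>Z _\<bar>"] mult_right_mono)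
  qed (use integrable_convolve[OF assms] in \<open>auto dest: borel_measurable_integrable\<close>)
qed

text \<open>All derivatives fall on the kernel, so integrability of \<open>Z\<close> suffices. The
  differentiated kernel is a free tensor, so one statement covers the time direction, both space
  directions and second derivatives.\<close>

lemma convolve_derivative:
  assumes Z: "integrable lborel Z" and \<eta>: "smooth_compact \<alpha>" "smooth_compact \<beta>" "smooth_compact \<gamma>"
    and \<eta>': "smooth_compact \<alpha>'" "smooth_compact \<beta>'" "smooth_compact \<gamma>'"
    and der: "\<And>z. ((\<lambda>a. tensor \<alpha> \<beta> \<gamma> (z + a *\<^sub>R v)) has_real_derivative tensor \<alpha>' \<beta>' \<gamma>' z) (at 0)"
  shows "((\<lambda>a. convolve Z (tensor \<alpha> \<beta> \<gamma>) (w + a *\<^sub>R v)) has_real_derivative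
    convolve Z (tensor \<alpha>' \<beta>' \<gamma>') w) (at 0)"
proof -
  obtain M where M: "\<And>z. \<bar>tensor \<alpha>' \<beta>' \<gamma>' z\<bar> \<le> M"
    using tensor_bounded[OF \<eta>'] by blast
  have der_a: "((\<lambda>a. tensor \<alpha> \<beta> \<gamma> (z + a *\<^sub>R v)) has_real_derivative tensor \<alpha>' \<beta>' \<gamma>' (z + a *\<^sub>R v)) (at a)" for z a
    using der[of "z + a *\<^sub>R v"] DERIV_shift[of "\<lambda>a. tensor \<alpha> \<beta> \<gamma> (z + a *\<^sub>R v)" _ 0 a]
    by (simp add: algebra_simps)
  have "((\<lambda>a. \<integral>y. Z y * tensor \<alpha> \<beta> \<gamma> (w + a *\<^sub>R v - y) \<partial>lborel) has_real_derivative
    (\<integral>y. Z y * tensor \<alpha>' \<beta>' \<gamma>' (w + 0 *\<^sub>R v - y) \<partial>lborel)) (at 0)"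
  proof (rule has_real_derivative_integral)
    show "integrable lborel (\<lambda>y. Z y * tensor \<alpha> \<beta> \<gamma> (w + a *\<^sub>R v - y))" for a
      by (rule integrable_convolve[OF Z \<eta>])
    show "((\<lambda>a. Z y * tensor \<alpha> \<beta> \<gamma> (w + a *\<^sub>R v - y)) has_real_derivative
        Z y * tensor \<alpha>' \<beta>' \<gamma>' (w + a *\<^sub>R v - y)) (at a)" for a y
      using der_a[of "w - y" a] by (intro DERIV_cmult) (simp add: algebra_simps)
    show "\<bar>Z y * tensor \<alpha>' \<beta>' \<gamma>' (w + a *\<^sub>R v - y)\<bar> \<le> M * \<bar>Z y\<bar>" for a y
      using M by (simp add: abs_mult mult.commute[of "\<bar>Z _\<bar>"] mult_right_mono)
  qed (use Z in simp)
  then show ?thesis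
    by (simp add: convolve_def)
qed

lemma tensor_line_derivative:
  assumes "\<And>x. (\<alpha> has_real_derivative \<alpha>' x) (at x)" "\<And>x. (\<beta> has_real_derivative \<beta>' x) (at x)"
    "\<And>x. (\<gamma> has_real_derivative \<gamma>' x) (at x)"
  shows "((\<lambda>a. tensor \<alpha> \<beta> \<gamma> (z + a *\<^sub>R (1, 0))) has_real_derivative tensor \<alpha>' \<beta> \<gamma> z) (at 0)"
    "((\<lambda>a. tensor \<alpha> \<beta> \<gamma> (z + a *\<^sub>R (\<i>, 0))) has_real_derivative tensor \<alpha> \<beta>' \<gamma> z) (at 0)"
    "((\<lambda>a. tensor \<alpha> \<beta> \<gamma> (z + a *\<^sub>R (0, 1))) has_real_derivative tensor \<alpha> \<beta> \<gamma>' z) (at 0)"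
proof -
  have "((\<lambda>a. f (x + a)) has_real_derivative f' x) (at 0)"
    if "\<And>x. (f has_real_derivative f' x) (at x)" for f f' :: "real \<Rightarrow> real" and x
    using that[of "x + 0"] DERIV_shift[of f "f' (x + 0)" 0 x] by (simp add: add.commute)
  note this[OF assms(1)] this[OF assms(2)] this[OF assms(3)]
  then show
    "((\<lambda>a. tensor \<alpha> \<beta> \<gamma> (z + a *\<^sub>R (1, 0))) has_real_derivative tensor \<alpha>' \<beta> \<gamma> z) (at 0)"
    "((\<lambda>a. tensor \<alpha> \<beta> \<gamma> (z + a *\<^sub>R (\<i>, 0))) has_real_derivative tensor \<alpha> \<beta>' \<gamma> z) (at 0)"
    "((\<lambda>a. tensor \<alpha> \<beta> \<gamma> (z + a *\<^sub>R (0, 1))) has_real_derivative tensor \<alpha> \<beta> \<gamma>' z) (at 0)"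
    by (auto simp: tensor_def intro!: derivative_eq_intros)
qed

section \<open>Integration by parts in space from translation invariance\<close>

lemma integral_translation_lborel:
  fixes f :: "'a::euclidean_space \<Rightarrow> real"
  assumes [measurable]: "f \<in> borel_measurable borel"
  shows "(\<integral>z. f (z + v) \<partial>lborel) = (\<integral>z. f z \<partial>lborel)"
  by (subst (2) lborel_distr_plus[of v, symmetric], subst integral_distr) (auto simp: add.commute)

lemma integrable_indicator_cball:
  "integrable lborel (indicator (cball c r) :: 'a::euclidean_space \<Rightarrow> real)"
  by (intro integrable_real_indicator emeasure_bounded_finite bounded_cball) simp

text \<open>A weight \<open>k\<close> in time does not see a spatial translation, so the integral of
  \<open>k\<close> times the translate of \<open>h\<close> is constant in the shift; its derivative
  at shift 0 is the integral in question. The weight may jump, as the later cutoff at time 0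
  does.\<close>

lemma integral_line_derivative_eq_0:
  fixes h h' :: "complex \<times> real \<Rightarrow> real"
  assumes h: "continuous_on UNIV h" "continuous_on UNIV h'"
    and supp: "\<And>z. R < norm z \<Longrightarrow> h z = 0" "\<And>z. R < norm z \<Longrightarrow> h' z = 0"
    and der: "\<And>z. ((\<lambda>a. h (z + a *\<^sub>R (d, 0))) has_real_derivative h' z) (at 0)"
    and k[measurable]: "k \<in> borel_measurable borel" and kC: "\<And>t. \<bar>k t\<bar> \<le> C"
  shows "(\<integral>z. k (snd z) * h' z \<partial>lborel) = 0"
proof -
  have [measurable]: "h \<in> borel_measurable borel" "h' \<in> borel_measurable borel"
    using h by (auto intro: borel_measurable_continuous_onI)
  obtain M where M: "\<And>z. \<bar>h z\<bar> \<le> M" using bounded_if_compact_support[OF h(1) supp(1)] by blast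
  obtain M' where M': "\<And>z. \<bar>h' z\<bar> \<le> M'" using bounded_if_compact_support[OF h(2) supp(2)] by blast
  have C: "C \<ge> 0" "M \<ge> 0" "M' \<ge> 0"
    using kC[of 0] M[of 0] M'[of 0] by auto
  have der_a: "((\<lambda>a. h (z + a *\<^sub>R (d, 0))) has_real_derivative h' (z + a *\<^sub>R (d, 0))) (at a)" for z a
    using der[of "z + a *\<^sub>R (d, 0)"] DERIV_shift[of "\<lambda>a. h (z + a *\<^sub>R (d, 0))" _ 0 a]
    by (simp add: algebra_simps flip: zero_prod_def)
  have int_ind: "integrable lborel (\<lambda>z. c * indicator (cball (0::complex \<times> real) r) z :: real)" for c r
    by (intro integrable_mult_right integrable_indicator_cball)
  have [measurable]: "(\<lambda>z::complex \<times> real. k (snd z)) \<in> borel_measurable borel"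
    by (rule measurable_compose[OF borel_measurable_continuous_onI k]) (intro continuous_intros)
  have [measurable]: "(\<lambda>z. h (z + v)) \<in> borel_measurable borel" for v
    using h by (intro borel_measurable_continuous_onI continuous_on_compose2[OF h(1)] continuous_intros) auto
  let ?H = "\<lambda>a z. k (snd z) * h (z + a *\<^sub>R (d, 0))"
  have const: "(\<integral>z. ?H a z \<partial>lborel) = (\<integral>z. k (snd z) * h z \<partial>lborel)" for a
    using integral_translation_lborel[of "\<lambda>z. k (snd z) * h z" "a *\<^sub>R (d, 0)"]
    by (simp add: borel_measurable_times del: scaleR_Pair)
  have "((\<lambda>a. \<integral>z. ?H a z \<partial>lborel) has_real_derivative (\<integral>z. k (snd z) * h' (z + 0 *\<^sub>R (d, 0)) \<partial>lborel)) (at 0)"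
  \<comment> \<open>For shifts of size below 1 all supports stay in the ball of radius
    \<open>R + norm d\<close>, which yields one dominating function.\<close>
  proof (rule has_real_derivative_integral[where H' = "\<lambda>a z. k (snd z) * h' (z + a *\<^sub>R (d, 0))"
        and B = "\<lambda>z. C * M' * indicator (cball 0 (R + norm d)) z"])
    show "integrable lborel (?H a)" for a
    proof (rule Bochner_Integration.integrable_bound[OF int_ind])
      show "AE z in lborel. norm (?H a z) \<le> norm (C * M * indicator (cball 0 (R + norm (a *\<^sub>R (d, 0::real)))) z)"
      proof (intro always_eventually allI)
        fix z
        show "norm (?H a z) \<le> norm (C * M * indicator (cball 0 (R + norm (a *\<^sub>R (d, 0::real)))) z)"
        proof (cases "R < norm (z + a *\<^sub>R (d, 0))")
          case True
          then show ?thesis using supp by (simp del: scaleR_Pair)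
        next
          case False
          then have "z \<in> cball 0 (R + norm (a *\<^sub>R (d, 0::real)))"
            using norm_triangle_ineq4[of "z + a *\<^sub>R (d, 0::real)" "a *\<^sub>R (d, 0)"] by simp
          then show ?thesis
            using kC M C mult_mono[OF kC[of "snd z"] M[of "z + a *\<^sub>R (d, 0)"]] by (simp add: abs_mult del: scaleR_Pair)
        qed
      qed
    qed (simp del: scaleR_Pair)
    show "(((\<lambda>a. ?H a z)) has_real_derivative k (snd z) * h' (z + a *\<^sub>R (d, 0))) (at a)" for a z
      by (intro DERIV_cmult der_a)
    show "\<bar>k (snd z) * h' (z + a *\<^sub>R (d, 0))\<bar> \<le> C * M' * indicator (cball 0 (R + norm d)) z"
      if a: "\<bar>a - 0\<bar> < 1" for a z
    proof (cases "R < norm (z + a *\<^sub>R (d, 0))")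
      case True
      then show ?thesis using supp C by (simp del: scaleR_Pair)
    next
      case False
      have "norm (a *\<^sub>R (d, 0::real)) \<le> norm d"
        using a mult_left_le_one_le[of "norm d" "\<bar>a\<bar>"] by (simp add: norm_Pair)
      then have "z \<in> cball 0 (R + norm d)"
        using False norm_triangle_ineq4[of "z + a *\<^sub>R (d, 0::real)" "a *\<^sub>R (d, 0)"]
        by (simp del: scaleR_Pair)
      then show ?thesis
        using kC M' C mult_mono[OF kC[of "snd z"] M'[of "z + a *\<^sub>R (d, 0)"]] by (simp add: abs_mult del: scaleR_Pair)
    qed
    show "integrable lborel (\<lambda>z. C * M' * indicator (cball (0::complex \<times> real) (R + norm d)) z)"
      by (rule int_ind)
  qed
  then have "((\<lambda>_. \<integral>z. k (snd z) * h z \<partial>lborel) has_real_derivative (\<integral>z. k (snd z) * h' z \<partial>lborel)) (at 0)"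
    by (simp only: const scaleR_zero_left add_0_right)
  then show ?thesis
    using DERIV_unique DERIV_const by blast
qed

lemma borel_measurable_comp_snd:
  fixes k :: "real \<Rightarrow> real"
  assumes "k \<in> borel_measurable borel"
  shows "(\<lambda>z::complex \<times> real. k (snd z)) \<in> borel_measurable borel"
  by (rule measurable_compose[OF borel_measurable_continuous_onI assms]) (intro continuous_intros)

lemma borel_measurable_comp_fst:
  fixes f :: "complex \<Rightarrow> real"
  assumes "f \<in> borel_measurable borel"
  shows "(\<lambda>z::complex \<times> real. f (fst z)) \<in> borel_measurable borel"
  by (rule measurable_compose[OF borel_measurable_continuous_onI assms]) (intro continuous_intros)

lemma integrable_times_compact_support:
  fixes g :: "complex \<times> real \<Rightarrow> real"
  assumes g: "continuous_on UNIV g" "\<And>z. R < norm z \<Longrightarrow> g z = 0"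
    and k: "k \<in> borel_measurable borel" and kC: "\<And>t. \<bar>k t\<bar> \<le> C"
  shows "integrable lborel (\<lambda>z. k (snd z) * g z)"
proof -
  obtain M where M: "\<And>z. \<bar>g z\<bar> \<le> M" "M \<ge> 0"
    using bounded_if_compact_support[OF g] by blast
  have [measurable]: "g \<in> borel_measurable borel"
    using g(1) by (rule borel_measurable_continuous_onI)
  have "integrable lborel (\<lambda>z. indicator (cball 0 R) z * (k (snd z) * g z))"
  proof (rule integrable_mult_bounded)
    show "integrable lborel (indicator (cball (0::complex \<times> real) R) :: _ \<Rightarrow> real)"
      by (rule integrable_indicator_cball)
    show "(\<lambda>z. k (snd z) * g z) \<in> borel_measurable lborel"
      using borel_measurable_comp_snd[OF k] by simp
    show "\<bar>k (snd z) * g z\<bar> \<le> C * M" for z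
      using mult_mono[OF kC[of "snd z"] M(1)[of z]] kC[of 0] by (simp add: abs_mult)
  qed
  moreover have "indicator (cball 0 R) z * (k (snd z) * g z) = k (snd z) * g z" for z
    using g(2)[of z] by (cases "R < norm z") auto
  ultimately show ?thesis
    by simp
qed

text \<open>Green's identity along a line: \<open>F * \<phi>'' - F'' * \<phi>\<close> is the
  derivative of the compactly supported \<open>F * \<phi>' - F' * \<phi>\<close>.\<close>

lemma integral_by_parts_line:
  fixes F F' F'' :: "complex \<Rightarrow> real" and \<phi> \<phi>' \<phi>'' :: "complex \<times> real \<Rightarrow> real"
  assumes cont: "continuous_on UNIV F" "continuous_on UNIV F'" "continuous_on UNIV F''"
      "continuous_on UNIV \<phi>" "continuous_on UNIV \<phi>'" "continuous_on UNIV \<phi>''"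
    and supp: "\<And>z. R < norm z \<Longrightarrow> \<phi> z = 0" "\<And>z. R < norm z \<Longrightarrow> \<phi>' z = 0" "\<And>z. R < norm z \<Longrightarrow> \<phi>'' z = 0"
    and F: "\<And>x. ((\<lambda>s. F (x + s *\<^sub>R d)) has_real_derivative F' x) (at 0)"
      "\<And>x. ((\<lambda>s. F' (x + s *\<^sub>R d)) has_real_derivative F'' x) (at 0)"
    and \<phi>: "\<And>z. ((\<lambda>s. \<phi> (z + s *\<^sub>R (d, 0))) has_real_derivative \<phi>' z) (at 0)"
      "\<And>z. ((\<lambda>s. \<phi>' (z + s *\<^sub>R (d, 0))) has_real_derivative \<phi>'' z) (at 0)"
    and k: "k \<in> borel_measurable borel" and kC: "\<And>t. \<bar>k t\<bar> \<le> C"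
  shows "(\<integral>z. k (snd z) * (F (fst z) * \<phi>'' z) \<partial>lborel) = (\<integral>z. k (snd z) * (F'' (fst z) * \<phi> z) \<partial>lborel)"
proof -
  have cont': "continuous_on UNIV (\<lambda>z::complex \<times> real. F (fst z))" "continuous_on UNIV (\<lambda>z::complex \<times> real. F' (fst z))"
    "continuous_on UNIV (\<lambda>z::complex \<times> real. F'' (fst z))"
    by (auto intro!: continuous_on_compose2[OF cont(1)] continuous_on_compose2[OF cont(2)]
        continuous_on_compose2[OF cont(3)] continuous_intros)
  have "(\<integral>z. k (snd z) * (F (fst z) * \<phi>'' z - F'' (fst z) * \<phi> z) \<partial>lborel) = 0"
  proof (rule integral_line_derivative_eq_0[where h = "\<lambda>z. F (fst z) * \<phi>' z - F' (fst z) * \<phi> z" and R = R])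
    show "((\<lambda>s. F (fst (z + s *\<^sub>R (d, 0))) * \<phi>' (z + s *\<^sub>R (d, 0)) - F' (fst (z + s *\<^sub>R (d, 0))) * \<phi> (z + s *\<^sub>R (d, 0)))
        has_real_derivative F (fst z) * \<phi>'' z - F'' (fst z) * \<phi> z) (at 0)" for z
      using F[of "fst z"] \<phi>[of z] by (auto intro!: derivative_eq_intros simp flip: zero_prod_def)
    show "R < norm z \<Longrightarrow> F (fst z) * \<phi>' z - F' (fst z) * \<phi> z = 0"
      "R < norm z \<Longrightarrow> F (fst z) * \<phi>'' z - F'' (fst z) * \<phi> z = 0" for z
      by (simp_all add: supp)
  qed (use cont cont' k kC in \<open>auto intro!: continuous_intros\<close>)
  moreover have "integrable lborel (\<lambda>z. k (snd z) * (F (fst z) * \<phi>'' z))"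
    by (rule integrable_times_compact_support[OF _ _ k kC, of _ R])
       (use cont cont' in \<open>auto intro!: continuous_intros simp: supp\<close>)
  moreover have "integrable lborel (\<lambda>z. k (snd z) * (F'' (fst z) * \<phi> z))"
    by (rule integrable_times_compact_support[OF _ _ k kC, of _ R])
       (use cont cont' in \<open>auto intro!: continuous_intros simp: supp\<close>)
  ultimately show ?thesis
    by (simp add: right_diff_distrib)
qed

text \<open>Along a line the squared modulus of an affine function is a quadratic polynomial in the
  parameter, so its second derivative is constant and the shift \<open>e\<close> drops out.\<close>

lemma line_derivative_cmod_affine:
  defines "S1 \<equiv> \<lambda>a b d x. 2 * (Re (a * x + b) * Re (a * d) + Im (a * x + b) * Im (a * d))"
  shows "((\<lambda>s. (cmod (a * (x + s *\<^sub>R d) + b))\<^sup>2 + e) has_real_derivative S1 a b d x) (at 0)"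
    "((\<lambda>s. S1 a b d (x + s *\<^sub>R d)) has_real_derivative 2 * (cmod (a * d))\<^sup>2) (at 0)"
proof -
  have Re_Im: "Re (a * (x + s *\<^sub>R d) + b) = Re (a * x + b) + s * Re (a * d)"
    "Im (a * (x + s *\<^sub>R d) + b) = Im (a * x + b) + s * Im (a * d)" for s
    by (simp_all add: algebra_simps scaleR_conv_of_real)
  show "((\<lambda>s. (cmod (a * (x + s *\<^sub>R d) + b))\<^sup>2 + e) has_real_derivative S1 a b d x) (at 0)"
    unfolding cmod_power2 Re_Im S1_def
    by (rule derivative_eq_intros refl | simp)+
  show "((\<lambda>s. S1 a b d (x + s *\<^sub>R d)) has_real_derivative 2 * (cmod (a * d))\<^sup>2) (at 0)"
    unfolding S1_def Re_Im
    by (rule derivative_eq_intros refl | simp)+ (simp add: cmod_power2, simp add: power2_eq_square)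
qed

text \<open>A nonnegative product test function bundled with the derivatives of its factors, so that
  \<open>lap\<close> and \<open>dt\<close> are built from tensors as well. The spatial rectangle
  lies in the open disk, while the time factor may be positive at time 0 and thus detects initial
  data.\<close>

locale box_test =
  fixes \<alpha> \<alpha>1 \<alpha>2 \<beta> \<beta>1 \<beta>2 \<gamma> \<gamma>1 :: "real \<Rightarrow> real" and l1 r1 l2 r2 :: real
  assumes \<alpha>_deriv: "\<And>x. (\<alpha> has_real_derivative \<alpha>1 x) (at x)" "\<And>x. (\<alpha>1 has_real_derivative \<alpha>2 x) (at x)"
    and \<beta>_deriv: "\<And>x. (\<beta> has_real_derivative \<beta>1 x) (at x)" "\<And>x. (\<beta>1 has_real_derivative \<beta>2 x) (at x)"
    and \<gamma>_deriv: "\<And>x. (\<gamma> has_real_derivative \<gamma>1 x) (at x)"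
    and smooth: "smooth_compact \<alpha>" "smooth_compact \<alpha>1" "smooth_compact \<alpha>2"
      "smooth_compact \<beta>" "smooth_compact \<beta>1" "smooth_compact \<beta>2" "smooth_compact \<gamma>" "smooth_compact \<gamma>1"
    and nonneg: "\<And>x. 0 \<le> \<alpha> x" "\<And>x. 0 \<le> \<beta> x" "\<And>x. 0 \<le> \<gamma> x"
    and vanish: "\<And>x. x \<notin> {l1..r1} \<Longrightarrow> \<alpha> x = 0" "\<And>x. x \<notin> {l2..r2} \<Longrightarrow> \<beta> x = 0"
    and disk: "\<And>a b. a \<in> {l1..r1} \<Longrightarrow> b \<in> {l2..r2} \<Longrightarrow> Complex a b \<in> ball 0 1"
begin

definition \<phi> where "\<phi> = tensor \<alpha> \<beta> \<gamma>"
definition lap where "lap z = tensor \<alpha>2 \<beta> \<gamma> z + tensor \<alpha> \<beta>2 \<gamma> z"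
definition dt where "dt = tensor \<alpha> \<beta> \<gamma>1"

lemma smooth_reals: "smooth_real \<alpha>" "smooth_real \<alpha>1" "smooth_real \<alpha>2"
      "smooth_real \<beta>" "smooth_real \<beta>1" "smooth_real \<beta>2" "smooth_real \<gamma>" "smooth_real \<gamma>1"
  using smooth by (auto simp: smooth_compact_def)

lemma \<phi>_nonneg: "0 \<le> \<phi> z"
  using nonneg by (simp add: \<phi>_def tensor_def)

lemma continuous: "continuous_on A \<phi>" "continuous_on A lap" "continuous_on A dt"
  unfolding \<phi>_def lap_def dt_def
  by (intro continuous_intros continuous_on_tensor smooth_reals)+

lemma measurable [measurable]: "\<phi> \<in> borel_measurable borel" "lap \<in> borel_measurable borel"
  "dt \<in> borel_measurable borel"
  using continuous by (auto intro: borel_measurable_continuous_onI)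

lemma support_disk:
  assumes "fst z \<notin> ball 0 1"
  shows "\<phi> z = 0" "lap z = 0" "dt z = 0"
proof -
  have vanish2: "f2 x = 0" if "\<And>x. (f has_real_derivative f1 x) (at x)" "\<And>x. (f1 has_real_derivative f2 x) (at x)"
    "\<And>x. x \<notin> {l..r} \<Longrightarrow> f x = 0" "x \<notin> {l..r}" for f f1 f2 and l r x :: real
  proof -
    have "f1 y = 0" if "y \<in> - {l..r}" for y
      using \<open>\<And>x. (f has_real_derivative f1 x) (at x)\<close>
      by (rule DERIV_eq_0_of_vanishing[of f _ y "- {l..r}"])
         (use that \<open>\<And>x. x \<notin> {l..r} \<Longrightarrow> f x = 0\<close> in auto)
    then show ?thesis
      by (intro DERIV_eq_0_of_vanishing[OF that(2), of "- {l..r}"]) (use that(4) in auto)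
  qed
  have "Re (fst z) \<notin> {l1..r1} \<or> Im (fst z) \<notin> {l2..r2}"
    using disk[of "Re (fst z)" "Im (fst z)"] assms by auto
  then have "\<alpha> (Re (fst z)) = 0 \<and> \<alpha>2 (Re (fst z)) = 0 \<or> \<beta> (Im (fst z)) = 0 \<and> \<beta>2 (Im (fst z)) = 0"
    using vanish2[OF \<alpha>_deriv vanish(1)] vanish2[OF \<beta>_deriv vanish(2)] vanish by blast
  then show "\<phi> z = 0" "lap z = 0" "dt z = 0"
    by (auto simp: \<phi>_def lap_def dt_def tensor_def)
qed

lemma support_time:
  obtains T where "T > 0" "\<And>z. T < \<bar>snd z\<bar> \<Longrightarrow> \<phi> z = 0 \<and> lap z = 0 \<and> dt z = 0"
proof -
  obtain R R' where R: "\<And>x. R < \<bar>x\<bar> \<Longrightarrow> \<gamma> x = 0" "\<And>x. R' < \<bar>x\<bar> \<Longrightarrow> \<gamma>1 x = 0"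
    using smooth(7,8) unfolding smooth_compact_def by blast
  show ?thesis
    by (rule that[of "\<bar>R\<bar> + \<bar>R'\<bar> + 1"]) (use R in \<open>auto simp: \<phi>_def lap_def dt_def tensor_def\<close>)
qed

lemma bounded:
  obtains M where "M \<ge> 0" "\<And>z. \<bar>\<phi> z\<bar> \<le> M" "\<And>z. \<bar>lap z\<bar> \<le> M" "\<And>z. \<bar>dt z\<bar> \<le> M"
proof -
  obtain A B C D where A: "\<And>z. \<bar>tensor \<alpha> \<beta> \<gamma> z\<bar> \<le> A" "A \<ge> 0" and B: "\<And>z. \<bar>tensor \<alpha>2 \<beta> \<gamma> z\<bar> \<le> B" "B \<ge> 0"
    and C: "\<And>z. \<bar>tensor \<alpha> \<beta>2 \<gamma> z\<bar> \<le> C" "C \<ge> 0" and D: "\<And>z. \<bar>tensor \<alpha> \<beta> \<gamma>1 z\<bar> \<le> D" "D \<ge> 0"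
    using smooth tensor_bounded by metis
  have "\<bar>lap z\<bar> \<le> A + B + C + D" for z
    using B(1)[of z] C(1)[of z] A D unfolding lap_def by linarith
  moreover have "\<bar>\<phi> z\<bar> \<le> A + B + C + D" "\<bar>dt z\<bar> \<le> A + B + C + D" for z
    using A(1)[of z] D(1)[of z] A(2) B(2) C(2) D(2) unfolding \<phi>_def dt_def by linarith+
  ultimately show ?thesis
    using A(2) B(2) C(2) D(2) by (intro that[of "A + B + C + D"]) auto
qed

text \<open>For \<open>S = |a x + b|^2 + e\<close> one has
  \<open>|grad S|^2 = 4 |a|^2 (S - e)\<close> and \<open>Laplacian S = 4 |a|^2\<close>, and the
  chain rule gives the factor on the right. With \<open>e > 0\<close>, \<open>S\<close> stays in the
  half-line where \<open>Q\<close> is differentiable, even at a zero of the affine function.\<close>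

lemma integral_radial_laplacian:
  fixes Q Q' Q'' :: "real \<Rightarrow> real" and a b :: complex and e :: real
  defines "S \<equiv> \<lambda>x. (cmod (a * x + b))\<^sup>2 + e"
  assumes e: "e > 0"
    and Q: "\<And>s. s > 0 \<Longrightarrow> (Q has_real_derivative Q' s) (at s)" "\<And>s. s > 0 \<Longrightarrow> (Q' has_real_derivative Q'' s) (at s)"
    and cont: "continuous_on {0<..} Q''"
    and k: "k \<in> borel_measurable borel" and kC: "\<And>t. \<bar>k t\<bar> \<le> C"
  shows "(\<integral>z. k (snd z) * (Q (S (fst z)) * lap z) \<partial>lborel) =
    (\<integral>z. k (snd z) * ((4 * (cmod a)\<^sup>2 * (Q'' (S (fst z)) * (S (fst z) - e) + Q' (S (fst z)))) * \<phi> z) \<partial>lborel)"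
proof -
  define S1 where "S1 d x = 2 * (Re (a * x + b) * Re (a * d) + Im (a * x + b) * Im (a * d))" for d x
  define F where "F x = Q (S x)" for x
  define F1 where "F1 d x = Q' (S x) * S1 d x" for d x
  define F2 where "F2 d x = Q'' (S x) * (S1 d x)\<^sup>2 + Q' (S x) * (2 * (cmod (a * d))\<^sup>2)" for d x
  have S_pos: "S x > 0" for x
    using e by (simp add: S_def add_nonneg_pos)
  have dS: "((\<lambda>s. S (x + s *\<^sub>R d)) has_real_derivative S1 d x) (at 0)" for x d
    unfolding S_def S1_def by (rule line_derivative_cmod_affine)
  have dS1: "((\<lambda>s. S1 d (x + s *\<^sub>R d)) has_real_derivative 2 * (cmod (a * d))\<^sup>2) (at 0)" for x d
    unfolding S1_def by (rule line_derivative_cmod_affine)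
  have dF: "((\<lambda>s. F (x + s *\<^sub>R d)) has_real_derivative F1 d x) (at 0)" for x d
    unfolding F_def F1_def using DERIV_chain2[OF _ dS, of Q _ x d] Q(1)[OF S_pos] by simp
  have dF1: "((\<lambda>s. F1 d (x + s *\<^sub>R d)) has_real_derivative F2 d x) (at 0)" for x d
  proof -
    have "((\<lambda>s. Q' (S (x + s *\<^sub>R d))) has_real_derivative Q'' (S x) * S1 d x) (at 0)"
      using DERIV_chain2[OF _ dS, of Q' _ x d] Q(2)[OF S_pos] by simp
    from DERIV_mult[OF this dS1[of d x]] show ?thesis
      unfolding F1_def F2_def by (simp add: power2_eq_square mult_ac)
  qed
  have contS: "continuous_on UNIV S" "continuous_on UNIV (S1 d)" for d
    unfolding S_def S1_def by (intro continuous_intros)+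
  have contQ: "continuous_on {0<..} Q" "continuous_on {0<..} Q'"
    using Q by (auto intro!: continuous_at_imp_continuous_on DERIV_isCont)
  have contQS: "continuous_on UNIV (\<lambda>x. Q (S x))" "continuous_on UNIV (\<lambda>x. Q' (S x))" "continuous_on UNIV (\<lambda>x. Q'' (S x))"
    using S_pos by (auto intro: continuous_on_compose2[OF contQ(1) contS(1)]
        continuous_on_compose2[OF contQ(2) contS(1)] continuous_on_compose2[OF cont contS(1)])
  have contF: "continuous_on UNIV F" "continuous_on UNIV (F1 d)" "continuous_on UNIV (F2 d)" for d
    unfolding F_def F1_def F2_def by (intro continuous_intros contQS contS)+
  \<comment> \<open>The squares of the derivatives along 1 and along the imaginary unit add up by
    the two-square identity
    \<open>(u a + v b)^2 + (v a - u b)^2 = (u^2 + v^2) (a^2 + b^2)\<close>.\<close>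
  have lap_F: "F2 1 x + F2 \<i> x = 4 * (cmod a)\<^sup>2 * (Q'' (S x) * (S x - e) + Q' (S x))" for x
  proof -
    define u v where "u = Re (a * x + b)" and "v = Im (a * x + b)"
    have "S1 1 x = 2 * (u * Re a + v * Im a)" "S1 \<i> x = 2 * (v * Re a - u * Im a)"
      by (simp_all add: S1_def u_def v_def)
    moreover have "S x - e = u\<^sup>2 + v\<^sup>2"
      unfolding S_def cmod_power2 u_def v_def by simp
    ultimately have eq: "(S1 1 x)\<^sup>2 + (S1 \<i> x)\<^sup>2 = 4 * (cmod a)\<^sup>2 * (S x - e)"
      by (simp only: cmod_power2[of a]) (simp add: power2_eq_square algebra_simps)
    have "(cmod (a * \<i>))\<^sup>2 = (cmod a)\<^sup>2"
      by (simp add: norm_mult)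
    moreover have "F2 1 x + F2 \<i> x = Q'' (S x) * ((S1 1 x)\<^sup>2 + (S1 \<i> x)\<^sup>2) +
        Q' (S x) * (2 * (cmod a)\<^sup>2 + 2 * (cmod (a * \<i>))\<^sup>2)"
      by (simp add: F2_def algebra_simps)
    ultimately show ?thesis
      unfolding eq by (simp add: distrib_left mult_ac)
  qed
  obtain R1 where R1: "\<And>z. R1 < norm z \<Longrightarrow> tensor \<alpha> \<beta> \<gamma> z = 0"
    using tensor_compact_support[OF smooth(1,4,7)] by blast
  obtain R2 where R2: "\<And>z. R2 < norm z \<Longrightarrow> tensor \<alpha>1 \<beta> \<gamma> z = 0"
    using tensor_compact_support[OF smooth(2,4,7)] by blast
  obtain R3 where R3: "\<And>z. R3 < norm z \<Longrightarrow> tensor \<alpha>2 \<beta> \<gamma> z = 0"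
    using tensor_compact_support[OF smooth(3,4,7)] by blast
  obtain R4 where R4: "\<And>z. R4 < norm z \<Longrightarrow> tensor \<alpha> \<beta>1 \<gamma> z = 0"
    using tensor_compact_support[OF smooth(1,5,7)] by blast
  obtain R5 where R5: "\<And>z. R5 < norm z \<Longrightarrow> tensor \<alpha> \<beta>2 \<gamma> z = 0"
    using tensor_compact_support[OF smooth(1,6,7)] by blast
  define R where "R = max R1 (max R2 (max R3 (max R4 R5)))"
  note cont_tensor = continuous_on_tensor smooth_reals
  have I1: "(\<integral>z. k (snd z) * (F (fst z) * tensor \<alpha>2 \<beta> \<gamma> z) \<partial>lborel) = (\<integral>z. k (snd z) * (F2 1 (fst z) * \<phi> z) \<partial>lborel)"
    unfolding \<phi>_def
    by (rule integral_by_parts_line[where R = R and F' = "F1 1" and d = 1 and \<phi>' = "tensor \<alpha>1 \<beta> \<gamma>" and C = C])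
       (auto intro!: contF cont_tensor dF dF1 tensor_line_derivative \<alpha>_deriv \<beta>_deriv \<gamma>_deriv k kC simp: R1 R2 R3 R_def simp del: scaleR_Pair)
  have I2: "(\<integral>z. k (snd z) * (F (fst z) * tensor \<alpha> \<beta>2 \<gamma> z) \<partial>lborel) = (\<integral>z. k (snd z) * (F2 \<i> (fst z) * \<phi> z) \<partial>lborel)"
    unfolding \<phi>_def
    by (rule integral_by_parts_line[where R = R and F' = "F1 \<i>" and d = \<i> and \<phi>' = "tensor \<alpha> \<beta>1 \<gamma>" and C = C])
       (auto intro!: contF cont_tensor dF dF1 tensor_line_derivative \<alpha>_deriv \<beta>_deriv \<gamma>_deriv k kC simp: R1 R4 R5 R_def simp del: scaleR_Pair)
  have int: "integrable lborel (\<lambda>z. k (snd z) * (G (fst z) * g z))"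
    if "continuous_on UNIV G" "continuous_on UNIV g" "\<And>z. R < norm z \<Longrightarrow> g z = 0"
    for G :: "complex \<Rightarrow> real" and g :: "complex \<times> real \<Rightarrow> real"
    by (rule integrable_times_compact_support[OF _ _ k kC, of _ R])
       (use that in \<open>auto intro!: continuous_intros continuous_on_compose2[OF that(1)]\<close>)
  have "(\<integral>z. k (snd z) * (Q (S (fst z)) * lap z) \<partial>lborel) =
    (\<integral>z. k (snd z) * (F (fst z) * tensor \<alpha>2 \<beta> \<gamma> z) + k (snd z) * (F (fst z) * tensor \<alpha> \<beta>2 \<gamma> z) \<partial>lborel)"
    by (simp add: F_def lap_def algebra_simps)
  also have "\<dots> = (\<integral>z. k (snd z) * (F2 1 (fst z) * \<phi> z) \<partial>lborel) + (\<integral>z. k (snd z) * (F2 \<i> (fst z) * \<phi> z) \<partial>lborel)"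
    by (subst Bochner_Integration.integral_add)
       (use I1 I2 R3 R5 in \<open>auto intro!: int contF cont_tensor simp: R_def\<close>)
  also have "\<dots> = (\<integral>z. k (snd z) * (F2 1 (fst z) * \<phi> z) + k (snd z) * (F2 \<i> (fst z) * \<phi> z) \<partial>lborel)"
    by (subst Bochner_Integration.integral_add)
       (use R1 in \<open>auto intro!: int contF cont_tensor simp: R_def \<phi>_def\<close>)
  also have "\<dots> = (\<integral>z. k (snd z) * ((F2 1 (fst z) + F2 \<i> (fst z)) * \<phi> z) \<partial>lborel)"
    by (simp add: algebra_simps)
  finally show ?thesis
    by (simp add: lap_F)
qed

end

section \<open>Integrability and limits against test functions in the space-time cylinder\<close>

lemma integrable_lborel_prod_mult:
  fixes f :: "complex \<Rightarrow> real" and g :: "real \<Rightarrow> real"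
  assumes f: "integrable lborel f" and g: "integrable lborel g"
  shows "integrable lborel (\<lambda>z. f (fst z) * g (snd z))"
proof -
  have [measurable]: "f \<in> borel_measurable lborel" "g \<in> borel_measurable lborel"
    using f g by auto
  have "integrable (lborel \<Otimes>\<^sub>M lborel) (\<lambda>z. f (fst z) * g (snd z))"
    by (rule lborel_pair.Fubini_integrable) (use f g in \<open>auto simp: abs_mult\<close>)
  then show ?thesis
    by (simp add: lborel_prod)
qed

text \<open>A planar null set times the whole time axis is null, since 0 times infinity is 0. This
  carries exceptional points in the disk over to space-time.\<close>

lemma AE_lborel_fst:
  assumes "AE x in lborel. P x"
  shows "AE z in (lborel :: (complex \<times> real) measure). P (fst z)"
proof -
  obtain N where N: "N \<in> null_sets lborel" "{x. \<not> P x} \<subseteq> N"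
    using assms by (auto simp: eventually_ae_filter)
  have "emeasure (lborel \<Otimes>\<^sub>M (lborel :: real measure)) (N \<times> UNIV) = emeasure lborel N * emeasure (lborel :: real measure) UNIV"
    using N(1) by (intro lborel.emeasure_pair_measure_Times) (auto simp: null_sets_def)
  then have "N \<times> UNIV \<in> null_sets (lborel \<Otimes>\<^sub>M (lborel :: real measure))"
    using N(1) by (intro null_setsI) (auto simp: null_sets_def)
  then have "N \<times> UNIV \<in> null_sets (lborel :: (complex \<times> real) measure)"
    by (simp add: lborel_prod)
  then show ?thesis
    by (rule AE_I') (use N(2) in auto)
qed

text \<open>Common to \<open>\<phi>\<close>, \<open>lap\<close> and \<open>dt\<close>: domination by
  a constant on the disk times a bounded time window. Multiplication by such a function makes
  anything integrable on the disk integrable on space-time.\<close>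

definition box_supported :: "(complex \<times> real \<Rightarrow> real) \<Rightarrow> bool" where
  "box_supported \<psi> \<longleftrightarrow> \<psi> \<in> borel_measurable borel \<and>
    (\<exists>M T. M \<ge> 0 \<and> (\<forall>z. \<bar>\<psi> z\<bar> \<le> M * (indicator (ball 0 1) (fst z) * indicator {-T..T} (snd z))))"

lemma (in box_test) box_supported:
  "box_supported \<phi>" "box_supported lap" "box_supported dt"
proof -
  obtain T where T: "\<And>z. T < \<bar>snd z\<bar> \<Longrightarrow> \<phi> z = 0 \<and> lap z = 0 \<and> dt z = 0"
    using support_time by blast
  obtain M where M: "M \<ge> 0" "\<And>z. \<bar>\<phi> z\<bar> \<le> M" "\<And>z. \<bar>lap z\<bar> \<le> M" "\<And>z. \<bar>dt z\<bar> \<le> M"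
    using bounded by blast
  have supported: "box_supported \<psi>"
    if "\<psi> \<in> borel_measurable borel" "\<And>z. \<bar>\<psi> z\<bar> \<le> M" "\<And>z. fst z \<notin> ball 0 1 \<Longrightarrow> \<psi> z = 0"
      "\<And>z. T < \<bar>snd z\<bar> \<Longrightarrow> \<psi> z = 0" for \<psi>
  proof -
    have "\<bar>\<psi> z\<bar> \<le> M * (indicator (ball 0 1) (fst z) * indicator {-T..T} (snd z))" for z
      using that(2)[of z] that(3)[of z] that(4)[of z] M(1)
      by (cases "fst z \<in> ball 0 1"; cases "T < \<bar>snd z\<bar>"; cases "snd z \<in> {-T..T}") auto
    then show ?thesis
      unfolding box_supported_def using that(1) M(1) by (intro conjI exI[of _ M] exI[of _ T] allI)
  qed
  show "box_supported \<phi>"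
    by (rule supported) (simp_all add: measurable M support_disk T)
  show "box_supported lap"
    by (rule supported) (simp_all add: measurable M support_disk T)
  show "box_supported dt"
    by (rule supported) (simp_all add: measurable M support_disk T)
qed

lemma integrable_indicator_Icc: "integrable lborel (indicator {a..b::real} :: real \<Rightarrow> real)"
  by (intro integrable_real_indicator emeasure_bounded_finite bounded_closed_interval) simp

text \<open>Dominated convergence where pointwise limit and majorant \<open>f\<close> concern the
  space variable only; the bounded weight and the time window of \<open>\<psi>\<close> supply the
  rest of the majorant.\<close>

lemma tendsto_integral_box_supported:
  fixes F :: "nat \<Rightarrow> complex \<Rightarrow> real"
  assumes \<psi>: "box_supported \<psi>"
    and k[measurable]: "k \<in> borel_measurable borel" and kC: "\<And>t. \<bar>k t\<bar> \<le> C"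
    and F[measurable]: "\<And>n. F n \<in> borel_measurable borel" "G \<in> borel_measurable borel"
    and f: "set_integrable lborel (ball 0 1) f"
    and bound: "\<And>n. AE x in lborel. x \<in> ball 0 1 \<longrightarrow> \<bar>F n x\<bar> \<le> f x"
    and lim: "AE x in lborel. x \<in> ball 0 1 \<longrightarrow> (\<lambda>n. F n x) \<longlonglongrightarrow> G x"
  shows "(\<lambda>n. \<integral>z. k (snd z) * (F n (fst z) * \<psi> z) \<partial>lborel) \<longlonglongrightarrow> (\<integral>z. k (snd z) * (G (fst z) * \<psi> z) \<partial>lborel)"
proof -
  obtain M T where M: "M \<ge> 0" "\<And>z. \<bar>\<psi> z\<bar> \<le> M * (indicator (ball 0 1) (fst z) * indicator {-T..T} (snd z))"
    and \<psi>_meas: "\<psi> \<in> borel_measurable borel"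
    using \<psi> unfolding box_supported_def by blast
  have C: "C \<ge> 0" using kC[of 0] by simp
  have \<psi>0: "\<psi> z = 0" if "fst z \<notin> ball 0 1" for z
    using M(2)[of z] that by simp
  note meas = borel_measurable_comp_snd[OF k] \<psi>_meas
  show ?thesis
  proof (rule integral_dominated_convergence)
    let ?D = "\<lambda>z. (C * M) * ((indicator (ball 0 1) (fst z) * f (fst z)) * indicator {-T..T} (snd z))"
    show "integrable lborel ?D"
      by (intro integrable_mult_right integrable_lborel_prod_mult integrable_indicator_Icc)
         (use f in \<open>simp add: set_integrable_def\<close>)
    show "AE z in lborel. norm (k (snd z) * (F n (fst z) * \<psi> z)) \<le> ?D z" for n
      using AE_lborel_fst[OF bound[of n]]
    proof eventually_elim
      case (elim z)
      show ?case
      proof (cases "fst z \<in> ball 0 1")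
        case True
        then have "\<bar>F n (fst z)\<bar> * \<bar>\<psi> z\<bar> \<le> f (fst z) * (M * indicator {-T..T} (snd z))"
          using elim M(2)[of z] by (intro mult_mono) auto
        with kC[of "snd z"] have "\<bar>k (snd z)\<bar> * (\<bar>F n (fst z)\<bar> * \<bar>\<psi> z\<bar>) \<le> C * (f (fst z) * (M * indicator {-T..T} (snd z)))"
          using C by (intro mult_mono[of _ C]) auto
        then show ?thesis
          using True by (simp add: abs_mult mult_ac)
      qed (simp add: \<psi>0)
    qed
    show "AE z in lborel. (\<lambda>n. k (snd z) * (F n (fst z) * \<psi> z)) \<longlonglongrightarrow> k (snd z) * (G (fst z) * \<psi> z)"
      using AE_lborel_fst[OF lim]
    proof eventually_elim
      case (elim z)
      then show ?case
        by (cases "fst z \<in> ball 0 1") (auto intro!: tendsto_intros simp: \<psi>0)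
    qed
    show "(\<lambda>z. k (snd z) * (F n (fst z) * \<psi> z)) \<in> borel_measurable lborel" for n
      using meas F(1)[THEN borel_measurable_comp_fst] by simp
    show "(\<lambda>z. k (snd z) * (G (fst z) * \<psi> z)) \<in> borel_measurable lborel"
      using meas F(2)[THEN borel_measurable_comp_fst] by simp
  qed
qed

lemma integrable_box_supported:
  assumes \<psi>: "box_supported \<psi>"
    and k[measurable]: "k \<in> borel_measurable borel" and kC: "\<And>t. \<bar>k t\<bar> \<le> C"
    and f[measurable]: "f \<in> borel_measurable borel" "set_integrable lborel (ball 0 1) f"
  shows "integrable lborel (\<lambda>z. k (snd z) * (f (fst z) * \<psi> z))"
proof -
  obtain M T where M: "M \<ge> 0" "\<And>z. \<bar>\<psi> z\<bar> \<le> M * (indicator (ball 0 1) (fst z) * indicator {-T..T} (snd z))"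
    and \<psi>_meas: "\<psi> \<in> borel_measurable borel"
    using \<psi> unfolding box_supported_def by blast
  note meas = borel_measurable_comp_snd[OF k] \<psi>_meas
  have C: "C \<ge> 0" using kC[of 0] by simp
  show ?thesis
  proof (rule Bochner_Integration.integrable_bound)
    show "integrable lborel (\<lambda>z. (C * M) * ((indicator (ball 0 1) (fst z) * f (fst z)) * indicator {-T..T} (snd z)))"
      by (intro integrable_mult_right integrable_lborel_prod_mult integrable_indicator_Icc)
         (use f in \<open>simp add: set_integrable_def\<close>)
    show "AE z in lborel. norm (k (snd z) * (f (fst z) * \<psi> z)) \<le>
      norm ((C * M) * ((indicator (ball 0 1) (fst z) * f (fst z)) * indicator {-T..T} (snd z)))"
    proof (intro always_eventually allI)
      fix z
      have "\<bar>k (snd z)\<bar> * (\<bar>f (fst z)\<bar> * \<bar>\<psi> z\<bar>) \<le>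
          C * (\<bar>f (fst z)\<bar> * (M * (indicator (ball 0 1) (fst z) * indicator {-T..T} (snd z))))"
        using kC[of "snd z"] M C by (intro mult_mono) auto
      then show "norm (k (snd z) * (f (fst z) * \<psi> z)) \<le>
          norm ((C * M) * ((indicator (ball 0 1) (fst z) * f (fst z)) * indicator {-T..T} (snd z)))"
        using M(1) C by (simp add: abs_mult mult_ac)
    qed
  qed (use meas f(1)[THEN borel_measurable_comp_fst] in simp)
qed

section \<open>Distributional Laplacians of the logarithm and of the modulus\<close>

text \<open>From \<open>ln y \<le> y - 1\<close> at \<open>y = x\<close> and at
  \<open>y = 1 / x\<close>. In this form the integrability of \<open>1 / cmod (a * x + b)\<close> on
  the disk controls the logarithm.\<close>

lemma abs_ln_le: "0 < x \<Longrightarrow> \<bar>ln x\<bar> \<le> 1 / x + (x::real)"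
proof -
  assume x: "0 < x"
  then have "0 < 1 / x"
    by simp
  moreover have "ln x \<le> x - 1" "- ln x \<le> 1 / x - 1"
    using x ln_le_minus_one[of x] ln_le_minus_one[of "1 / x"] by (simp_all add: ln_div)
  ultimately show ?thesis
    using x unfolding abs_le_iff by linarith
qed

lemma square_add_le: "0 \<le> w \<Longrightarrow> e \<le> 1 \<Longrightarrow> w\<^sup>2 + e \<le> (1 + w)\<^sup>2" for w e :: real
  by (simp add: power2_eq_square algebra_simps)

text \<open>Half the logarithm is squeezed between \<open>ln w\<close> and
  \<open>ln (1 + w)\<close>, uniformly in \<open>e\<close>, so one majorant serves all smoothing
  parameters.\<close>

lemma abs_half_ln_le:
  fixes w e :: real
  assumes w: "0 < w" and e: "0 \<le> e" "e \<le> 1"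
  shows "\<bar>ln (w\<^sup>2 + e) / 2\<bar> \<le> 1 / w + w"
proof -
  have w2: "0 < w\<^sup>2"
    using w by simp
  then have pos: "0 < w\<^sup>2 + e"
    using e by linarith
  have "2 * ln w = ln (w\<^sup>2)"
    using w by (simp add: ln_realpow)
  also have "\<dots> \<le> ln (w\<^sup>2 + e)"
    using ln_le_cancel_iff[OF w2 pos] e by simp
  finally have "2 * ln w \<le> ln (w\<^sup>2 + e)" .
  moreover have "\<bar>ln w\<bar> \<le> 1 / w + w"
    by (rule abs_ln_le[OF w])
  moreover have "ln (w\<^sup>2 + e) \<le> ln ((1 + w)\<^sup>2)"
    using ln_le_cancel_iff[OF pos, of "(1 + w)\<^sup>2"] square_add_le[of w e] w e by simp
  moreover have "ln ((1 + w)\<^sup>2) = 2 * ln (1 + w)"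
    using w by (simp add: ln_realpow)
  moreover have "ln (1 + w) \<le> w"
    using w by (simp add: ln_add_one_self_le_self)
  moreover have "0 \<le> 1 / w"
    using w by simp
  ultimately show ?thesis
    unfolding abs_le_iff by linarith
qed

text \<open>The expression is the planar Laplacian of \<open>sqrt (w^2 + e)\<close> with
  \<open>w\<close> the modulus. As \<open>e\<close> tends to 0 it tends to \<open>1 / w\<close>, and
  twice this limit is a majorant.\<close>

lemma smoothed_inverse_bounds:
  fixes w e :: real
  assumes w: "0 < w" and e: "0 < e"
  shows "0 \<le> 1 / sqrt (w\<^sup>2 + e) + e / ((w\<^sup>2 + e) * sqrt (w\<^sup>2 + e))"
    "1 / sqrt (w\<^sup>2 + e) + e / ((w\<^sup>2 + e) * sqrt (w\<^sup>2 + e)) \<le> 2 * (1 / w)"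
proof -
  define s where "s = w\<^sup>2 + e"
  have "0 < w\<^sup>2" using w by simp
  then have s: "0 < s" "e \<le> s" "w\<^sup>2 \<le> s"
    using e unfolding s_def by linarith+
  have r: "0 < sqrt s" "w \<le> sqrt s"
    using s w by (auto intro: real_le_rsqrt)
  have "1 / sqrt s \<le> 1 / w"
    using r w by (simp add: frac_le)
  moreover have "e / (s * sqrt s) \<le> 1 / sqrt s"
    using s r by (simp add: divide_simps)
  moreover have "0 \<le> 1 / sqrt s" "0 \<le> e / (s * sqrt s)"
    using s r e by simp_all
  ultimately show "0 \<le> 1 / sqrt (w\<^sup>2 + e) + e / ((w\<^sup>2 + e) * sqrt (w\<^sup>2 + e))"
    "1 / sqrt (w\<^sup>2 + e) + e / ((w\<^sup>2 + e) * sqrt (w\<^sup>2 + e)) \<le> 2 * (1 / w)"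
    unfolding s_def[symmetric] by linarith+
qed

text \<open>The radial formula for \<open>Q s = ln s / 2\<close>: away from the zero of the affine
  function the smoothed logarithm becomes harmonic as \<open>e\<close> tends to 0.\<close>

lemma ln_laplacian_identity:
  fixes s e A :: real
  assumes "s \<noteq> 0"
  shows "4 * A * (- 1 / (2 * s\<^sup>2) * (s - e) + 1 / (2 * s)) = 2 * A * e / s\<^sup>2"
  using assms by (simp add: power2_eq_square field_simps)

lemma sqrt_laplacian_identity:
  fixes s e A r :: real
  assumes "s \<noteq> 0" "r \<noteq> 0"
  shows "4 * A * (- 1 / (4 * s * r) * (s - e) + 1 / (2 * r)) = A * (1 / r + e / (s * r))"
  using assms by (simp add: field_simps)

text \<open>
  The modulus \<open>cmod (a * x + b)\<close> is singular at its zero.  It is smoothed to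
  \<open>sqrt ((cmod (a * x + b))\<^sup>2 + eps n)\<close>, for which integration by parts is classical.
\<close>

definition eps :: "nat \<Rightarrow> real" where "eps n = (inverse (real (Suc n)))\<^sup>2"

lemma eps: "0 < eps n" "eps n \<le> 1" "eps \<longlonglongrightarrow> 0"
proof -
  show "0 < eps n" "eps n \<le> 1"
    by (auto simp: eps_def power_le_one_iff inverse_le_1_iff)
  show "eps \<longlonglongrightarrow> 0"
    unfolding eps_def using tendsto_power[OF LIMSEQ_inverse_real_of_nat, of 2] by simp
qed

text \<open>Covers both \<open>x - p\<close> and the reflected factor \<open>1 - cnj p * x\<close>.
  The slope may be 0, as for the reflection of \<open>p = 0\<close>. Integrability of the inverse
  modulus is assumed because the two cases have different reasons: a dyadic estimate at the pole,
  boundedness for the reflection.\<close>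

locale affine_weight =
  fixes a b :: complex
  assumes nontrivial: "a \<noteq> 0 \<or> b \<noteq> 0"
    and inverse_integrable: "set_integrable lborel (ball 0 1) (\<lambda>x. 1 / cmod (a * x + b))"
begin

definition S where "S n x = (cmod (a * x + b))\<^sup>2 + eps n"

lemma S_pos: "S n x > 0"
  using eps(1)[of n] by (simp add: S_def add_nonneg_pos)

lemma continuous_S: "continuous_on A (S n)"
  unfolding S_def by (intro continuous_intros)

lemma AE_nonzero: "AE x in lborel. a * x + b \<noteq> 0"
proof (cases "a = 0")
  case False
  have "a * x + b \<noteq> 0" if "x \<noteq> - b / a" for x
    using that False by (auto simp: field_simps add_eq_0_iff)
  then show ?thesis
    using AE_lborel_singleton[of "- b / a"] by (auto elim: eventually_mono)
qed (use nontrivial in auto)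

lemma continuous_cmod_affine: "continuous_on A (\<lambda>x. cmod (a * x + b))"
  by (intro continuous_intros)

lemma measurable_cmod_affine: "(\<lambda>x. cmod (a * x + b)) \<in> borel_measurable borel"
  by (rule borel_measurable_continuous_onI[OF continuous_cmod_affine])

lemma set_integrable_one: "set_integrable lborel (ball (0::complex) 1) (\<lambda>_. 1::real)"
  unfolding set_integrable_def
  by (simp, intro integrable_real_indicator emeasure_bounded_finite bounded_ball) simp

lemma set_integrable_cmod_affine: "set_integrable lborel (ball 0 1) (\<lambda>x. cmod (a * x + b))"
proof -
  have "integrable lborel (\<lambda>x. indicator (ball 0 1) x * (indicator (cball 0 1) x * cmod (a * x + b)))"
  proof (rule integrable_mult_bounded)
    show "integrable lborel (indicator (ball (0::complex) 1) :: _ \<Rightarrow> real)"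
      by (intro integrable_real_indicator emeasure_bounded_finite) auto
    show "(\<lambda>x. indicator (cball 0 1) x * cmod (a * x + b)) \<in> borel_measurable lborel"
      using borel_measurable_times[OF borel_measurable_indicator measurable_cmod_affine, of "cball 0 1"] by simp
    show "\<bar>indicator (cball 0 1) x * cmod (a * x + b)\<bar> \<le> cmod a + cmod b" for x
      using norm_triangle_ineq[of "a * x" b] mult_left_le[of "cmod x" "cmod a"]
      by (auto simp: indicator_def norm_mult)
  qed
  moreover have "indicator (ball 0 1) x * (indicator (cball 0 1) x * cmod (a * x + b)) = indicator (ball 0 1) x * cmod (a * x + b)" for x
    by (auto simp: indicator_def)
  ultimately show ?thesis
    by (simp add: set_integrable_def)
qed

lemma integrable_cmod_affine: "set_integrable lborel (ball 0 1) (\<lambda>x. 1 / cmod (a * x + b) + cmod (a * x + b))"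
  using inverse_integrable set_integrable_cmod_affine by (rule set_integral_add)

lemma set_integrable_ln_cmod: "set_integrable lborel (ball 0 1) (\<lambda>x. ln (cmod (a * x + b)))"
  unfolding set_integrable_def
proof (rule Bochner_Integration.integrable_bound[OF integrable_cmod_affine[unfolded set_integrable_def]])
  show "(\<lambda>x. indicator (ball 0 1) x *\<^sub>R ln (cmod (a * x + b))) \<in> borel_measurable lborel"
    using borel_measurable_times[OF borel_measurable_indicator borel_measurable_ln[OF measurable_cmod_affine], of "ball 0 1"] by simp
  show "AE x in lborel. norm (indicator (ball 0 1) x *\<^sub>R ln (cmod (a * x + b))) \<le>
      norm (indicator (ball 0 1) x *\<^sub>R (1 / cmod (a * x + b) + cmod (a * x + b)))"
    using AE_nonzero
  proof eventually_elim
    case (elim x)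
    then show ?case
      using abs_ln_le[of "cmod (a * x + b)"] by (auto simp: indicator_def)
  qed
qed

end

text \<open>The weight \<open>k\<close> acts in time only and is merely bounded and measurable; it
  will be an exponential cut off at time 0.\<close>

locale box_test_affine = box_test + affine_weight +
  fixes k :: "real \<Rightarrow> real" and C :: real
  assumes k: "k \<in> borel_measurable borel" and kC: "\<And>t. \<bar>k t\<bar> \<le> C"
begin

text \<open>The Laplacian of \<open>cmod (a * x + b)\<close> is
  \<open>(cmod a)^2 / cmod (a * x + b)\<close>. No point mass appears at a zero, because the inverse
  modulus is integrable in the plane and dominates the smoothed Laplacians.\<close>

lemma integral_cmod_laplacian:
  "(\<integral>z. k (snd z) * (cmod (a * fst z + b) * lap z) \<partial>lborel) =
   (\<integral>z. k (snd z) * ((cmod a)\<^sup>2 / cmod (a * fst z + b) * \<phi> z) \<partial>lborel)"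
proof -
  define R where "R n x = (cmod a)\<^sup>2 * (1 / sqrt (S n x) + eps n / (S n x * sqrt (S n x)))" for n x
  have R_eq: "4 * (cmod a)\<^sup>2 * (- 1 / (4 * S n x * sqrt (S n x)) * (S n x - eps n) + 1 / (2 * sqrt (S n x))) = R n x" for n x
    unfolding R_def by (rule sqrt_laplacian_identity) (use S_pos[of n x] in simp_all)
  have cont_R: "continuous_on UNIV (R n)" for n
    unfolding R_def using continuous_S S_pos by (intro continuous_intros) (auto simp: order_less_imp_not_eq2)
  have eq: "(\<integral>z. k (snd z) * (sqrt (S n (fst z)) * lap z) \<partial>lborel) = (\<integral>z. k (snd z) * (R n (fst z) * \<phi> z) \<partial>lborel)" for n
  proof -
    show ?thesis
      unfolding R_eq[symmetric] unfolding S_def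
    proof (rule integral_radial_laplacian[where Q = sqrt and Q' = "\<lambda>s. 1 / (2 * sqrt s)"
          and Q'' = "\<lambda>s. - 1 / (4 * s * sqrt s)", OF eps(1) _ _ _ k kC])
      show "(sqrt has_real_derivative 1 / (2 * sqrt s)) (at s)" if "s > 0" for s
        using DERIV_real_sqrt[OF that] by (simp add: field_simps)
      show "((\<lambda>s. 1 / (2 * sqrt s)) has_real_derivative - 1 / (4 * s * sqrt s)) (at s)" if "s > 0" for s
        using that by (auto intro!: derivative_eq_intros simp: field_simps)
      show "continuous_on {0<..} (\<lambda>s. - 1 / (4 * s * sqrt s))"
        by (intro continuous_intros) auto
    qed
  qed
  have "(\<lambda>n. \<integral>z. k (snd z) * (sqrt (S n (fst z)) * lap z) \<partial>lborel) \<longlonglongrightarrow> (\<integral>z. k (snd z) * (cmod (a * fst z + b) * lap z) \<partial>lborel)"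
  proof (rule tendsto_integral_box_supported[OF box_supported(2) k kC])
    show "set_integrable lborel (ball 0 1) (\<lambda>x. 1 + cmod (a * x + b))"
      using set_integral_add(1)[OF set_integrable_one set_integrable_cmod_affine] .
    show "AE x in lborel. x \<in> ball 0 1 \<longrightarrow> \<bar>sqrt (S n x)\<bar> \<le> 1 + cmod (a * x + b)" for n
    proof (intro always_eventually allI impI)
      fix x
      have "S n x \<le> (1 + cmod (a * x + b))\<^sup>2"
        unfolding S_def using eps(2)[of n] by (intro square_add_le) auto
      then show "\<bar>sqrt (S n x)\<bar> \<le> 1 + cmod (a * x + b)"
        using S_pos[of n x] by (simp add: real_le_lsqrt)
    qed
    show "AE x in lborel. x \<in> ball 0 1 \<longrightarrow> (\<lambda>n. sqrt (S n x)) \<longlonglongrightarrow> cmod (a * x + b)"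
    proof (intro always_eventually allI impI)
      fix x
      have "(\<lambda>n. sqrt ((cmod (a * x + b))\<^sup>2 + eps n)) \<longlonglongrightarrow> sqrt ((cmod (a * x + b))\<^sup>2 + 0)"
        by (intro tendsto_intros eps(3))
      then show "(\<lambda>n. sqrt (S n x)) \<longlonglongrightarrow> cmod (a * x + b)" by (simp add: S_def)
    qed
    show "(\<lambda>x. sqrt (S n x)) \<in> borel_measurable borel" for n
      by (intro borel_measurable_continuous_onI continuous_on_real_sqrt continuous_S)
  qed (rule measurable_cmod_affine)
  moreover have "(\<lambda>n. \<integral>z. k (snd z) * (R n (fst z) * \<phi> z) \<partial>lborel) \<longlonglongrightarrow>
    (\<integral>z. k (snd z) * ((cmod a)\<^sup>2 / cmod (a * fst z + b) * \<phi> z) \<partial>lborel)"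
  proof (rule tendsto_integral_box_supported[OF box_supported(1) k kC])
    show "set_integrable lborel (ball 0 1) (\<lambda>x. 2 * (cmod a)\<^sup>2 * (1 / cmod (a * x + b)))"
      using inverse_integrable by (intro set_integrable_mult_right) auto
    show "AE x in lborel. x \<in> ball 0 1 \<longrightarrow> \<bar>R n x\<bar> \<le> 2 * (cmod a)\<^sup>2 * (1 / cmod (a * x + b))" for n
      using AE_nonzero
    proof eventually_elim
      case (elim x)
      then have w: "cmod (a * x + b) > 0" by simp
      show ?case
      proof
        have "\<bar>R n x\<bar> = (cmod a)\<^sup>2 * (1 / sqrt (S n x) + eps n / (S n x * sqrt (S n x)))"
          using smoothed_inverse_bounds(1)[OF w eps(1)[of n]] by (simp only: R_def S_def abs_mult abs_of_nonneg abs_power2)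
        also have "\<dots> \<le> (cmod a)\<^sup>2 * (2 * (1 / cmod (a * x + b)))"
          using smoothed_inverse_bounds(2)[OF w eps(1)[of n]] unfolding S_def by (rule mult_left_mono) simp
        finally show "\<bar>R n x\<bar> \<le> 2 * (cmod a)\<^sup>2 * (1 / cmod (a * x + b))"
          by (simp only: mult_ac)
      qed
    qed
    show "AE x in lborel. x \<in> ball 0 1 \<longrightarrow> (\<lambda>n. R n x) \<longlonglongrightarrow> (cmod a)\<^sup>2 / cmod (a * x + b)"
      using AE_nonzero
    proof eventually_elim
      case (elim x)
      have "(\<lambda>n. (cmod a)\<^sup>2 * (1 / sqrt ((cmod (a * x + b))\<^sup>2 + eps n) +
          eps n / (((cmod (a * x + b))\<^sup>2 + eps n) * sqrt ((cmod (a * x + b))\<^sup>2 + eps n)))) \<longlonglongrightarrow> (cmod a)\<^sup>2 * (1 / sqrt ((cmod (a * x + b))\<^sup>2 + 0) +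
          0 / (((cmod (a * x + b))\<^sup>2 + 0) * sqrt ((cmod (a * x + b))\<^sup>2 + 0)))"
        using elim by (intro tendsto_intros eps(3)) auto
      then show ?case by (simp add: R_def S_def)
    qed
  qed (use cont_R in \<open>auto intro: borel_measurable_continuous_onI\<close>)
  ultimately show ?thesis
    unfolding eq by (rule LIMSEQ_unique)
qed

text \<open>The densities on the left tend to 0 almost everywhere but may concentrate at a zero of
  the affine function. Their limit is therefore left open here and evaluated separately with and
  without a zero in the disk.\<close>

lemma integral_ln_cmod_laplacian:
  "(\<lambda>n. \<integral>z. k (snd z) * (2 * (cmod a)\<^sup>2 * eps n / (S n (fst z))\<^sup>2 * \<phi> z) \<partial>lborel)
    \<longlonglongrightarrow> (\<integral>z. k (snd z) * (ln (cmod (a * fst z + b)) * lap z) \<partial>lborel)"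
proof -
  have R_eq: "4 * (cmod a)\<^sup>2 * (- 1 / (2 * (S n x)\<^sup>2) * (S n x - eps n) + 1 / (2 * S n x)) =
      2 * (cmod a)\<^sup>2 * eps n / (S n x)\<^sup>2" for n x
    by (rule ln_laplacian_identity) (use S_pos[of n x] in simp)
  have eq: "(\<integral>z. k (snd z) * (2 * (cmod a)\<^sup>2 * eps n / (S n (fst z))\<^sup>2 * \<phi> z) \<partial>lborel) =
    (\<integral>z. k (snd z) * (ln (S n (fst z)) / 2 * lap z) \<partial>lborel)" for n
  proof -
    have "(\<integral>z. k (snd z) * (ln (S n (fst z)) / 2 * lap z) \<partial>lborel) = (\<integral>z. k (snd z) *
      ((4 * (cmod a)\<^sup>2 * (- 1 / (2 * (S n (fst z))\<^sup>2) * (S n (fst z) - eps n) + 1 / (2 * S n (fst z)))) * \<phi> z) \<partial>lborel)"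
      unfolding S_def
    proof (rule integral_radial_laplacian[where Q = "\<lambda>s. ln s / 2" and Q' = "\<lambda>s. 1 / (2 * s)"
          and Q'' = "\<lambda>s. - 1 / (2 * s\<^sup>2)", OF eps(1) _ _ _ k kC])
    show "((\<lambda>s. ln s / 2) has_real_derivative 1 / (2 * s)) (at s)" if "s > 0" for s :: real
      using that by (auto intro!: derivative_eq_intros)
    show "((\<lambda>s. 1 / (2 * s)) has_real_derivative - 1 / (2 * s\<^sup>2)) (at s)" if "s > 0" for s :: real
      using that by (auto intro!: derivative_eq_intros simp: field_simps power2_eq_square)
    show "continuous_on {0<..} (\<lambda>s::real. - 1 / (2 * s\<^sup>2))"
        by (intro continuous_intros) auto
    qed
    then show ?thesis
      by (simp only: R_eq)
  qed
  show ?thesis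
    unfolding eq
  proof (rule tendsto_integral_box_supported[OF box_supported(2) k kC _ _ integrable_cmod_affine])
    show "AE x in lborel. x \<in> ball 0 1 \<longrightarrow> \<bar>ln (S n x) / 2\<bar> \<le> 1 / cmod (a * x + b) + cmod (a * x + b)" for n
      using AE_nonzero
    proof eventually_elim
      case (elim x)
      then show ?case
        using abs_half_ln_le[of "cmod (a * x + b)" "eps n"] eps(1,2)[of n] by (simp add: S_def)
    qed
    show "AE x in lborel. x \<in> ball 0 1 \<longrightarrow> (\<lambda>n. ln (S n x) / 2) \<longlonglongrightarrow> ln (cmod (a * x + b))"
      using AE_nonzero
    proof eventually_elim
      case (elim x)
      have "(\<lambda>n. ln ((cmod (a * x + b))\<^sup>2 + eps n) / 2) \<longlonglongrightarrow> ln ((cmod (a * x + b))\<^sup>2 + 0) / 2"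
        using elim by (intro tendsto_intros eps(3)) auto
      then show ?case
        using elim by (simp add: ln_realpow S_def)
    qed
    show "(\<lambda>x. ln (S n x) / 2) \<in> borel_measurable borel" for n
      by (rule borel_measurable_divide[OF borel_measurable_ln[OF borel_measurable_continuous_onI[OF continuous_S]] borel_measurable_const])
    show "(\<lambda>x. ln (cmod (a * x + b))) \<in> borel_measurable borel"
      by (rule borel_measurable_ln[OF measurable_cmod_affine])
  qed
qed

end

text \<open>A substitute for polar coordinates, by comparison with disks of radius \<open>r n\<close>.\<close>

lemma integrable_dyadic_bound:
  fixes f :: "complex \<Rightarrow> real" and r c :: "nat \<Rightarrow> real"
  assumes f: "f \<in> borel_measurable borel" "\<And>x. 0 \<le> f x"
    and r: "\<And>n. 0 \<le> r n" "\<And>n. 0 \<le> c n" and sum: "summable (\<lambda>n. c n * (r n)\<^sup>2)"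
    and bound: "\<And>x. f x \<noteq> 0 \<Longrightarrow> \<exists>n. norm x \<le> r n \<and> f x \<le> c n"
  shows "integrable lborel f"
proof -
  define V where "V = unit_ball_vol 2"
  have ball: "emeasure lborel (cball (0::complex) (r n)) = ennreal (V * (r n)\<^sup>2)" for n
    using r(1)[of n] by (simp add: emeasure_cball V_def)
  have "V \<ge> 0" by (simp add: V_def)
  have "(\<integral>\<^sup>+x. ennreal (f x) \<partial>lborel) \<le> (\<integral>\<^sup>+x. (\<Sum>n. ennreal (c n) * indicator (cball (0::complex) (r n)) x) \<partial>lborel)"
  proof (intro nn_integral_mono)
    fix x
    show "ennreal (f x) \<le> (\<Sum>n. ennreal (c n) * indicator (cball (0::complex) (r n)) x)"
    proof (cases "f x = 0")
      case False
      then obtain n where n: "norm x \<le> r n" "f x \<le> c n"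
        using bound by blast
      then have "ennreal (f x) \<le> ennreal (c n) * indicator (cball (0::complex) (r n)) x"
        by (simp add: ennreal_leI)
      also have "\<dots> = (\<Sum>i\<in>{n}. ennreal (c i) * indicator (cball (0::complex) (r i)) x)"
        by (simp del: sum_mult_indicator)
      also have "\<dots> \<le> (\<Sum>n. ennreal (c n) * indicator (cball (0::complex) (r n)) x)"
        by (intro sum_le_suminf) auto
      finally show ?thesis .
    qed simp
  qed
  also have "\<dots> = (\<Sum>n. \<integral>\<^sup>+x. ennreal (c n) * indicator (cball (0::complex) (r n)) x \<partial>lborel)"
    by (intro nn_integral_suminf borel_measurable_times_ennreal borel_measurable_indicator) auto
  also have "\<dots> = (\<Sum>n. ennreal (c n * (V * (r n)\<^sup>2)))"
    using r \<open>V \<ge> 0\<close> by (simp add: nn_integral_cmult_indicator ball ennreal_mult)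
  also have "\<dots> = ennreal (\<Sum>n. c n * (V * (r n)\<^sup>2))"
    using summable_mult[OF sum, of V] r \<open>V \<ge> 0\<close>
    by (intro suminf_ennreal2) (auto simp: mult_ac)
  also have "\<dots> < \<infinity>" by simp
  finally show ?thesis
    using f by (intro integrableI_nonneg) auto
qed

text \<open>Seen from \<open>p\<close>, the unit disk lies within radius 2, so the estimate is made
  at the origin and translated. The spelling \<open>1 * x + - p\<close> matches the affine form
  \<open>a * x + b\<close>.\<close>

lemma set_integrable_inverse_cmod:
  assumes p: "p \<in> ball 0 1"
  shows "set_integrable lborel (ball 0 1) (\<lambda>x. 1 / cmod (1 * x + - p))"
proof -
  define f where "f x = indicator (cball 0 2) x * (1 / cmod x)" for x
  have norm_meas: "cmod \<in> borel_measurable borel"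
    by (intro borel_measurable_continuous_onI continuous_intros)
  have f_int: "integrable lborel f"
  \<comment> \<open>On the shell \<open>1 / 2 ^ n < cmod x \<le> 2 / 2 ^ n\<close> the inverse
    modulus is below \<open>2 ^ n\<close>, so the series has terms \<open>4 / 2 ^ n\<close>.\<close>
  proof (rule integrable_dyadic_bound[where r = "\<lambda>n. 2 / 2 ^ n" and c = "\<lambda>n. 2 ^ n"])
    show "f \<in> borel_measurable borel"
      unfolding f_def[abs_def]
      using borel_measurable_times[OF borel_measurable_indicator borel_measurable_inverse[OF norm_meas], of "cball 0 2"]
      by (simp add: inverse_eq_divide)
    have "summable (\<lambda>n. 4 * (1 / 2) ^ n :: real)"
      by (intro summable_mult summable_geometric) simp
    then show "summable (\<lambda>n. 2 ^ n * (2 / 2 ^ n)\<^sup>2 :: real)"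
      by (simp add: power2_eq_square power_divide)
    show "\<exists>n. norm x \<le> 2 / 2 ^ n \<and> f x \<le> 2 ^ n" if "f x \<noteq> 0" for x
    proof -
      have x: "cmod x \<le> 2" "cmod x > 0"
        using that by (auto simp: f_def indicator_def split: if_splits)
      obtain m where m: "(1 / 2) ^ m < cmod x / 2"
        using real_arch_pow_inv[of "cmod x / 2" "1 / 2"] x by auto
      \<comment> \<open>The least exponent gives a two-sided bound on \<open>cmod x\<close>. It is
        not 0 because \<open>cmod x \<le> 2\<close>, and its predecessor \<open>k\<close> indexes
        the shell that contains \<open>x\<close>.\<close>
      define n where "n = (LEAST m. (1 / 2) ^ m < cmod x / 2)"
      have n: "(1 / 2) ^ n < cmod x / 2"
        unfolding n_def by (rule LeastI[of "\<lambda>m. (1 / 2) ^ m < cmod x / 2", OF m])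
      have "n \<noteq> 0"
        using n x by (intro notI) auto
      then obtain k where k: "n = Suc k"
        using not0_implies_Suc by blast
      have "\<not> (1 / 2) ^ k < cmod x / 2"
        using not_less_Least[of k "\<lambda>m. (1 / 2) ^ m < cmod x / 2"] k by (auto simp: n_def)
      then have "cmod x \<le> 2 / 2 ^ k"
        by (simp add: power_divide)
      moreover have "1 / cmod x \<le> 2 ^ k"
        using n x by (simp add: k power_divide field_simps)
      ultimately show ?thesis
        using x by (intro exI[of _ k]) (simp add: f_def)
    qed
  qed (auto simp: f_def)
  then have "integrable (distr lborel borel ((+) (- p))) f"
    by (simp add: lborel_distr_plus)
  then have shifted: "integrable lborel (\<lambda>x. f (- p + x))"
    using f_int by (subst (asm) integrable_distr_eq) auto
  show ?thesis
    unfolding set_integrable_def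
  proof (rule Bochner_Integration.integrable_bound[OF shifted])
    have "(\<lambda>x. cmod (1 * x + - p)) \<in> borel_measurable borel"
      by (intro borel_measurable_continuous_onI continuous_intros)
    from borel_measurable_times[OF borel_measurable_indicator borel_measurable_inverse[OF this], of "ball 0 1"]
    show "(\<lambda>x. indicator (ball 0 1) x *\<^sub>R (1 / cmod (1 * x + - p))) \<in> borel_measurable lborel"
      by (simp add: inverse_eq_divide)
    show "AE x in lborel. norm (indicator (ball 0 1) x *\<^sub>R (1 / cmod (1 * x + - p))) \<le> norm (f (- p + x))"
    proof (intro always_eventually allI)
      fix x
      have "cmod (x - p) \<le> 2" if "x \<in> ball 0 1"
        using norm_triangle_ineq4[of x p] that p by simp
      then show "norm (indicator (ball 0 1) x *\<^sub>R (1 / cmod (1 * x + - p))) \<le> norm (f (- p + x))"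
        by (auto simp: f_def indicator_def)
    qed
  qed
qed

text \<open>
  \<open>profile (y / e) / e\<^sup>2\<close> is the Laplacian of \<open>ln (sqrt ((cmod y)\<^sup>2 + e\<^sup>2))\<close>, an approximate
  identity of mass \<open>kappa\<close>.
\<close>

definition profile :: "complex \<Rightarrow> real" where
  "profile y = 2 / ((cmod y)\<^sup>2 + 1)\<^sup>2"

definition kappa :: real where
  "kappa = (\<integral>y. profile y \<partial>lborel)"

lemma one_le_profile_base: "1 \<le> (cmod y)\<^sup>2 + 1" "0 < ((cmod y)\<^sup>2 + 1)\<^sup>2"
proof -
  show 1: "1 \<le> (cmod y)\<^sup>2 + 1"
    by simp
  then show "0 < ((cmod y)\<^sup>2 + 1)\<^sup>2"
    by (intro zero_less_power) linarith
qed

lemma profile_pos: "profile y > 0"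
  unfolding profile_def using one_le_profile_base(2) by (intro divide_pos_pos) auto

lemma measurable_profile [measurable]: "profile \<in> borel_measurable borel"
  unfolding profile_def[abs_def] by measurable

text \<open>On the shell \<open>2 ^ (n - 1) \<le> cmod y < 2 ^ n\<close> the profile is at most
  \<open>2 / 16 ^ (n - 1) = 32 / 16 ^ n\<close>, and the series has terms
  \<open>32 / 4 ^ n\<close>.\<close>

lemma integrable_profile: "integrable lborel profile"
proof (rule integrable_dyadic_bound[where r = "\<lambda>n. 2 ^ n" and c = "\<lambda>n. 32 / 16 ^ n"])
  have "summable (\<lambda>n. 32 * (1 / 4) ^ n :: real)"
    by (intro summable_mult summable_geometric) simp
  then show "summable (\<lambda>n. 32 / 16 ^ n * (2 ^ n)\<^sup>2 :: real)"
    by (rule summable_cong[THEN iffD1, rotated])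
       (auto simp: power_divide power2_eq_square field_simps simp flip: power_mult_distrib)
  show "\<exists>n. norm y \<le> 2 ^ n \<and> profile y \<le> 32 / 16 ^ n" for y
  proof -
    obtain m where m: "cmod y < 2 ^ m"
      using real_arch_pow[of 2 "cmod y"] by auto
    define n where "n = (LEAST m. cmod y < 2 ^ m)"
    have n: "cmod y < 2 ^ n"
      unfolding n_def by (rule LeastI[of "\<lambda>m. cmod y < 2 ^ m", OF m])
    have "profile y \<le> 32 / 16 ^ n"
    proof (cases n)
      case 0
      have "1 \<le> ((cmod y)\<^sup>2 + 1)\<^sup>2"
        by (simp add: one_le_power)
      then have "profile y \<le> 2 / 1"
        unfolding profile_def using one_le_profile_base[of y] by (intro divide_left_mono mult_pos_pos) auto
      then show ?thesis using 0 by simp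
    next
      case (Suc k)
      have "2 ^ k \<le> cmod y"
        using not_less_Least[of k "\<lambda>m. cmod y < 2 ^ m"] Suc by (auto simp: n_def)
      then have "(2 ^ k)\<^sup>2 \<le> (cmod y)\<^sup>2"
        by (intro power_mono) auto
      then have "(2 ^ k)\<^sup>2 \<le> (cmod y)\<^sup>2 + 1"
        by linarith
      then have "((2 ^ k)\<^sup>2)\<^sup>2 \<le> ((cmod y)\<^sup>2 + 1)\<^sup>2"
        by (intro power_mono) simp_all
      moreover have "((2 ^ k)\<^sup>2)\<^sup>2 = (16 ^ k :: real)"
        by (simp add: power2_eq_square flip: power_mult_distrib)
      ultimately have "profile y \<le> 2 / 16 ^ k"
        unfolding profile_def using one_le_profile_base(2)[of y] by (intro divide_left_mono mult_pos_pos) auto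
      then show ?thesis using Suc by simp
    qed
    then show ?thesis
      using n by (intro exI[of _ n]) auto
  qed
qed (use profile_pos in \<open>auto intro: less_imp_le\<close>)

lemma kappa_pos: "kappa > 0"
proof -
  have "kappa \<ge> 0"
    unfolding kappa_def using profile_pos by (intro integral_nonneg_AE) (auto intro: less_imp_le)
  moreover have "kappa \<noteq> 0"
  proof
    assume "kappa = 0"
    then have "AE y in lborel. profile y = 0"
      unfolding kappa_def using integral_nonneg_eq_0_iff_AE[OF integrable_profile] profile_pos
      by (auto intro: less_imp_le)
    then have "AE y in (lborel :: complex measure). False"
      using profile_pos by (simp add: less_imp_neq[symmetric])
    then show False
      by (simp add: trivial_limit_def[symmetric] ae_filter_eq_bot_iff)
  qed
  ultimately show ?thesis by simp
qed

section \<open>The logarithm at its pole and its reflection outside the disk\<close>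

lemma integral_complex_affine:
  fixes f :: "complex \<Rightarrow> real"
  assumes f: "f \<in> borel_measurable borel" and c: "c > 0"
  shows "(\<integral>x. f x \<partial>lborel) = c\<^sup>2 * (\<integral>y. f (p + c *\<^sub>R y) \<partial>lborel)"
proof -
  have [measurable]: "(\<lambda>y. p + c *\<^sub>R y) \<in> borel_measurable borel"
    by (intro borel_measurable_continuous_onI continuous_intros)
  have "(\<integral>x. f x \<partial>lborel) = (\<integral>x. f x \<partial>density (distr lborel borel (\<lambda>x. p + c *\<^sub>R x)) (\<lambda>_. ennreal (c\<^sup>2)))"
    using lborel_affine[of c p] c by simp
  also have "\<dots> = (\<integral>x. c\<^sup>2 *\<^sub>R f x \<partial>distr lborel borel (\<lambda>x. p + c *\<^sub>R x))"
    by (intro integral_density) (use f in auto)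
  also have "\<dots> = (\<integral>y. c\<^sup>2 *\<^sub>R f (p + c *\<^sub>R y) \<partial>lborel)"
    by (intro integral_distr) (use f in auto)
  finally show ?thesis by simp
qed

lemma set_integrable_ball_bounded:
  fixes f :: "complex \<Rightarrow> real"
  assumes f: "f \<in> borel_measurable borel" and bound: "\<And>x. x \<in> ball 0 1 \<Longrightarrow> \<bar>f x\<bar> \<le> B"
  shows "set_integrable lborel (ball 0 1) f"
proof -
  have "integrable lborel (\<lambda>x. indicator (ball 0 1) x * (indicator (ball 0 1) x * f x))"
  proof (rule integrable_mult_bounded)
    show "integrable lborel (indicator (ball (0::complex) 1) :: _ \<Rightarrow> real)"
      by (intro integrable_real_indicator emeasure_bounded_finite) auto
    show "(\<lambda>x. indicator (ball 0 1) x * f x) \<in> borel_measurable lborel"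
      using borel_measurable_times[OF borel_measurable_indicator f, of "ball 0 1"] by simp
    show "\<bar>indicator (ball 0 1) x * f x\<bar> \<le> \<bar>B\<bar>" for x
      using bound[of x] by (auto simp: indicator_def)
  qed
  moreover have "indicator (ball 0 1) x * (indicator (ball 0 1) x * f x) = indicator (ball 0 1) x *\<^sub>R f x" for x
    by (simp add: indicator_def)
  ultimately show ?thesis
    by (simp add: set_integrable_def)
qed

lemma reflected_lower_bound:
  assumes "cmod x \<le> 1"
  shows "1 - cmod p \<le> cmod (- cnj p * x + 1)"
proof -
  have "cmod p * cmod x \<le> cmod p"
    using assms by (intro mult_left_le) auto
  moreover have "1 - cmod (cnj p * x) \<le> cmod (- cnj p * x + 1)"
    using norm_triangle_ineq2[of 1 "cnj p * x"] by (simp add: add.commute)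
  ultimately show ?thesis
    by (simp add: norm_mult)
qed

lemma affine_weight_pole: "p \<in> ball 0 1 \<Longrightarrow> affine_weight 1 (- p)"
  using set_integrable_inverse_cmod by (intro affine_weight.intro) auto

lemma affine_weight_reflected:
  assumes p: "p \<in> ball 0 1"
  shows "affine_weight (- cnj p) 1"
proof
  have d: "0 < 1 - cmod p" using p by simp
  show "set_integrable lborel (ball 0 1) (\<lambda>x. 1 / cmod (- cnj p * x + 1))"
  proof (rule set_integrable_ball_bounded)
    have "(\<lambda>x. cmod (- cnj p * x + 1)) \<in> borel_measurable borel"
      by (intro borel_measurable_continuous_onI continuous_intros)
    then show "(\<lambda>x. 1 / cmod (- cnj p * x + 1)) \<in> borel_measurable borel"
      by simp
    show "\<bar>1 / cmod (- cnj p * x + 1)\<bar> \<le> 1 / (1 - cmod p)" if "x \<in> ball 0 1" for x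
      using reflected_lower_bound[of x p] that d by (simp add: frac_le)
  qed
qed simp

lemma integral_snd_fst:
  assumes int: "integrable lborel (f :: complex \<times> real \<Rightarrow> real)"
  shows "(\<integral>z. f z \<partial>lborel) = (\<integral>t. (\<integral>x. f (x, t) \<partial>lborel) \<partial>lborel)"
    "(\<integral>z. f z \<partial>lborel) = (\<integral>x. (\<integral>t. f (x, t) \<partial>lborel) \<partial>lborel)"
    "integrable lborel (\<lambda>t. \<integral>x. f (x, t) \<partial>lborel)"
proof -
  have "integrable (lborel \<Otimes>\<^sub>M lborel) (case_prod (\<lambda>x t. f (x, t)))"
    using int by (simp add: lborel_prod case_prod_unfold)
  from lborel_pair.integral_snd[OF this] lborel_pair.integral_fst[OF this] lborel_pair.integrable_snd[OF this]
  show "(\<integral>z. f z \<partial>lborel) = (\<integral>t. (\<integral>x. f (x, t) \<partial>lborel) \<partial>lborel)"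
    "(\<integral>z. f z \<partial>lborel) = (\<integral>x. (\<integral>t. f (x, t) \<partial>lborel) \<partial>lborel)"
    "integrable lborel (\<lambda>t. \<integral>x. f (x, t) \<partial>lborel)"
    by (simp_all add: lborel_prod case_prod_unfold)
qed

context box_test
begin

lemma measurable_slices: "(\<lambda>x. \<phi> (x, t)) \<in> borel_measurable borel"
  by (rule measurable_compose[OF borel_measurable_continuous_onI measurable(1)]) (intro continuous_intros)

text \<open>The substitution \<open>x = p + ?c n * y\<close> turns the density into the fixed
  \<open>profile\<close>, whose total mass is \<open>kappa\<close>; continuity of
  \<open>\<phi>\<close> then leaves its value at the pole.\<close>

lemma integral_ln_laplacian_pole:
  assumes p: "p \<in> ball 0 1" and k: "k \<in> borel_measurable borel" and kC: "\<And>t. \<bar>k t\<bar> \<le> C"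
  shows "(\<integral>z. k (snd z) * (ln (cmod (1 * fst z + - p)) * lap z) \<partial>lborel) = kappa * (\<integral>t. k t * \<phi> (p, t) \<partial>lborel)"
proof -
  interpret box_test_affine \<alpha> \<alpha>1 \<alpha>2 \<beta> \<beta>1 \<beta>2 \<gamma> \<gamma>1 l1 r1 l2 r2 1 "- p" k C
    using box_test_axioms affine_weight_pole[OF p] k kC
    by (simp add: box_test_affine_def box_test_affine_axioms_def)
  \<comment> \<open>\<open>?c n\<close> is the square root of \<open>eps n\<close>, the scale of the
    rescaling; \<open>eps\<close> is a square for this reason.\<close>
  let ?c = "\<lambda>n. inverse (real (Suc n))"
  define f where "f n x = 2 * (cmod 1)\<^sup>2 * eps n / (S n x)\<^sup>2" for n x
  have f_meas: "f n \<in> borel_measurable borel" for n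
    unfolding f_def using S_pos[of n]
    by (intro borel_measurable_continuous_onI continuous_intros continuous_S) (auto simp: less_imp_neq[symmetric])
  have f_int: "set_integrable lborel (ball 0 1) (f n)" for n
  proof (rule set_integrable_ball_bounded[OF f_meas])
    fix x
    have "(eps n)\<^sup>2 \<le> (S n x)\<^sup>2"
      using eps(1)[of n] by (intro power_mono) (auto simp: S_def)
    then show "\<bar>f n x\<bar> \<le> 2 * eps n / (eps n)\<^sup>2"
      using eps(1)[of n] S_pos[of n x] by (auto simp: f_def intro!: divide_left_mono)
  qed
  have int: "integrable lborel (\<lambda>z. k (snd z) * (f n (fst z) * \<phi> z))" for n
    by (rule integrable_box_supported[OF box_supported(1) k kC f_meas f_int])
  obtain T where T: "\<And>z. T < \<bar>snd z\<bar> \<Longrightarrow> \<phi> z = 0"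
    using support_time by metis
  obtain M where M: "M \<ge> 0" "\<And>z. \<bar>\<phi> z\<bar> \<le> M"
    using bounded by metis
  have inner: "(\<integral>x. k t * (f n x * \<phi> (x, t)) \<partial>lborel) = k t * (\<integral>y. profile y * \<phi> (p + ?c n *\<^sub>R y, t) \<partial>lborel)" for n t
  proof -
    have c: "?c n > 0" by simp
    have meas: "(\<lambda>x. f n x * \<phi> (x, t)) \<in> borel_measurable borel"
      using f_meas measurable_slices by (rule borel_measurable_times)
    have "(?c n)\<^sup>2 * f n (p + ?c n *\<^sub>R y) = profile y" for y
    proof -
      have "S n (p + ?c n *\<^sub>R y) = (?c n)\<^sup>2 * ((cmod y)\<^sup>2 + 1)"
        by (simp add: S_def eps_def power_mult_distrib algebra_simps)
      moreover have "(?c n)\<^sup>2 \<noteq> 0"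
        using c by simp
      ultimately show ?thesis
        unfolding f_def profile_def eps_def by (simp add: power_mult_distrib power2_eq_square)
    qed
    then have eq: "(?c n)\<^sup>2 * (f n (p + ?c n *\<^sub>R y) * \<phi> (p + ?c n *\<^sub>R y, t)) = profile y * \<phi> (p + ?c n *\<^sub>R y, t)" for y
      by (metis mult.assoc)
    have "(\<integral>x. f n x * \<phi> (x, t) \<partial>lborel) = (\<integral>y. profile y * \<phi> (p + ?c n *\<^sub>R y, t) \<partial>lborel)"
      by (simp only: integral_complex_affine[OF meas c, of p] integral_mult_right_zero[symmetric] eq)
    then show ?thesis
      by (simp only: integral_mult_right_zero)
  qed
  have lim_inner: "(\<lambda>n. \<integral>y. profile y * \<phi> (p + ?c n *\<^sub>R y, t) \<partial>lborel) \<longlonglongrightarrow> kappa * \<phi> (p, t)" for t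
  proof -
    have "(\<lambda>n. \<integral>y. profile y * \<phi> (p + ?c n *\<^sub>R y, t) \<partial>lborel) \<longlonglongrightarrow> (\<integral>y. profile y * \<phi> (p, t) \<partial>lborel)"
    proof (rule integral_dominated_convergence)
      show "integrable lborel (\<lambda>y. M * profile y)"
        using integrable_profile by simp
      have "(\<lambda>y. \<phi> (p + ?c n *\<^sub>R y, t)) \<in> borel_measurable borel" for n
        by (rule measurable_compose[OF borel_measurable_continuous_onI measurable_slices]) (intro continuous_intros)
      then show "(\<lambda>y. profile y * \<phi> (p + ?c n *\<^sub>R y, t)) \<in> borel_measurable lborel" for n
        using borel_measurable_times[OF measurable_profile] by simp
      show "(\<lambda>y. profile y * \<phi> (p, t)) \<in> borel_measurable lborel"
        using borel_measurable_times[OF measurable_profile borel_measurable_const] by simp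
      show "AE y in lborel. (\<lambda>n. profile y * \<phi> (p + ?c n *\<^sub>R y, t)) \<longlonglongrightarrow> profile y * \<phi> (p, t)"
      proof (intro always_eventually allI tendsto_mult tendsto_const)
        fix y
        have "(\<lambda>n. (p + ?c n *\<^sub>R y, t)) \<longlonglongrightarrow> (p + 0 *\<^sub>R y, t)"
          by (intro tendsto_intros LIMSEQ_inverse_real_of_nat)
        then show "(\<lambda>n. \<phi> (p + ?c n *\<^sub>R y, t)) \<longlonglongrightarrow> \<phi> (p, t)"
          using continuous_on_tendsto_compose[OF continuous(1)[of UNIV]] by simp
      qed
      show "AE y in lborel. norm (profile y * \<phi> (p + ?c n *\<^sub>R y, t)) \<le> M * profile y" for n
        using M profile_pos by (intro always_eventually allI) (simp add: abs_mult mult.commute mult_left_mono less_imp_le)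
    qed
    then show ?thesis
      by (simp add: kappa_def)
  qed
  \<comment> \<open>The outer limit, in the time integral, needs a majorant uniform in
    \<open>n\<close>: the mass of the profile times the bound and the time window of
    \<open>\<phi>\<close>.\<close>
  have inner_bound: "\<bar>\<integral>y. profile y * \<phi> (p + ?c n *\<^sub>R y, t) \<partial>lborel\<bar> \<le> M * kappa * indicator {-T..T} t" for n t
  proof (cases "T < \<bar>t\<bar>")
    case True
    then show ?thesis
      using T M(1) kappa_pos by (auto simp: indicator_def)
  next
    case False
    have "\<bar>\<integral>y. profile y * \<phi> (p + ?c n *\<^sub>R y, t) \<partial>lborel\<bar> \<le> (\<integral>y. M * profile y \<partial>lborel)"
      unfolding real_norm_def[symmetric]
    proof (rule Bochner_Integration.integral_norm_bound_integral)
      show "norm (profile y * \<phi> (p + ?c n *\<^sub>R y, t)) \<le> M * profile y" for y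
        using M profile_pos by (simp add: abs_mult mult.commute mult_left_mono less_imp_le)
      have "(\<lambda>y. \<phi> (p + ?c n *\<^sub>R y, t)) \<in> borel_measurable borel"
        by (rule measurable_compose[OF borel_measurable_continuous_onI measurable_slices]) (intro continuous_intros)
      then show "integrable lborel (\<lambda>y. profile y * \<phi> (p + ?c n *\<^sub>R y, t))"
        using M(2) by (intro integrable_mult_bounded[OF integrable_profile]) auto
    qed (use integrable_profile in simp)
    then show ?thesis
      using False by (auto simp: kappa_def indicator_def)
  qed
  have "(\<lambda>n. \<integral>z. k (snd z) * (f n (fst z) * \<phi> z) \<partial>lborel) \<longlonglongrightarrow> (\<integral>t. k t * (kappa * \<phi> (p, t)) \<partial>lborel)"
    unfolding integral_snd_fst(1)[OF int]
  proof (rule integral_dominated_convergence)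
    show "integrable lborel (\<lambda>t. C * (M * kappa * indicator {-T..T} t))"
      by (intro integrable_mult_right integrable_indicator_Icc)
    show "(\<lambda>t. \<integral>x. k (snd (x, t)) * (f n (fst (x, t)) * \<phi> (x, t)) \<partial>lborel) \<in> borel_measurable lborel" for n
      using integral_snd_fst(3)[OF int] by (rule borel_measurable_integrable)
    have "(\<lambda>t. \<phi> (p, t)) \<in> borel_measurable borel"
      by (rule measurable_compose[OF borel_measurable_continuous_onI measurable(1)]) (intro continuous_intros)
    then show "(\<lambda>t. k t * (kappa * \<phi> (p, t))) \<in> borel_measurable lborel"
      using k by simp
    show "AE t in lborel. (\<lambda>n. \<integral>x. k (snd (x, t)) * (f n (fst (x, t)) * \<phi> (x, t)) \<partial>lborel) \<longlonglongrightarrow> k t * (kappa * \<phi> (p, t))"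
      by (intro always_eventually allI) (simp only: inner fst_conv snd_conv, intro tendsto_mult tendsto_const lim_inner)
    show "AE t in lborel. norm (\<integral>x. k (snd (x, t)) * (f n (fst (x, t)) * \<phi> (x, t)) \<partial>lborel) \<le> C * (M * kappa * indicator {-T..T} t)" for n
    proof (intro always_eventually allI)
      fix t
      show "norm (\<integral>x. k (snd (x, t)) * (f n (fst (x, t)) * \<phi> (x, t)) \<partial>lborel) \<le> C * (M * kappa * indicator {-T..T} t)"
        unfolding fst_conv snd_conv inner real_norm_def abs_mult
        using kC[of t] kC[of 0] inner_bound[of n t] by (intro mult_mono) auto
    qed
  qed
  with integral_ln_cmod_laplacian have "(\<integral>z. k (snd z) * (ln (cmod (1 * fst z + - p)) * lap z) \<partial>lborel) = (\<integral>t. k t * (kappa * \<phi> (p, t)) \<partial>lborel)"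
    unfolding f_def by (rule LIMSEQ_unique)
  also have "(\<lambda>t. k t * (kappa * \<phi> (p, t))) = (\<lambda>t. kappa * (k t * \<phi> (p, t)))"
    by (simp add: mult_ac)
  finally show ?thesis
    by simp
qed

text \<open>On the disk \<open>1 - cnj p * x\<close> has modulus at least \<open>1 - cmod p\<close>,
  so the densities are bounded by a constant and tend to 0: no mass can concentrate.\<close>

lemma integral_ln_laplacian_no_pole:
  assumes p: "p \<in> ball 0 1" and k: "k \<in> borel_measurable borel" and kC: "\<And>t. \<bar>k t\<bar> \<le> C"
  shows "(\<integral>z. k (snd z) * (ln (cmod (- cnj p * fst z + 1)) * lap z) \<partial>lborel) = 0"
proof -
  define d where "d = 1 - cmod p"
  have d: "d > 0" using p by (simp add: d_def)
  have lower: "d \<le> cmod (- cnj p * x + 1)" if "x \<in> ball 0 1" for x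
    unfolding d_def using that by (intro reflected_lower_bound) auto
  interpret box_test_affine \<alpha> \<alpha>1 \<alpha>2 \<beta> \<beta>1 \<beta>2 \<gamma> \<gamma>1 l1 r1 l2 r2 "- cnj p" 1 k C
    using box_test_axioms affine_weight_reflected[OF p] k kC
    by (simp add: box_test_affine_def box_test_affine_axioms_def)
  have "(\<lambda>n. \<integral>z. k (snd z) * (2 * (cmod (- cnj p))\<^sup>2 * eps n / (S n (fst z))\<^sup>2 * \<phi> z) \<partial>lborel)
      \<longlonglongrightarrow> (\<integral>z. k (snd z) * (0 * \<phi> z) \<partial>lborel)"
  proof (rule tendsto_integral_box_supported[OF box_supported(1) k kC, where G = "\<lambda>_. 0"])
    show "(\<lambda>x. 2 * (cmod (- cnj p))\<^sup>2 * eps n / (S n x)\<^sup>2) \<in> borel_measurable borel" for n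
      using S_pos[of n]
      by (intro borel_measurable_continuous_onI continuous_intros continuous_S) (auto simp: less_imp_neq[symmetric])
    show "set_integrable lborel (ball 0 1) (\<lambda>x::complex. 2 * (cmod (- cnj p))\<^sup>2 * 1 / (d\<^sup>2)\<^sup>2)"
      by (rule set_integrable_ball_bounded) auto
    show "AE x in lborel. x \<in> ball 0 1 \<longrightarrow> \<bar>2 * (cmod (- cnj p))\<^sup>2 * eps n / (S n x)\<^sup>2\<bar> \<le> 2 * (cmod (- cnj p))\<^sup>2 * 1 / (d\<^sup>2)\<^sup>2" for n
    proof (intro always_eventually allI impI)
      fix x :: complex assume "x \<in> ball 0 1"
      then have "d\<^sup>2 \<le> (cmod (- cnj p * x + 1))\<^sup>2"
        using lower d by (intro power_mono) auto
      then have "d\<^sup>2 \<le> S n x"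
        using eps(1)[of n] unfolding S_def by linarith
      then have "(d\<^sup>2)\<^sup>2 \<le> (S n x)\<^sup>2"
        by (intro power_mono) auto
      then have "2 * (cmod (- cnj p))\<^sup>2 * eps n / (S n x)\<^sup>2 \<le> 2 * (cmod (- cnj p))\<^sup>2 * 1 / (d\<^sup>2)\<^sup>2"
        using d eps(1,2)[of n] by (intro frac_le mult_left_mono) auto
      moreover have "0 \<le> 2 * (cmod (- cnj p))\<^sup>2 * eps n / (S n x)\<^sup>2"
        using eps(1)[of n] by simp
      ultimately show "\<bar>2 * (cmod (- cnj p))\<^sup>2 * eps n / (S n x)\<^sup>2\<bar> \<le> 2 * (cmod (- cnj p))\<^sup>2 * 1 / (d\<^sup>2)\<^sup>2"
        by linarith
    qed
    show "AE x in lborel. x \<in> ball 0 1 \<longrightarrow> (\<lambda>n. 2 * (cmod (- cnj p))\<^sup>2 * eps n / (S n x)\<^sup>2) \<longlonglongrightarrow> 0"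
      using AE_nonzero
    proof eventually_elim
      case (elim x)
      have "(\<lambda>n. 2 * (cmod (- cnj p))\<^sup>2 * eps n / ((cmod (- cnj p * x + 1))\<^sup>2 + eps n)\<^sup>2)
        \<longlonglongrightarrow> 2 * (cmod (- cnj p))\<^sup>2 * 0 / ((cmod (- cnj p * x + 1))\<^sup>2 + 0)\<^sup>2"
        using elim by (intro tendsto_intros eps(3)) auto
      then show ?case by (simp add: S_def)
    qed
  qed simp
  then show "(\<integral>z. k (snd z) * (ln (cmod (- cnj p * fst z + 1)) * lap z) \<partial>lborel) = 0"
    using integral_ln_cmod_laplacian LIMSEQ_unique by fastforce
qed

end

section \<open>Green functions and barriers\<close>

definition green :: "complex \<Rightarrow> complex \<Rightarrow> real" where
  "green p x = ln (cmod (- cnj p * x + 1)) - ln (cmod (1 * x + - p))"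

definition barrier :: "complex \<Rightarrow> complex \<Rightarrow> real" where
  "barrier p x = green p x + (cmod (- cnj p * x + 1) - cmod (1 * x + - p))"

text \<open>With the cutoff inside the weight, integrals run over all of space-time, and the jump at
  time 0 produces the initial trace when integrating in time.\<close>

definition decay :: "real \<Rightarrow> real \<Rightarrow> real" where
  "decay c t = indicator {0..} t * exp (- c * t)"

text \<open>The factor \<open>1 - (cmod x)^2\<close> yields both that the reflected modulus is the
  larger one inside the disk and that the two agree on the circle.\<close>

lemma cmod_reflection_identity:
  "(cmod (- cnj p * x + 1))\<^sup>2 - (cmod (1 * x + - p))\<^sup>2 = (1 - (cmod p)\<^sup>2) * (1 - (cmod x)\<^sup>2)"
  unfolding cmod_power2 by (simp add: power2_eq_square algebra_simps)

lemma reflection_ge: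
  assumes "cmod p < 1" "cmod x \<le> 1"
  shows "cmod (1 * x + - p) \<le> cmod (- cnj p * x + 1)"
proof -
  have "0 \<le> (1 - (cmod p)\<^sup>2) * (1 - (cmod x)\<^sup>2)"
    using assms by (intro mult_nonneg_nonneg) (auto simp: power_le_one)
  then have "(cmod (1 * x + - p))\<^sup>2 \<le> (cmod (- cnj p * x + 1))\<^sup>2"
    unfolding cmod_reflection_identity[symmetric] by simp
  then show ?thesis
    by (rule power2_le_imp_le) simp
qed

lemma reflection_pos:
  assumes "cmod p < 1" "cmod x \<le> 1"
  shows "0 < cmod (- cnj p * x + 1)"
  using reflected_lower_bound[OF assms(2), of p] assms(1) by linarith

lemma green_nonneg:
  assumes "cmod p < 1" "cmod x \<le> 1" "x \<noteq> p"
  shows "0 \<le> green p x"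
proof -
  have "0 < cmod (1 * x + - p)" using assms by simp
  then have "ln (cmod (1 * x + - p)) \<le> ln (cmod (- cnj p * x + 1))"
    using reflection_ge[OF assms(1,2)] reflection_pos[OF assms(1,2)] ln_le_cancel_iff by blast
  then show ?thesis
    unfolding green_def by linarith
qed

lemma green_le_barrier:
  assumes "cmod p < 1" "cmod x \<le> 1"
  shows "green p x \<le> barrier p x"
  using reflection_ge[OF assms] by (simp add: barrier_def)

lemma green_sphere: "cmod x = 1 \<Longrightarrow> green p x = 0" and barrier_sphere: "cmod x = 1 \<Longrightarrow> barrier p x = 0"
proof -
  assume "cmod x = 1"
  then have "(cmod (- cnj p * x + 1))\<^sup>2 = (cmod (1 * x + - p))\<^sup>2"
    using cmod_reflection_identity[of p x] by simp
  then have "cmod (- cnj p * x + 1) = cmod (1 * x + - p)"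
    by (rule power2_eq_imp_eq) simp_all
  then show "green p x = 0" "barrier p x = 0"
    by (simp_all add: green_def barrier_def)
qed

text \<open>With \<open>d \<le> a \<le> 2\<close>, \<open>ln (a / d) \<le> (a - d) / d\<close>, so
  the barrier is at most \<open>(a - d) * (1 + d) / d\<close>; the numerator is at most
  \<open>2 + 2 * 2\<close>, which is the constant 6.\<close>

lemma barrier_le_inverse:
  assumes p: "cmod p < 1" and x: "cmod x \<le> 1" and ne: "x \<noteq> p"
  shows "barrier p x \<le> 6 / cmod (1 * x + - p)"
proof -
  define a d where "a = cmod (- cnj p * x + 1)" and "d = cmod (1 * x + - p)"
  have d: "0 < d" "d \<le> a" "d \<le> 2"
    using ne reflection_ge[OF p x] norm_triangle_ineq4[of x p] p x by (auto simp: a_def d_def)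
  have a: "0 < a" "a \<le> 2"
    using d norm_triangle_ineq4[of 1 "cnj p * x"] mult_mono[of "cmod p" 1 "cmod x" 1] p x
    by (auto simp: a_def norm_mult norm_minus_commute)
  have "green p x = ln (a / d)"
    using a d ln_div[of a d] unfolding green_def a_def[symmetric] d_def[symmetric] by simp
  also have "\<dots> \<le> a / d - 1"
    using a d by (intro ln_le_minus_one) simp
  finally have "barrier p x \<le> a / d - 1 + (a - d)"
    unfolding barrier_def a_def[symmetric] d_def[symmetric] by simp
  also have "\<dots> \<le> 6 / d"
  proof -
    have "a - d + (a - d) * d \<le> 2 + 2 * 2"
      using a d by (intro add_mono mult_mono) auto
    then have "(a - d + (a - d) * d) / d \<le> 6 / d"
      using d by (intro divide_right_mono) auto
    moreover have "a / d - 1 + (a - d) = (a - d + (a - d) * d) / d"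
      using d by (simp add: field_simps)
    ultimately show ?thesis
      by simp
  qed
  finally show ?thesis unfolding d_def .
qed

lemma measurable_green: "green p \<in> borel_measurable borel"
  and measurable_barrier: "barrier p \<in> borel_measurable borel"
proof -
  have m: "(\<lambda>x. cmod (a * x + b)) \<in> borel_measurable borel" for a b
    by (rule borel_measurable_continuous_onI) (intro continuous_intros)
  have g: "green p \<in> borel_measurable borel"
    unfolding green_def[abs_def] by (intro borel_measurable_diff borel_measurable_ln m)
  then show "green p \<in> borel_measurable borel" .
  show "barrier p \<in> borel_measurable borel"
    unfolding barrier_def[abs_def] by (intro borel_measurable_add g borel_measurable_diff m)
qed

lemma decay_measurable: "decay c \<in> borel_measurable borel"
  unfolding decay_def[abs_def]
  by (intro borel_measurable_times borel_measurable_indicator borel_measurable_continuous_onI continuous_intros) auto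

lemma decay_bound: "0 \<le> c \<Longrightarrow> \<bar>decay c t\<bar> \<le> 1" and decay_nonneg: "0 \<le> decay c t"
  by (auto simp: decay_def indicator_def)

lemma set_integrable_green:
  assumes "p \<in> ball 0 1"
  shows "set_integrable lborel (ball 0 1) (green p)" "set_integrable lborel (ball 0 1) (barrier p)"
proof -
  interpret P: affine_weight 1 "- p"
    by (rule affine_weight_pole[OF assms])
  interpret Q: affine_weight "- cnj p" 1
    by (rule affine_weight_reflected[OF assms])
  show g: "set_integrable lborel (ball 0 1) (green p)"
    unfolding green_def[abs_def] by (intro set_integral_diff(1) P.set_integrable_ln_cmod Q.set_integrable_ln_cmod)
  show "set_integrable lborel (ball 0 1) (barrier p)"
    unfolding barrier_def[abs_def]
    by (intro set_integral_add(1) set_integral_diff(1) g P.set_integrable_cmod_affine Q.set_integrable_cmod_affine)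
qed

context box_test_affine
begin

lemma integrable_affine_tests:
  assumes "box_supported \<psi>"
  shows "integrable lborel (\<lambda>z. k (snd z) * (ln (cmod (a * fst z + b)) * \<psi> z))"
    "integrable lborel (\<lambda>z. k (snd z) * (cmod (a * fst z + b) * \<psi> z))"
    "integrable lborel (\<lambda>z. k (snd z) * (1 / cmod (a * fst z + b) * \<psi> z))"
  using integrable_box_supported[OF assms k kC borel_measurable_ln[OF measurable_cmod_affine] set_integrable_ln_cmod]
    integrable_box_supported[OF assms k kC measurable_cmod_affine set_integrable_cmod_affine]
    integrable_box_supported[OF assms k kC _ inverse_integrable] measurable_cmod_affine
  by simp_all

end

context box_test
begin

lemma affine_pole:
  assumes "p \<in> ball 0 1" "k \<in> borel_measurable borel" "\<And>t. \<bar>k t\<bar> \<le> C"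
  shows "box_test_affine \<alpha> \<alpha>1 \<alpha>2 \<beta> \<beta>1 \<beta>2 \<gamma> \<gamma>1 l1 r1 l2 r2 1 (- p) k C"
  using box_test_axioms affine_weight_pole[OF assms(1)] assms(2,3)
  by (simp add: box_test_affine_def box_test_affine_axioms_def)

lemma affine_reflected:
  assumes "p \<in> ball 0 1" "k \<in> borel_measurable borel" "\<And>t. \<bar>k t\<bar> \<le> C"
  shows "box_test_affine \<alpha> \<alpha>1 \<alpha>2 \<beta> \<beta>1 \<beta>2 \<gamma> \<gamma>1 l1 r1 l2 r2 (- cnj p) 1 k C"
  using box_test_axioms affine_weight_reflected[OF assms(1)] assms(2,3)
  by (simp add: box_test_affine_def box_test_affine_axioms_def)

lemma integral_green_laplacian:
  assumes p: "p \<in> ball 0 1" and k: "k \<in> borel_measurable borel" and kC: "\<And>t. \<bar>k t\<bar> \<le> C"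
  shows "(\<integral>z. k (snd z) * (green p (fst z) * lap z) \<partial>lborel) = - kappa * (\<integral>t. k t * \<phi> (p, t) \<partial>lborel)"
proof -
  interpret P: box_test_affine \<alpha> \<alpha>1 \<alpha>2 \<beta> \<beta>1 \<beta>2 \<gamma> \<gamma>1 l1 r1 l2 r2 1 "- p" k C
    by (rule affine_pole[OF assms])
  interpret Q: box_test_affine \<alpha> \<alpha>1 \<alpha>2 \<beta> \<beta>1 \<beta>2 \<gamma> \<gamma>1 l1 r1 l2 r2 "- cnj p" 1 k C
    by (rule affine_reflected[OF assms])
  have "(\<integral>z. k (snd z) * (green p (fst z) * lap z) \<partial>lborel) =
    (\<integral>z. k (snd z) * (ln (cmod (- cnj p * fst z + 1)) * lap z) - k (snd z) * (ln (cmod (1 * fst z + - p)) * lap z) \<partial>lborel)"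
    by (simp only: green_def left_diff_distrib right_diff_distrib)
  also have "\<dots> = 0 - kappa * (\<integral>t. k t * \<phi> (p, t) \<partial>lborel)"
    using P.integrable_affine_tests(1)[OF box_supported(2)] Q.integrable_affine_tests(1)[OF box_supported(2)]
    by (simp only: Bochner_Integration.integral_diff integral_ln_laplacian_no_pole[OF assms] integral_ln_laplacian_pole[OF assms])
  finally show ?thesis by simp
qed

text \<open>The Laplacian of the barrier is a negative point mass at \<open>p\<close> plus
  \<open>(cmod p)^2 / a - 1 / d\<close>, where \<open>a \<ge> d\<close> are the two moduli. The
  density is at most \<open>- (1 - (cmod p)^2) / d\<close>, hence at most \<open>- c\<close> times
  the barrier.\<close>

lemma integral_barrier_laplacian:
  assumes p: "p \<in> ball 0 1" and k: "k \<in> borel_measurable borel" and kC: "\<And>t. \<bar>k t\<bar> \<le> C"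
    and k0: "\<And>t. 0 \<le> k t" and c: "c \<le> (1 - (cmod p)\<^sup>2) / 6" "0 \<le> c"
  shows "(\<integral>z. k (snd z) * (barrier p (fst z) * lap z) \<partial>lborel) \<le> - c * (\<integral>z. k (snd z) * (barrier p (fst z) * \<phi> z) \<partial>lborel)"
proof -
  interpret P: box_test_affine \<alpha> \<alpha>1 \<alpha>2 \<beta> \<beta>1 \<beta>2 \<gamma> \<gamma>1 l1 r1 l2 r2 1 "- p" k C
    by (rule affine_pole[OF p k kC])
  interpret Q: box_test_affine \<alpha> \<alpha>1 \<alpha>2 \<beta> \<beta>1 \<beta>2 \<gamma> \<gamma>1 l1 r1 l2 r2 "- cnj p" 1 k C
    by (rule affine_reflected[OF p k kC])
  have int_g: "integrable lborel (\<lambda>z. k (snd z) * (green p (fst z) * lap z))"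
    by (rule integrable_box_supported[OF box_supported(2) k kC measurable_green set_integrable_green(1)[OF p]])
  have int_b: "integrable lborel (\<lambda>z. k (snd z) * (barrier p (fst z) * \<phi> z))"
    by (rule integrable_box_supported[OF box_supported(1) k kC measurable_barrier set_integrable_green(2)[OF p]])
  note ints = P.integrable_affine_tests(2)[OF box_supported(2)] Q.integrable_affine_tests(2)[OF box_supported(2)]
  \<comment> \<open>The point mass has the favourable sign because both the weight and the test
    function are nonnegative.\<close>
  have green_le: "(\<integral>z. k (snd z) * (green p (fst z) * lap z) \<partial>lborel) \<le> 0"
    unfolding integral_green_laplacian[OF p k kC]
    using kappa_pos k0 \<phi>_nonneg by (auto intro!: mult_nonneg_nonneg integral_nonneg_AE)
  have "(\<integral>z. k (snd z) * (barrier p (fst z) * lap z) \<partial>lborel) =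
    (\<integral>z. k (snd z) * (green p (fst z) * lap z) + (k (snd z) * (cmod (- cnj p * fst z + 1) * lap z) -
      k (snd z) * (cmod (1 * fst z + - p) * lap z)) \<partial>lborel)"
    by (simp only: barrier_def left_diff_distrib right_diff_distrib distrib_left distrib_right)
  also have "\<dots> = (\<integral>z. k (snd z) * (green p (fst z) * lap z) \<partial>lborel) +
     ((\<integral>z. k (snd z) * ((cmod (- cnj p))\<^sup>2 / cmod (- cnj p * fst z + 1) * \<phi> z) \<partial>lborel) -
      (\<integral>z. k (snd z) * ((cmod 1)\<^sup>2 / cmod (1 * fst z + - p) * \<phi> z) \<partial>lborel))"
    unfolding P.integral_cmod_laplacian[symmetric] Q.integral_cmod_laplacian[symmetric]
    using int_g ints by (simp only: Bochner_Integration.integral_diff Bochner_Integration.integral_add Bochner_Integration.integrable_diff)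
  also have "\<dots> \<le> (\<integral>z. k (snd z) * ((cmod (- cnj p))\<^sup>2 / cmod (- cnj p * fst z + 1) * \<phi> z) \<partial>lborel) -
      (\<integral>z. k (snd z) * ((cmod 1)\<^sup>2 / cmod (1 * fst z + - p) * \<phi> z) \<partial>lborel)"
    using green_le by simp
  also have "\<dots> = (\<integral>z. (cmod p)\<^sup>2 * (k (snd z) * (1 / cmod (- cnj p * fst z + 1) * \<phi> z)) -
      k (snd z) * (1 / cmod (1 * fst z + - p) * \<phi> z) \<partial>lborel)"
  proof -
    have "(\<integral>z. k (snd z) * ((cmod (- cnj p))\<^sup>2 / cmod (- cnj p * fst z + 1) * \<phi> z) \<partial>lborel) =
        (\<integral>z. (cmod p)\<^sup>2 * (k (snd z) * (1 / cmod (- cnj p * fst z + 1) * \<phi> z)) \<partial>lborel)"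
      by (rule Bochner_Integration.integral_cong) (simp_all add: mult_ac)
    moreover have "(\<integral>z. k (snd z) * ((cmod 1)\<^sup>2 / cmod (1 * fst z + - p) * \<phi> z) \<partial>lborel) =
        (\<integral>z. k (snd z) * (1 / cmod (1 * fst z + - p) * \<phi> z) \<partial>lborel)"
      by simp
    moreover note Bochner_Integration.integral_diff[OF
      integrable_mult_right[OF Q.integrable_affine_tests(3)[OF box_supported(1)], of "(cmod p)\<^sup>2"]
      P.integrable_affine_tests(3)[OF box_supported(1)]]
    ultimately show ?thesis
      by (simp only:)
  qed
  also have "\<dots> \<le> (\<integral>z. - c * (k (snd z) * (barrier p (fst z) * \<phi> z)) \<partial>lborel)"
  proof (rule integral_mono_AE)
    show "integrable lborel (\<lambda>z. (cmod p)\<^sup>2 * (k (snd z) * (1 / cmod (- cnj p * fst z + 1) * \<phi> z)) -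
        k (snd z) * (1 / cmod (1 * fst z + - p) * \<phi> z))"
      using P.integrable_affine_tests(3)[OF box_supported(1)] Q.integrable_affine_tests(3)[OF box_supported(1)]
      by (intro Bochner_Integration.integrable_diff integrable_mult_right)
    show "integrable lborel (\<lambda>z. - c * (k (snd z) * (barrier p (fst z) * \<phi> z)))"
      using int_b by (rule integrable_mult_right)
    show "AE z in lborel. (cmod p)\<^sup>2 * (k (snd z) * (1 / cmod (- cnj p * fst z + 1) * \<phi> z)) -
        k (snd z) * (1 / cmod (1 * fst z + - p) * \<phi> z) \<le> - c * (k (snd z) * (barrier p (fst z) * \<phi> z))"
      using AE_lborel_fst[OF P.AE_nonzero]
    proof eventually_elim
      case (elim z)
      show ?case
      proof (cases "fst z \<in> ball 0 1")
        case True
        define a d where "a = cmod (- cnj p * fst z + 1)" and "d = cmod (1 * fst z + - p)"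
        have p1: "cmod p < 1" "cmod (fst z) \<le> 1" and ne: "fst z \<noteq> p"
          using p True elim by auto
        have d: "0 < d" "d \<le> a"
          using ne reflection_ge[OF p1] by (auto simp: a_def d_def)
        \<comment> \<open>The 6 from the barrier bound cancels against the 6 in the hypothesis on
          \<open>c\<close>; then \<open>1 / d\<close> is replaced by the smaller
          \<open>1 / a\<close> in the reflected term.\<close>
        have "c * barrier p (fst z) \<le> c * (6 / d)"
          using barrier_le_inverse[OF p1 ne] c(2) unfolding d_def by (rule mult_left_mono)
        also have "\<dots> \<le> (1 - (cmod p)\<^sup>2) / 6 * (6 / d)"
          using c(1) d by (intro mult_right_mono) auto
        also have "\<dots> = 1 / d - (cmod p)\<^sup>2 * (1 / d)"
          by (simp add: diff_divide_distrib)
        also have "\<dots> \<le> 1 / d - (cmod p)\<^sup>2 * (1 / a)"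
          using d by (intro diff_mono mult_left_mono frac_le) auto
        finally have "(cmod p)\<^sup>2 * (1 / a) - 1 / d \<le> - c * barrier p (fst z)"
          by linarith
        then have "(k (snd z) * \<phi> z) * ((cmod p)\<^sup>2 * (1 / a) - 1 / d) \<le> (k (snd z) * \<phi> z) * (- c * barrier p (fst z))"
          using k0 \<phi>_nonneg by (intro mult_left_mono mult_nonneg_nonneg)
        then show ?thesis
          unfolding a_def[symmetric] d_def[symmetric] by (simp add: algebra_simps)
      qed (simp add: support_disk)
    qed
  qed
  finally show ?thesis
    by simp
qed

text \<open>For fixed \<open>x\<close>, \<open>exp (- c * t) * (c * \<phi> - dt)\<close> is the time
  derivative of \<open>- exp (- c * t) * \<phi>\<close>, and the fundamental theorem leaves the
  initial trace.\<close>

lemma integral_time: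
  assumes g: "g \<in> borel_measurable borel" "set_integrable lborel (ball 0 1) g" and c: "0 \<le> c"
  shows "(\<integral>z. decay c (snd z) * (g (fst z) * (c * \<phi> z - dt z)) \<partial>lborel) = (\<integral>x. g x * \<phi> (x, 0) \<partial>lborel)"
proof -
  obtain T where T: "T > 0" "\<And>z. T < \<bar>snd z\<bar> \<Longrightarrow> \<phi> z = 0 \<and> dt z = 0"
    using support_time by metis
  have "integrable lborel (\<lambda>z. c * (decay c (snd z) * (g (fst z) * \<phi> z)) - decay c (snd z) * (g (fst z) * dt z))"
    by (intro Bochner_Integration.integrable_diff integrable_mult_right
        integrable_box_supported[OF box_supported(1) decay_measurable decay_bound[OF c] g]
        integrable_box_supported[OF box_supported(3) decay_measurable decay_bound[OF c] g])
  then have int: "integrable lborel (\<lambda>z. decay c (snd z) * (g (fst z) * (c * \<phi> z - dt z)))"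
    by (simp add: algebra_simps)
  have "(\<integral>t. decay c t * (c * \<phi> (x, t) - dt (x, t)) \<partial>lborel) = \<phi> (x, 0)" for x
  proof -
    let ?F = "\<lambda>t. - exp (- c * t) * \<phi> (x, t)" and ?f = "\<lambda>t. exp (- c * t) * (c * \<phi> (x, t) - dt (x, t))"
    have d\<phi>: "((\<lambda>t. \<phi> (x, t)) has_real_derivative dt (x, t)) (at t)" for t
      unfolding \<phi>_def dt_def tensor_def using \<gamma>_deriv by (auto intro!: derivative_eq_intros)
    have "(?F has_real_derivative ?f t) (at t)" for t
      by (rule derivative_eq_intros d\<phi> refl | simp)+ (simp add: algebra_simps)
    moreover have "isCont ?f t" for t
    proof -
      have "continuous_on UNIV ?f"
        by (intro continuous_intros continuous_on_compose2[OF continuous(1)[of UNIV]]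
            continuous_on_compose2[OF continuous(3)[of UNIV]]) auto
      then show ?thesis
        by (simp add: continuous_on_eq_continuous_at)
    qed
    \<comment> \<open>\<open>T + 1\<close> rather than \<open>T\<close>: the test function is known
      to vanish only strictly beyond \<open>T\<close>.\<close>
    ultimately have "(\<integral>t. ?f t * indicator {0..T + 1} t \<partial>lborel) = ?F (T + 1) - ?F 0"
      using T(1) by (intro integral_FTC_Icc_real) auto
    also have "\<dots> = \<phi> (x, 0)"
      using T by simp
    also have "(\<lambda>t. ?f t * indicator {0..T + 1} t) = (\<lambda>t. decay c t * (c * \<phi> (x, t) - dt (x, t)))"
    proof
      fix t
      show "?f t * indicator {0..T + 1} t = decay c t * (c * \<phi> (x, t) - dt (x, t))"
        using T(2)[of "(x, t)"] by (cases "t > T + 1") (auto simp: decay_def indicator_def)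
    qed
    finally show ?thesis .
  qed
  then have "(\<integral>t. decay c t * (g x * (c * \<phi> (x, t) - dt (x, t))) \<partial>lborel) = g x * \<phi> (x, 0)" for x
    by (simp add: mult.left_commute[of _ "g x"])
  then show ?thesis
    unfolding integral_snd_fst(2)[OF int] by simp
qed

end

section \<open>A minimum principle for weak supersolutions\<close>

lemma second_derivative_at_min_nonneg:
  fixes g :: "real \<Rightarrow> real"
  assumes g: "\<And>s. (g has_real_derivative g' s) (at s)" and g': "(g' has_real_derivative D) (at 0)"
    and d: "0 < d" "\<And>s. \<bar>s\<bar> < d \<Longrightarrow> g 0 \<le> g s"
  shows "0 \<le> D"
proof (rule ccontr)
  assume "\<not> 0 \<le> D"
  then obtain e where e: "0 < e" "\<And>h. 0 < h \<Longrightarrow> h < e \<Longrightarrow> g' h < g' 0"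
    using DERIV_neg_dec_right[OF g'] by auto
  have "g' 0 = 0"
    using DERIV_local_min[OF g d(1)] d(2) by auto
  define h where "h = min d e / 2"
  have h: "0 < h" "h < d" "h < e"
    using d(1) e(1) by (auto simp: h_def)
  obtain s where s: "0 < s" "s < h" "g h - g 0 = (h - 0) * g' s"
    using MVT2[of 0 h g g'] g h(1) by auto
  then have "g h < g 0"
    using e(2)[of s] h \<open>g' 0 = 0\<close> mult_pos_neg[of h "g' s"] by auto
  then show False
    using d(2)[of h] h by simp
qed

text \<open>Adding \<open>e * (t - t1)\<close> makes the supersolution strict. At a minimum below
  \<open>b\<close>, which must avoid the initial and lateral boundary, the second space derivatives
  are nonnegative and the time derivative of \<open>W\<close> is at most \<open>- e\<close>, a
  contradiction.\<close>

lemma parabolic_minimum_principle: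
  fixes W :: "complex \<times> real \<Rightarrow> real"
  assumes cont: "continuous_on (cball 0 R \<times> {t1..t2}) W"
    and dt: "\<And>z. ((\<lambda>s. W (z + s *\<^sub>R (0, 1))) has_real_derivative Wt z) (at 0)"
    and dx: "\<And>z. ((\<lambda>s. W (z + s *\<^sub>R (1, 0))) has_real_derivative Wx z) (at 0)"
      "\<And>z. ((\<lambda>s. Wx (z + s *\<^sub>R (1, 0))) has_real_derivative Wxx z) (at 0)"
    and dy: "\<And>z. ((\<lambda>s. W (z + s *\<^sub>R (\<i>, 0))) has_real_derivative Wy z) (at 0)"
      "\<And>z. ((\<lambda>s. Wy (z + s *\<^sub>R (\<i>, 0))) has_real_derivative Wyy z) (at 0)"
    and super: "\<And>x t. cmod x < R \<Longrightarrow> t1 < t \<Longrightarrow> t \<le> t2 \<Longrightarrow> 0 \<le> Wt (x, t) - Wxx (x, t) - Wyy (x, t)"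
    and lateral: "\<And>x t. cmod x = R \<Longrightarrow> t1 \<le> t \<Longrightarrow> t \<le> t2 \<Longrightarrow> b \<le> W (x, t)"
    and initial: "\<And>x. cmod x \<le> R \<Longrightarrow> b \<le> W (x, t1)"
    and x0: "cmod x0 \<le> R" "t1 \<le> t0" "t0 \<le> t2"
  shows "b \<le> W (x0, t0)"
proof (rule ccontr)
  assume neg: "\<not> b \<le> W (x0, t0)"
  \<comment> \<open>The summand 1 keeps \<open>L\<close> positive when \<open>t0 = t1\<close>. The
    factor 2 in \<open>e\<close> below keeps the perturbed value at \<open>(x0, t0)\<close> under
    \<open>b\<close>.\<close>
  define L where "L = t0 - t1 + 1"
  have L: "0 < L" "t0 - t1 \<le> L"
    using x0 by (simp_all add: L_def)
  define e where "e = (b - W (x0, t0)) / (2 * L)"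
  have e: "0 < e"
    using neg L by (simp add: e_def)
  define V where "V z = W z + e * (snd z - t1)" for z
  let ?K = "cball (0::complex) R \<times> {t1..t2}"
  have "continuous_on ?K V"
    unfolding V_def by (intro continuous_intros cont)
  moreover have "compact ?K"
    by (rule compact_Times[OF compact_cball compact_Icc])
  moreover have "(x0, t0) \<in> ?K"
    using x0 by simp
  then have "?K \<noteq> {}"
    by blast
  ultimately obtain z1 where z1: "z1 \<in> ?K" "\<And>z. z \<in> ?K \<Longrightarrow> V z1 \<le> V z"
    using continuous_attains_inf[of ?K V] by blast
  obtain x1 s1 where [simp]: "z1 = (x1, s1)"
    by (cases z1)
  have "2 * (e * (t0 - t1)) \<le> 2 * (e * L)"
    using e L by simp
  also have "\<dots> = b - W (x0, t0)"
    using L by (simp add: e_def)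
  finally have "V (x0, t0) < b"
    using neg by (simp add: V_def)
  then have low: "V (x1, s1) < b"
    using z1(2)[of "(x0, t0)"] x0 by simp
  have W_le: "W (x1, s1) \<le> V (x1, s1)"
    using z1(1) e by (simp add: V_def)
  have z1': "cmod x1 \<le> R" "t1 \<le> s1" "s1 \<le> t2"
    using z1(1) by simp_all
  have "cmod x1 \<noteq> R" "s1 \<noteq> t1"
    using lateral[of x1 s1] initial[of x1] z1' low W_le by force+
  then have x1: "cmod x1 < R" and s1: "t1 < s1" "s1 \<le> t2"
    using z1' by simp_all
  \<comment> \<open>The minimum may lie on the final slice, so it is compared with earlier times
    only; this gives an inequality instead of a vanishing derivative.\<close>
  have "Wt (x1, s1) + e \<le> 0"
  proof (rule ccontr)
    assume pos: "\<not> Wt (x1, s1) + e \<le> 0"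
    have "((\<lambda>s. W (x1, s1 + s)) has_real_derivative Wt (x1, s1)) (at 0)"
      using dt[of "(x1, s1)"] by simp
    moreover have "((\<lambda>s. e * (s1 + s - t1)) has_real_derivative e) (at 0)"
      by (auto intro!: derivative_eq_intros)
    ultimately have "((\<lambda>s. W (x1, s1 + s) + e * (s1 + s - t1)) has_real_derivative Wt (x1, s1) + e) (at 0)"
      by (rule DERIV_add)
    from DERIV_pos_inc_left[OF this] pos
    obtain d where d: "0 < d" "\<And>h. 0 < h \<Longrightarrow> h < d \<Longrightarrow> W (x1, s1 - h) + e * (s1 - h - t1) < W (x1, s1) + e * (s1 - t1)"
      by auto
    define h where "h = min d (s1 - t1) / 2"
    have h: "0 < h" "h < d" "h \<le> s1 - t1"
      using d(1) s1 by (auto simp: h_def)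
    have "V (x1, s1) \<le> V (x1, s1 - h)"
      using z1 h s1 by auto
    then show False
      using d(2)[OF h(1,2)] by (simp add: V_def)
  qed
  moreover have "0 \<le> D"
    if v: "cmod v = 1" and "\<And>z. ((\<lambda>s. W (z + s *\<^sub>R (v, 0))) has_real_derivative W' z) (at 0)"
      "((\<lambda>s. W' ((x1, s1) + s *\<^sub>R (v, 0))) has_real_derivative D) (at 0)" for v W' D
  proof (rule second_derivative_at_min_nonneg)
    show "((\<lambda>s. W ((x1, s1) + s *\<^sub>R (v, 0))) has_real_derivative W' ((x1, s1) + s *\<^sub>R (v, 0))) (at s)" for s
      using that(2)[of "(x1, s1) + s *\<^sub>R (v, 0)"] DERIV_shift[of "\<lambda>s. W ((x1, s1) + s *\<^sub>R (v, 0))" _ 0 s]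
      by (simp add: algebra_simps)
    show "((\<lambda>s. W' ((x1, s1) + s *\<^sub>R (v, 0))) has_real_derivative D) (at 0)"
      by (rule that(3))
    show "0 < R - cmod x1" using x1 by simp
    show "W ((x1, s1) + 0 *\<^sub>R (v, 0)) \<le> W ((x1, s1) + s *\<^sub>R (v, 0))" if "\<bar>s\<bar> < R - cmod x1" for s
    proof -
      have "cmod (x1 + s *\<^sub>R v) \<le> R"
        using that norm_triangle_ineq[of x1 "s *\<^sub>R v"] v by simp
      then have "V (x1, s1) \<le> V (x1 + s *\<^sub>R v, s1)"
        using z1 s1 by auto
      then show ?thesis
        by (simp add: V_def flip: zero_prod_def)
    qed
  qed
  from this[of 1, OF _ dx(1) dx(2)] this[of \<i>, OF _ dy(1) dy(2)]
  have "0 \<le> Wxx (x1, s1)" "0 \<le> Wyy (x1, s1)"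
    by auto
  ultimately show False
    using super[OF x1 s1] e by linarith
qed

text \<open>On a closed annulus free of sources, over a bounded time interval, \<open>z\<close> is
  uniformly continuous, so it can be compared with its value at the radial projection
  \<open>sgn x\<close>.\<close>

lemma nonneg_near_sphere:
  fixes z :: "complex \<times> real \<Rightarrow> real"
  assumes P: "finite P" "P \<subseteq> ball 0 1"
    and cont: "continuous_on ((cball 0 1 - P) \<times> {0..}) z"
    and sphere: "\<And>x t. cmod x = 1 \<Longrightarrow> 0 \<le> t \<Longrightarrow> 0 \<le> z (x, t)" and a: "0 < a"
  obtains r where "0 < r" "r < 1" "\<And>x t. r \<le> cmod x \<Longrightarrow> cmod x < 1 \<Longrightarrow> 0 \<le> t \<Longrightarrow> t \<le> T \<Longrightarrow> - a \<le> z (x, t)"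
proof -
  obtain r1 where r1: "0 < r1" "r1 < 1" "\<And>p. p \<in> P \<Longrightarrow> cmod p < r1"
  proof (cases "P = {}")
    case False
    have m: "Max (cmod ` P) < 1" "\<And>p. p \<in> P \<Longrightarrow> cmod p \<le> Max (cmod ` P)"
      using P False by auto
    define r1 where "r1 = (1 + max 0 (Max (cmod ` P))) / 2"
    have "0 < r1" "r1 < 1" "Max (cmod ` P) < r1"
      using m(1) by (auto simp: r1_def max_def)
    then show ?thesis
      using m(2) by (intro that[of r1]) (auto intro: le_less_trans)
  qed (use that[of "1/2"] in auto)
  let ?K = "(cball (0::complex) 1 - ball 0 r1) \<times> {0..T}"
  have "compact ?K"
    by (intro compact_Times compact_diff compact_cball compact_Icc open_ball)
  moreover have "continuous_on ?K z"
    by (rule continuous_on_subset[OF cont]) (use r1 in force)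
  ultimately have "uniformly_continuous_on ?K z"
    by (rule compact_uniformly_continuous[rotated])
  then obtain d where d: "0 < d" "\<And>w w'. w \<in> ?K \<Longrightarrow> w' \<in> ?K \<Longrightarrow> dist w' w < d \<Longrightarrow> dist (z w') (z w) < a"
    using a unfolding uniformly_continuous_on_def by metis
  define r where "r = max r1 (1 - d / 2)"
  show ?thesis
  proof (rule that)
    show "0 < r" "r < 1"
      using r1 d(1) by (auto simp: r_def)
    fix x t assume x: "r \<le> cmod x" "cmod x < 1" and t: "0 \<le> t" "t \<le> T"
    have x0: "cmod x > 0" using x \<open>0 < r\<close> by linarith
    have sgn: "cmod (sgn x) = 1"
      using x0 by (simp add: norm_sgn)
    have "x - sgn x = (cmod x - 1) *\<^sub>R sgn x"
      using x0 by (simp add: sgn_div_norm algebra_simps)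
    then have "dist x (sgn x) = 1 - cmod x"
      using sgn x by (simp add: dist_norm)
    then have "dist (x, t) (sgn x, t) < d"
      using x d(1) by (simp add: dist_Pair_Pair r_def)
    moreover have "(x, t) \<in> ?K" "(sgn x, t) \<in> ?K"
      using x t sgn r1 by (auto simp: r_def)
    ultimately have "dist (z (x, t)) (z (sgn x, t)) < a"
      using d(2) by blast
    then show "- a \<le> z (x, t)"
      using sphere[OF sgn t(1)] by (simp add: dist_real_def)
  qed
qed

section \<open>Mollified supersolutions\<close>

lemma integral_reflected_tensor:
  assumes "\<And>x. h (- x) = h x" "smooth_compact h"
  shows "(\<integral>y. tensor h h h (w - y) \<partial>lborel) = (\<integral>y. tensor h h h y \<partial>lborel)"
proof -
  have "tensor h h h (w - y) = tensor h h h (y + - w)" for y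
    using assms(1)[of "Re (fst w) - Re (fst y)"] assms(1)[of "Im (fst w) - Im (fst y)"] assms(1)[of "snd w - snd y"]
    by (simp add: tensor_def)
  then show ?thesis
    using integral_translation_lborel[of "tensor h h h" "- w"] assms(2)
    by (simp add: tensor_measurable smooth_compact_def)
qed

lemma integrable_tensor:
  assumes "smooth_compact \<alpha>" "smooth_compact \<beta>" "smooth_compact \<gamma>"
  shows "integrable lborel (\<lambda>y. tensor \<alpha> \<beta> \<gamma> (w - y))"
proof -
  obtain R where R: "\<And>z. R < norm z \<Longrightarrow> tensor \<alpha> \<beta> \<gamma> z = 0"
    using tensor_compact_support[OF assms] by blast
  have cont: "continuous_on UNIV (tensor \<alpha> \<beta> \<gamma>)"
    using assms by (intro continuous_on_tensor) (auto simp: smooth_compact_def)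
  have "integrable lborel (\<lambda>y. 1 * tensor \<alpha> \<beta> \<gamma> (w - y))"
  proof (rule integrable_times_compact_support[where k = "\<lambda>_. 1" and R = "R + norm w" and C = 1])
    show "continuous_on UNIV (\<lambda>y. tensor \<alpha> \<beta> \<gamma> (w - y))"
      by (intro continuous_on_compose2[OF cont] continuous_intros) auto
    show "tensor \<alpha> \<beta> \<gamma> (w - y) = 0" if "R + norm w < norm y" for y
      using R[of "w - y"] that norm_triangle_ineq2[of y w] by (simp add: norm_minus_commute)
  qed auto
  then show ?thesis by simp
qed

text \<open>The kernel is nonnegative and supported in a box of half-width \<open>d\<close>, so only
  values of \<open>Z\<close> there count. It is not normalised, hence its mass multiplies every
  bound.\<close>

lemma convolve_bounds:
  assumes Z: "integrable lborel Z" and h: "smooth_compact h" "\<And>x. h (- x) = h x" "\<And>x. 0 \<le> h x"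
    and vanish: "\<And>x. d \<le> \<bar>x\<bar> \<Longrightarrow> h x = 0"
  shows "(\<And>y s. \<bar>Re x - Re y\<bar> < d \<Longrightarrow> \<bar>Im x - Im y\<bar> < d \<Longrightarrow> \<bar>t - s\<bar> < d \<Longrightarrow> b \<le> Z (y, s)) \<Longrightarrow>
      b * (\<integral>y. tensor h h h y \<partial>lborel) \<le> convolve Z (tensor h h h) (x, t)"
    and "(\<And>y s. \<bar>Re x - Re y\<bar> < d \<Longrightarrow> \<bar>Im x - Im y\<bar> < d \<Longrightarrow> \<bar>t - s\<bar> < d \<Longrightarrow> Z (y, s) \<le> b) \<Longrightarrow>
      convolve Z (tensor h h h) (x, t) \<le> b * (\<integral>y. tensor h h h y \<partial>lborel)"
proof -
  have eq: "b * (\<integral>y. tensor h h h y \<partial>lborel) = (\<integral>y. b * tensor h h h ((x, t) - y) \<partial>lborel)"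
    by (simp add: integral_reflected_tensor[OF h(2,1)])
  have int: "integrable lborel (\<lambda>y. b * tensor h h h ((x, t) - y))"
    by (intro integrable_mult_right integrable_tensor h(1))
  have int': "integrable lborel (\<lambda>y. Z y * tensor h h h ((x, t) - y))"
    by (intro integrable_convolve Z h(1))
  have zero: "tensor h h h ((x, t) - (y, s)) = 0" if "\<not> (\<bar>Re x - Re y\<bar> < d \<and> \<bar>Im x - Im y\<bar> < d \<and> \<bar>t - s\<bar> < d)" for y s
    using that vanish[of "Re x - Re y"] vanish[of "Im x - Im y"] vanish[of "t - s"] by (auto simp: tensor_def)
  have nonneg: "0 \<le> tensor h h h w" for w
    using h(3) by (simp add: tensor_def)
  show "b * (\<integral>y. tensor h h h y \<partial>lborel) \<le> convolve Z (tensor h h h) (x, t)"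
    if low: "\<And>y s. \<bar>Re x - Re y\<bar> < d \<Longrightarrow> \<bar>Im x - Im y\<bar> < d \<Longrightarrow> \<bar>t - s\<bar> < d \<Longrightarrow> b \<le> Z (y, s)"
    unfolding eq convolve_def
  proof (rule integral_mono[OF int int'])
    fix w
    show "b * tensor h h h ((x, t) - w) \<le> Z w * tensor h h h ((x, t) - w)"
      using low[of "fst w" "snd w"] zero[of "fst w" "snd w"] nonneg[of "(x, t) - w"]
      by (cases "\<bar>Re x - Re (fst w)\<bar> < d \<and> \<bar>Im x - Im (fst w)\<bar> < d \<and> \<bar>t - snd w\<bar> < d") (auto intro: mult_right_mono)
  qed
  show "convolve Z (tensor h h h) (x, t) \<le> b * (\<integral>y. tensor h h h y \<partial>lborel)"
    if up: "\<And>y s. \<bar>Re x - Re y\<bar> < d \<Longrightarrow> \<bar>Im x - Im y\<bar> < d \<Longrightarrow> \<bar>t - s\<bar> < d \<Longrightarrow> Z (y, s) \<le> b"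
    unfolding eq convolve_def
  proof (rule integral_mono[OF int' int])
    fix w
    show "Z w * tensor h h h ((x, t) - w) \<le> b * tensor h h h ((x, t) - w)"
      using up[of "fst w" "snd w"] zero[of "fst w" "snd w"] nonneg[of "(x, t) - w"]
      by (cases "\<bar>Re x - Re (fst w)\<bar> < d \<and> \<bar>Im x - Im (fst w)\<bar> < d \<and> \<bar>t - snd w\<bar> < d") (auto intro: mult_right_mono)
  qed
qed

lemma smooth_compact_reflect:
  assumes "smooth_compact h"
  shows "smooth_compact (\<lambda>s. h (c - s))"
proof -
  obtain R where R: "smooth_real h" "\<And>x. R < \<bar>x\<bar> \<Longrightarrow> h x = 0"
    using assms unfolding smooth_compact_def by blast
  have "smooth_real (\<lambda>s. h (- 1 * s + c))"
    by (rule smooth_real_affine[OF R(1)])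
  moreover have "h (c - s) = 0" if "R + \<bar>c\<bar> < \<bar>s\<bar>" for s
    using that by (intro R(2)) linarith
  ultimately show ?thesis
    unfolding smooth_compact_def by (auto simp: algebra_simps)
qed

lemma smooth_compact_uminus:
  assumes "smooth_compact h"
  shows "smooth_compact (\<lambda>s. - h s)"
proof -
  obtain R where R: "smooth_real h" "\<And>x. R < \<bar>x\<bar> \<Longrightarrow> h x = 0"
    using assms unfolding smooth_compact_def by blast
  obtain S where S: "h \<in> S" "\<And>g. g \<in> S \<Longrightarrow> \<exists>g'\<in>S. \<forall>x. (g has_real_derivative g' x) (at x)"
    using R(1) unfolding smooth_real_def by blast
  have "\<exists>k'\<in>(\<lambda>g x. - g x) ` S. \<forall>x. (k has_real_derivative k' x) (at x)" if k: "k \<in> (\<lambda>g x. - g x) ` S" for k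
  proof -
    obtain g where g: "g \<in> S" "k = (\<lambda>x. - g x)" using k by blast
    obtain g' where "g' \<in> S" "\<And>x. (g has_real_derivative g' x) (at x)"
      using S(2)[OF g(1)] by blast
    then show ?thesis
      unfolding g(2) by (intro bexI[of _ "\<lambda>x. - g' x"]) (auto intro!: derivative_intros)
  qed
  then have "smooth_real (\<lambda>s. - h s)"
    unfolding smooth_real_def using S(1) by (intro exI[of _ "(\<lambda>g x. - g x) ` S"]) blast
  then show ?thesis
    using R(2) unfolding smooth_compact_def by auto
qed

lemma abs_Re_Im_dist: "cmod (x - y) \<le> \<bar>Re x - Re y\<bar> + \<bar>Im x - Im y\<bar>"
  using cmod_le[of "x - y"] by simp

lemma DERIV_reflect:
  fixes f :: "real \<Rightarrow> real"
  assumes "(f has_real_derivative D) (at (c - s))"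
  shows "((\<lambda>s. f (c - s)) has_real_derivative - D) (at s)"
proof -
  have "((\<lambda>s. c - s) has_real_derivative - 1) (at s)"
    by (auto intro!: derivative_eq_intros)
  from DERIV_chain2[OF assms this] show ?thesis
    by simp
qed

text \<open>
  No sign of \<open>z\<close> at time 0 is assumed: test functions that do not vanish there encode the sign of
  the initial data.  The extension of \<open>z\<close> by 0 to negative times is thus a supersolution
  too, and its mollification is a classical supersolution that vanishes for \<open>t \<le> -1\<close>.
\<close>

lemma weak_supersolution_nonneg:
  fixes z :: "complex \<times> real \<Rightarrow> real"
  assumes P: "finite P" "P \<subseteq> ball 0 1"
    and cont: "continuous_on ((cball 0 1 - P) \<times> {0..}) z"
    and sphere: "\<And>x t. cmod x = 1 \<Longrightarrow> 0 \<le> t \<Longrightarrow> 0 \<le> z (x, t)"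
    and int: "\<And>T. 0 < T \<Longrightarrow> set_integrable lborel (ball 0 1 \<times> {0..T}) z"
    and weak: "\<And>\<alpha> \<alpha>1 \<alpha>2 \<beta> \<beta>1 \<beta>2 \<gamma> \<gamma>1 l1 r1 l2 r2. box_test \<alpha> \<alpha>1 \<alpha>2 \<beta> \<beta>1 \<beta>2 \<gamma> \<gamma>1 l1 r1 l2 r2 \<Longrightarrow>
      0 \<le> (LINT w:ball 0 1 \<times> {0..}|lborel. z w * (- tensor \<alpha> \<beta> \<gamma>1 w - (tensor \<alpha>2 \<beta> \<gamma> w + tensor \<alpha> \<beta>2 \<gamma> w)))"
    and x0: "x0 \<in> ball 0 1 - P" and t0: "0 < t0"
  shows "0 \<le> z (x0, t0)"
proof (rule ccontr)
  assume "\<not> 0 \<le> z (x0, t0)"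
  \<comment> \<open>Three levels: \<open>z\<close> equals \<open>- 3 * a\<close> at the bad point,
    is at most \<open>- 2 * a\<close> near it and at least \<open>- a\<close> near the circle.
    Mollification preserves the gap between the last two.\<close>
  define a where "a = - z (x0, t0) / 3"
  have a: "0 < a" "z (x0, t0) = - (3 * a)"
    using \<open>\<not> 0 \<le> z (x0, t0)\<close> by (auto simp: a_def)
  obtain r where r: "0 < r" "r < 1"
    "\<And>x t. r \<le> cmod x \<Longrightarrow> cmod x < 1 \<Longrightarrow> 0 \<le> t \<Longrightarrow> t \<le> t0 + 1 \<Longrightarrow> - a \<le> z (x, t)"
    using nonneg_near_sphere[OF P cont sphere a(1), of "t0 + 1"] by blast
  have "open (ball 0 1 - P)"
    using P by (intro open_Diff open_ball finite_imp_closed)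
  then obtain d1 where d1: "0 < d1" "ball x0 d1 \<subseteq> ball 0 1 - P"
    using x0 by (meson openE)
  have "(x0, t0) \<in> (cball 0 1 - P) \<times> {0..}"
    using x0 t0 by auto
  then obtain d2 where d2: "0 < d2"
    "\<And>w. w \<in> (cball 0 1 - P) \<times> {0..} \<Longrightarrow> dist w (x0, t0) < d2 \<Longrightarrow> dist (z w) (z (x0, t0)) < a"
    using cont a(1) unfolding continuous_on_iff by metis
  \<comment> \<open>The entries in order: kernels at \<open>(x0, t0)\<close> avoid the sources, stay
    where \<open>z\<close> is within \<open>a\<close> of its value there, and kernels centred on the
    circle of radius \<open>1 - 2 * d\<close> stay in the layer beyond \<open>r\<close>;
    \<open>x0\<close> lies inside that circle; times near \<open>t0\<close> stay positive; times
    near -1 stay negative.\<close>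
  define d where "d = Min {d1 / 4, d2 / 4, (1 - r) / 4, (1 - cmod x0) / 4, t0 / 2, 1 / 2}"
  have "0 < (1 - cmod x0) / 4"
    using x0 by simp
  then have d0: "0 < d"
    using d1(1) d2(1) r t0 by (simp add: d_def)
  have "d \<le> d1 / 4" "d \<le> d2 / 4" "d \<le> (1 - r) / 4" "d \<le> (1 - cmod x0) / 4" "d \<le> t0 / 2" "d \<le> 1 / 2"
    unfolding d_def by (rule Min_le; simp)+
  with d0 have d: "0 < d" "d \<le> d1 / 4" "d \<le> d2 / 4" "d \<le> (1 - r) / 4" "d \<le> (1 - cmod x0) / 4" "d \<le> t0 / 2" "d \<le> 1 / 2"
    by simp_all
  from smooth_bump obtain \<eta> where \<eta>: "smooth_real \<eta> \<and> (\<forall>x. \<eta> (- x) = \<eta> x) \<and> (\<forall>x. 0 \<le> \<eta> x) \<and>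
    (\<forall>x. \<bar>x\<bar> < 1 \<longrightarrow> 0 < \<eta> x) \<and> (\<forall>x. 1 \<le> \<bar>x\<bar> \<longrightarrow> \<eta> x = 0)" ..
  define h where "h x = \<eta> (1 / d * x + 0)" for x
  have h_smooth: "smooth_real h"
    unfolding h_def using \<eta> by (intro smooth_real_affine) blast
  have h_vanish: "h x = 0" if "d \<le> \<bar>x\<bar>" for x
    using \<eta> that d(1) by (simp add: h_def abs_mult field_simps)
  have h_even: "h (- x) = h x" for x
    using \<eta> by (simp add: h_def)
  have h_nonneg: "0 \<le> h x" for x
    using \<eta> by (simp add: h_def)
  have h: "smooth_compact h"
    using h_smooth h_vanish unfolding smooth_compact_def by (intro conjI exI[of _ d]) auto
  obtain h1 where h1: "smooth_compact h1" "\<And>x. (h has_real_derivative h1 x) (at x)"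
    using smooth_compact_deriv[OF h] by blast
  obtain h2 where h2: "smooth_compact h2" "\<And>x. (h1 has_real_derivative h2 x) (at x)"
    using smooth_compact_deriv[OF h1(1)] by blast
  have h1_vanish: "h1 x = 0" if "d < \<bar>x\<bar>" for x
    by (rule DERIV_eq_0_of_vanishing[OF h1(2), of "{x. d < \<bar>x\<bar>}"])
       (use that h_vanish in \<open>auto intro!: open_Collect_less continuous_intros\<close>)
  define m where "m = (\<integral>y. tensor h h h y \<partial>lborel)"
  have m: "0 < m"
  proof -
    have int_h: "integrable lborel (\<lambda>y. tensor h h h y)"
      using integrable_tensor[OF h h h, of 0] h_even by (simp add: tensor_def)
    have nn: "0 \<le> tensor h h h y" for y
      using h_nonneg by (simp add: tensor_def)
    let ?B = "box (- (Complex d d, d)) (Complex d d, d)"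
    have pos: "0 < tensor h h h y" if "y \<in> ?B" for y
    proof -
      have "0 < h s" if "- d < s" "s < d" for s
      proof -
        have "\<bar>1 / d * s + 0\<bar> < 1"
          using that d(1) by (simp add: abs_less_iff field_simps)
        then show ?thesis
          using \<eta> unfolding h_def by blast
      qed
      then show ?thesis
        using that by (auto simp: tensor_def box_def Basis_complex_real inner_prod_def inner_complex_def)
    qed
    have "0 \<le> m"
      unfolding m_def using nn by (intro integral_nonneg_AE) simp
    moreover have "m \<noteq> 0"
    proof
      assume "m = 0"
      then have "AE y in lborel. tensor h h h y = 0"
        unfolding m_def using integral_nonneg_eq_0_iff_AE[OF int_h] nn by simp
      then have "AE y in lborel. y \<notin> ?B"
        by eventually_elim (use pos in force)
      then have "emeasure lborel ?B = 0"
        by (subst (asm) AE_iff_measurable[OF _ refl]) auto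
      then show False
        using d(1) by (simp add: emeasure_lborel_box_eq Basis_complex_real inner_prod_def inner_complex_def split: if_splits)
    qed
    ultimately show ?thesis
      by simp
  qed
  \<comment> \<open>Extension by 0 to negative times and outside the disk; the truncation at
    \<open>t0 + 1\<close> makes \<open>Z\<close> integrable and is beyond the reach of kernels
    centred at times up to \<open>t0\<close>.\<close>
  define Z where "Z w = indicator (ball 0 1 \<times> {0..t0 + 1}) w * z w" for w
  have Z: "integrable lborel Z"
    using int[of "t0 + 1"] t0 by (simp add: Z_def[abs_def] set_integrable_def)
  define W where "W = convolve Z (tensor h h h)"
  \<comment> \<open>A box of half-width \<open>d\<close> lies within distance \<open>2 * d\<close>
    of its centre, so kernels centred inside radius \<open>R\<close> are supported in the open
    disk.\<close>
  define R where "R = 1 - 2 * d"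
  have near: "cmod (x - y) < 2 * d" if "\<bar>Re x - Re y\<bar> < d" "\<bar>Im x - Im y\<bar> < d" for x y
    using abs_Re_Im_dist[of x y] that by simp
  have "- a * m \<le> W (x0, t0)"
  proof (rule parabolic_minimum_principle[where R = R and ?t1.0 = "-1" and ?t2.0 = t0])
    show "continuous_on (cball 0 R \<times> {-1..t0}) W"
      unfolding W_def by (rule convolve_continuous[OF Z h h h])
    show "((\<lambda>s. W (w + s *\<^sub>R (0, 1))) has_real_derivative convolve Z (tensor h h h1) w) (at 0)" for w
      unfolding W_def by (rule convolve_derivative[OF Z h h h h h h1(1) tensor_line_derivative(3)[OF h1(2) h1(2) h1(2)]])
    show "((\<lambda>s. W (w + s *\<^sub>R (1, 0))) has_real_derivative convolve Z (tensor h1 h h) w) (at 0)" for w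
      unfolding W_def by (rule convolve_derivative[OF Z h h h h1(1) h h tensor_line_derivative(1)[OF h1(2) h1(2) h1(2)]])
    show "((\<lambda>s. convolve Z (tensor h1 h h) (w + s *\<^sub>R (1, 0))) has_real_derivative convolve Z (tensor h2 h h) w) (at 0)" for w
      by (rule convolve_derivative[OF Z h1(1) h h h2(1) h h tensor_line_derivative(1)[OF h2(2) h1(2) h1(2)]])
    show "((\<lambda>s. W (w + s *\<^sub>R (\<i>, 0))) has_real_derivative convolve Z (tensor h h1 h) w) (at 0)" for w
      unfolding W_def by (rule convolve_derivative[OF Z h h h h h1(1) h tensor_line_derivative(2)[OF h1(2) h1(2) h1(2)]])
    show "((\<lambda>s. convolve Z (tensor h h1 h) (w + s *\<^sub>R (\<i>, 0))) has_real_derivative convolve Z (tensor h h2 h) w) (at 0)" for w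
      by (rule convolve_derivative[OF Z h h1(1) h h h2(1) h tensor_line_derivative(2)[OF h1(2) h2(2) h1(2)]])
    show "0 \<le> convolve Z (tensor h h h1) (x, t) - convolve Z (tensor h2 h h) (x, t) - convolve Z (tensor h h2 h) (x, t)"
      if x: "cmod x < R" and t: "-1 < t" "t \<le> t0" for x t
    proof -
      \<comment> \<open>The test function is the kernel centred at \<open>(x, t)\<close>. Reflection
        changes the sign of first derivatives only, so \<open>- ?\<gamma>1\<close> is the reflected
        \<open>h1\<close> and the weak inequality becomes the heat operator applied to
        \<open>W\<close> at \<open>(x, t)\<close>.\<close>
      let ?\<alpha> = "\<lambda>s. h (Re x - s)" and ?\<beta> = "\<lambda>s. h (Im x - s)" and ?\<gamma> = "\<lambda>s. h (t - s)"
      let ?\<alpha>1 = "\<lambda>s. - h1 (Re x - s)" and ?\<beta>1 = "\<lambda>s. - h1 (Im x - s)" and ?\<gamma>1 = "\<lambda>s. - h1 (t - s)"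
      let ?\<alpha>2 = "\<lambda>s. h2 (Re x - s)" and ?\<beta>2 = "\<lambda>s. h2 (Im x - s)"
      have refl_deriv1: "((\<lambda>s. h (c - s)) has_real_derivative - h1 (c - s)) (at s)" for c s
        by (rule DERIV_reflect[OF h1(2)])
      have refl_deriv2: "((\<lambda>s. - h1 (c - s)) has_real_derivative h2 (c - s)) (at s)" for c s
        using DERIV_minus[OF DERIV_reflect[OF h2(2)]] by simp
      have bt: "box_test ?\<alpha> ?\<alpha>1 ?\<alpha>2 ?\<beta> ?\<beta>1 ?\<beta>2 ?\<gamma> ?\<gamma>1 (Re x - d) (Re x + d) (Im x - d) (Im x + d)"
      proof
        show "Complex p q \<in> ball 0 1" if pq: "p \<in> {Re x - d..Re x + d}" "q \<in> {Im x - d..Im x + d}" for p q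
        proof -
          have "\<bar>p - Re x\<bar> \<le> d" "\<bar>q - Im x\<bar> \<le> d"
            using pq by (simp_all add: abs_le_iff)
          then have "cmod (Complex p q - x) \<le> d + d"
            using abs_Re_Im_dist[of "Complex p q" x] by simp
          then show ?thesis
            using norm_triangle_ineq[of "Complex p q - x" x] x by (simp add: R_def)
        qed
        show "h (Re x - s) = 0" if "s \<notin> {Re x - d..Re x + d}" for s
          by (rule h_vanish) (use that in auto)
        show "h (Im x - s) = 0" if "s \<notin> {Im x - d..Im x + d}" for s
          by (rule h_vanish) (use that in auto)
      qed (intro refl_deriv1 refl_deriv2 h_nonneg smooth_compact_reflect smooth_compact_uminus h h1(1) h2(1))+
      have eq: "indicator (ball 0 1 \<times> {0..}) w *\<^sub>R (z w * (- tensor ?\<alpha> ?\<beta> ?\<gamma>1 w - (tensor ?\<alpha>2 ?\<beta> ?\<gamma> w + tensor ?\<alpha> ?\<beta>2 ?\<gamma> w))) =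
          Z w * tensor h h h1 ((x, t) - w) - Z w * tensor h2 h h ((x, t) - w) - Z w * tensor h h2 h ((x, t) - w)" for w
      proof (cases "snd w \<le> t0 + 1")
        case True
        then show ?thesis
          by (cases w) (auto simp: Z_def indicator_def tensor_def algebra_simps)
      next
        case False
        then have "h (t - snd w) = 0" "h1 (t - snd w) = 0"
          using t d by (auto intro!: h_vanish h1_vanish)
        then show ?thesis
          by (simp add: tensor_def)
      qed
      have "0 \<le> (\<integral>w. Z w * tensor h h h1 ((x, t) - w) - Z w * tensor h2 h h ((x, t) - w) - Z w * tensor h h2 h ((x, t) - w) \<partial>lborel)"
        using weak[OF bt] unfolding set_lebesgue_integral_def eq .
      also have "\<dots> = convolve Z (tensor h h h1) (x, t) - convolve Z (tensor h2 h h) (x, t) - convolve Z (tensor h h2 h) (x, t)"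
        unfolding convolve_def
        by (simp only: Bochner_Integration.integral_diff Bochner_Integration.integrable_diff
            integrable_convolve[OF Z h h h1(1)] integrable_convolve[OF Z h2(1) h h] integrable_convolve[OF Z h h2(1) h])
      finally show ?thesis .
    qed
    \<comment> \<open>Points of the disk seen from radius \<open>1 - 2 * d\<close> have modulus
      above \<open>1 - 4 * d \<ge> r\<close>, where \<open>z \<ge> - a\<close>; outside the cylinder
      \<open>Z\<close> is 0.\<close>
    show "- a * m \<le> W (x, t)" if x: "cmod x = R" and t: "-1 \<le> t" "t \<le> t0" for x t
      unfolding W_def m_def
    proof (rule convolve_bounds(1)[OF Z h h_even h_nonneg h_vanish])
      fix y s assume y: "\<bar>Re x - Re y\<bar> < d" "\<bar>Im x - Im y\<bar> < d" "\<bar>t - s\<bar> < d"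
      show "- a \<le> Z (y, s)"
      proof (cases "(y, s) \<in> ball 0 1 \<times> {0..t0 + 1}")
        case True
        have "cmod x - cmod y \<le> cmod (x - y)"
          by (rule norm_triangle_ineq2)
        then have "r \<le> cmod y"
          using near[OF y(1,2)] x d(4) by (simp add: R_def)
        then show ?thesis
          using True r(3)[of y s] by (simp add: Z_def)
      qed (use a in \<open>simp add: Z_def\<close>)
    qed
    \<comment> \<open>Starting at time -1 puts the whole kernel at negative times, where
      \<open>Z\<close> is 0.\<close>
    show "- a * m \<le> W (x, -1)" if "cmod x \<le> R" for x
      unfolding W_def m_def
    proof (rule convolve_bounds(1)[OF Z h h_even h_nonneg h_vanish])
      fix y s assume "\<bar>- 1 - s\<bar> < d"
      then have "s < 0" using d by auto
      then show "- a \<le> Z (y, s)"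
        using a by (simp add: Z_def)
    qed
    show "cmod x0 \<le> R" "-1 \<le> t0" "t0 \<le> t0"
      using d x0 t0 by (auto simp: R_def)
  qed
  moreover have "W (x0, t0) \<le> - (2 * a) * m"
    unfolding W_def m_def
  proof (rule convolve_bounds(2)[OF Z h h_even h_nonneg h_vanish])
    fix y s assume y: "\<bar>Re x0 - Re y\<bar> < d" "\<bar>Im x0 - Im y\<bar> < d" "\<bar>t0 - s\<bar> < d"
    have "cmod (x0 - y) < d1"
      using near[OF y(1,2)] d(1,2) by linarith
    then have y_in: "y \<in> ball 0 1 - P"
      using d1(2) by (auto simp: dist_norm)
    have s: "0 \<le> s" "s \<le> t0 + 1"
      using y(3) d t0 by auto
    have "dist (y, s) (x0, t0) \<le> dist y x0 + dist s t0"
      by (simp add: dist_Pair_Pair sqrt_sum_squares_le_sum)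
    also have "\<dots> < 4 * d"
      using near[OF y(1,2)] y(3) d(1) by (simp add: dist_norm norm_minus_commute dist_real_def abs_minus_commute)
    also have "\<dots> \<le> d2"
      using d(3) by simp
    finally have "dist (z (y, s)) (z (x0, t0)) < a"
      using y_in s by (intro d2(2)) auto
    then have "z (y, s) \<le> - (2 * a)"
      using a by (simp add: dist_real_def)
    then show "Z (y, s) \<le> - (2 * a)"
      using y_in s by (simp add: Z_def)
  qed
  ultimately have "a * m \<le> 0"
    by (simp add: algebra_simps)
  then show False
    using a(1) m mult_pos_pos[of a m] by linarith
qed

section \<open>Weak form of the decaying barrier and of the steady state\<close>

lemma continuous_on_green_barrier:
  assumes p: "cmod p < 1"
  shows "continuous_on (cball 0 1 - {p}) (green p)" "continuous_on (cball 0 1 - {p}) (barrier p)"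
proof -
  have "cmod (- cnj p * x + 1) \<noteq> 0" if "x \<in> cball 0 1 - {p}" for x
    using reflection_pos[OF p, of x] that by auto
  then show g: "continuous_on (cball 0 1 - {p}) (green p)"
    unfolding green_def[abs_def] by (intro continuous_intros) auto
  show "continuous_on (cball 0 1 - {p}) (barrier p)"
    unfolding barrier_def[abs_def] by (intro continuous_intros g)
qed

text \<open>The heat operator sends \<open>exp (- c * t)\<close> times the barrier to
  \<open>exp (- c * t)\<close> times \<open>- c * barrier - Laplacian barrier\<close>, which is
  nonnegative; the cutoff at time 0 contributes the initial trace.\<close>

lemma (in box_test) barrier_weak:
  assumes p: "p \<in> ball 0 1" and c: "c \<le> (1 - (cmod p)\<^sup>2) / 6" "0 \<le> c"
  shows "(\<integral>x. barrier p x * \<phi> (x, 0) \<partial>lborel) \<le> (\<integral>z. decay c (snd z) * (barrier p (fst z) * (- dt z - lap z)) \<partial>lborel)"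
    and "integrable lborel (\<lambda>z. decay c (snd z) * (barrier p (fst z) * (- dt z - lap z)))"
proof -
  note m = measurable_barrier set_integrable_green(2)[OF p]
  note int = integrable_box_supported[OF box_supported(1) decay_measurable decay_bound[OF c(2)] m]
    integrable_box_supported[OF box_supported(2) decay_measurable decay_bound[OF c(2)] m]
    integrable_box_supported[OF box_supported(3) decay_measurable decay_bound[OF c(2)] m]
  have eq: "decay c (snd z) * (barrier p (fst z) * (- dt z - lap z)) =
      decay c (snd z) * (barrier p (fst z) * (c * \<phi> z - dt z)) - c * (decay c (snd z) * (barrier p (fst z) * \<phi> z)) -
      decay c (snd z) * (barrier p (fst z) * lap z)" for z
    by (simp add: algebra_simps)
  have int1: "integrable lborel (\<lambda>z. decay c (snd z) * (barrier p (fst z) * (c * \<phi> z - dt z)))"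
  proof -
    have "integrable lborel (\<lambda>z. c * (decay c (snd z) * (barrier p (fst z) * \<phi> z)) - decay c (snd z) * (barrier p (fst z) * dt z))"
      by (intro Bochner_Integration.integrable_diff integrable_mult_right int)
    then show ?thesis by (simp add: algebra_simps)
  qed
  have int2: "integrable lborel (\<lambda>z. c * (decay c (snd z) * (barrier p (fst z) * \<phi> z)))"
    by (intro integrable_mult_right int)
  show "integrable lborel (\<lambda>z. decay c (snd z) * (barrier p (fst z) * (- dt z - lap z)))"
    unfolding eq by (intro Bochner_Integration.integrable_diff int1 int2 int)
  have "(\<integral>z. decay c (snd z) * (barrier p (fst z) * (- dt z - lap z)) \<partial>lborel) =
      (\<integral>x. barrier p x * \<phi> (x, 0) \<partial>lborel) - c * (\<integral>z. decay c (snd z) * (barrier p (fst z) * \<phi> z) \<partial>lborel) -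
      (\<integral>z. decay c (snd z) * (barrier p (fst z) * lap z) \<partial>lborel)"
    unfolding eq integral_time[OF m c(2), symmetric]
    by (simp only: Bochner_Integration.integral_diff Bochner_Integration.integrable_diff int int1 int2 integral_mult_right_zero)
  moreover have "(\<integral>z. decay c (snd z) * (barrier p (fst z) * lap z) \<partial>lborel) \<le>
      - c * (\<integral>z. decay c (snd z) * (barrier p (fst z) * \<phi> z) \<partial>lborel)"
    by (rule integral_barrier_laplacian[OF p decay_measurable decay_bound[OF c(2)] decay_nonneg c])
  ultimately show "(\<integral>x. barrier p x * \<phi> (x, 0) \<partial>lborel) \<le> (\<integral>z. decay c (snd z) * (barrier p (fst z) * (- dt z - lap z)) \<partial>lborel)"
    by linarith
qed

text \<open>\<open>decay 0\<close> is the indicator of nonnegative times. A steady profile switched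
  on at time 0 carries its own initial trace besides the point source.\<close>

lemma (in box_test) green_weak:
  assumes p: "p \<in> ball 0 1"
  shows "(\<integral>z. decay 0 (snd z) * (green p (fst z) * (- dt z - lap z)) \<partial>lborel) =
      (\<integral>x. green p x * \<phi> (x, 0) \<partial>lborel) + kappa * (\<integral>t. decay 0 t * \<phi> (p, t) \<partial>lborel)"
    and "integrable lborel (\<lambda>z. decay 0 (snd z) * (green p (fst z) * (- dt z - lap z)))"
proof -
  note m = measurable_green set_integrable_green(1)[OF p]
  have b: "\<And>t. \<bar>decay 0 t\<bar> \<le> 1" by (rule decay_bound) simp
  note int = integrable_box_supported[OF box_supported(2) decay_measurable b m]
    integrable_box_supported[OF box_supported(3) decay_measurable b m]
  have eq: "decay 0 (snd z) * (green p (fst z) * (- dt z - lap z)) =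
      decay 0 (snd z) * (green p (fst z) * (0 * \<phi> z - dt z)) - decay 0 (snd z) * (green p (fst z) * lap z)" for z
    by (simp add: algebra_simps)
  have int1: "integrable lborel (\<lambda>z. decay 0 (snd z) * (green p (fst z) * (0 * \<phi> z - dt z)))"
    using integrable_minus[OF int(2)] by simp
  show "integrable lborel (\<lambda>z. decay 0 (snd z) * (green p (fst z) * (- dt z - lap z)))"
    unfolding eq by (intro Bochner_Integration.integrable_diff int1 int)
  show "(\<integral>z. decay 0 (snd z) * (green p (fst z) * (- dt z - lap z)) \<partial>lborel) =
      (\<integral>x. green p x * \<phi> (x, 0) \<partial>lborel) + kappa * (\<integral>t. decay 0 t * \<phi> (p, t) \<partial>lborel)"
    unfolding eq Bochner_Integration.integral_diff[OF int1 int(1)] integral_time[OF m order_refl]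
      integral_green_laplacian[OF p decay_measurable b] by simp
qed

section \<open>Exponential relaxation to the steady state\<close>

locale source_problem =
  fixes N :: nat and p :: "nat \<Rightarrow> complex" and q :: "nat \<Rightarrow> real"
    and u :: "complex \<Rightarrow> real \<Rightarrow> real" and f :: "real \<Rightarrow> real \<Rightarrow> real"
  assumes data: "point_source_data N p q u f"
begin

abbreviation "P \<equiv> p ` {1..N}"

lemma pole: "j \<in> {1..N} \<Longrightarrow> p j \<in> ball 0 1"
  and pole_norm: "j \<in> {1..N} \<Longrightarrow> cmod (p j) < 1"
  and solution: "heat_point_source_solution N p q u"
  and flux: "boundary_flux u f"
  using data by (auto simp: point_source_data_def)

lemma P: "finite P" "P \<subseteq> ball 0 1"
  using pole by auto

lemma u_continuous: "continuous_on ((cball 0 1 - P) \<times> {0..}) (\<lambda>(x, t). u x t)"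
  and u_integrable: "0 < T \<Longrightarrow> set_integrable lborel (ball 0 1 \<times> {0..T}) (\<lambda>(x, t). u x t)"
  and u_weak: "test_function \<psi> \<Longrightarrow>
    (LINT z:ball 0 1 \<times> {0..}|lborel. u (fst z) (snd z) * (- time_deriv \<psi> z - space_laplacian \<psi> z)) =
    (\<Sum>j\<in>{1..N}. q j * (LINT t:{0..}|lborel. \<psi> (p j, t)))"
  using solution by (auto simp: heat_point_source_solution_def)

lemma u_slice_continuous:
  assumes "x \<in> cball 0 1 - P"
  shows "continuous_on {0..} (u x)"
proof -
  have 1: "continuous_on {0..} (\<lambda>t. (x, t))"
    by (intro continuous_intros)
  have 2: "(\<lambda>t. (x, t)) ` {0..} \<subseteq> (cball 0 1 - P) \<times> {0..}"
    using assms by blast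
  from continuous_on_compose2[OF u_continuous 1 2] show ?thesis
    by simp
qed

lemma u_lateral: "cmod x = 1 \<Longrightarrow> 0 < t \<Longrightarrow> u x t = 0"
  using solution unfolding heat_point_source_solution_def by simp

text \<open>The boundary condition is given for positive times; continuity up to time 0 fills in the
  corner.\<close>

lemma u_sphere:
  assumes x: "cmod x = 1" and t: "0 \<le> t"
  shows "u x t = 0"
proof (cases "t = 0")
  case False
  then show ?thesis
    using u_lateral[OF x] t by simp
next
  case True
  have "x \<in> cball 0 1 - P"
    using x P(2) by fastforce
  then have "(u x \<longlongrightarrow> u x 0) (at 0 within {0..})"
    using u_slice_continuous by (simp only: continuous_on_def) simp
  then have lim: "(u x \<longlongrightarrow> u x 0) (at_right 0)"
    by (rule tendsto_within_subset) auto
  have "\<forall>\<^sub>F t in at_right 0. u x t = 0"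
    using u_lateral[OF x] by (simp add: eventually_at_filter)
  then have "(u x \<longlongrightarrow> 0) (at_right 0)"
    by (rule tendsto_eventually)
  from tendsto_unique[OF trivial_limit_at_right_real lim this] show ?thesis
    using True by simp
qed

definition U :: "complex \<Rightarrow> real" where
  "U x = (\<Sum>j\<in>{1..N}. q j / kappa * green (p j) x)"

definition \<Psi> :: "complex \<Rightarrow> real" where
  "\<Psi> x = (\<Sum>j\<in>{1..N}. \<bar>q j\<bar> / kappa * barrier (p j) x)"

text \<open>The smallest of the admissible rates of the single barriers. The inserted 1 keeps the
  set nonempty when there are no sources.\<close>

definition rate :: real where
  "rate = Min (insert 1 ((\<lambda>j. (1 - (cmod (p j))\<^sup>2) / 6) ` {1..N}))"

lemma rate_le: "j \<in> {1..N} \<Longrightarrow> rate \<le> (1 - (cmod (p j))\<^sup>2) / 6"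
  unfolding rate_def by (rule Min_le) auto

lemma rate_pos: "0 < rate"
proof -
  have "0 < (1 - (cmod (p j))\<^sup>2) / 6" if "j \<in> {1..N}" for j
    using pole_norm[OF that] power_strict_mono[of "cmod (p j)" 1 2] by simp
  then show ?thesis
    unfolding rate_def by (subst Min_gr_iff) auto
qed

lemma sphere_zero: "cmod x = 1 \<Longrightarrow> U x = 0" "cmod x = 1 \<Longrightarrow> \<Psi> x = 0"
  by (simp_all add: U_def \<Psi>_def green_sphere barrier_sphere)

lemma continuous_on_U_\<Psi>: "continuous_on (cball 0 1 - P) U" "continuous_on (cball 0 1 - P) \<Psi>"
  unfolding U_def[abs_def] \<Psi>_def[abs_def] using kappa_pos
  by (auto intro!: continuous_intros continuous_on_subset[OF continuous_on_green_barrier(1)[OF pole_norm]]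
      continuous_on_subset[OF continuous_on_green_barrier(2)[OF pole_norm]])

lemma set_integrable_U_\<Psi>: "set_integrable lborel (ball 0 1) U" "set_integrable lborel (ball 0 1) \<Psi>"
  unfolding U_def[abs_def] \<Psi>_def[abs_def] set_integrable_def
  using set_integrable_green[OF pole]
  by (auto simp: set_integrable_def sum_distrib_left mult.left_commute[of "indicator _ _"] intro!: Bochner_Integration.integrable_sum)

definition comparison :: "real \<Rightarrow> complex \<times> real \<Rightarrow> real" where
  "comparison \<sigma> w = exp (- rate * snd w) * \<Psi> (fst w) + \<sigma> * (U (fst w) - u (fst w) (snd w))"

text \<open>The sources of \<open>U\<close> and \<open>u\<close> agree and cancel, so only initial
  traces remain. That of \<open>u\<close> is 0, and that of \<open>U\<close> is absorbed by the
  trace of \<open>\<Psi>\<close>, for either sign of \<open>\<sigma>\<close>.\<close>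

lemma comparison_weak:
  assumes \<sigma>: "\<bar>\<sigma>\<bar> = 1" and bt: "box_test \<alpha> \<alpha>1 \<alpha>2 \<beta> \<beta>1 \<beta>2 \<gamma> \<gamma>1 l1 r1 l2 r2"
  shows "0 \<le> (LINT w:ball 0 1 \<times> {0..}|lborel. comparison \<sigma> w *
      (- tensor \<alpha> \<beta> \<gamma>1 w - (tensor \<alpha>2 \<beta> \<gamma> w + tensor \<alpha> \<beta>2 \<gamma> w)))"
proof -
  interpret box_test \<alpha> \<alpha>1 \<alpha>2 \<beta> \<beta>1 \<beta>2 \<gamma> \<gamma>1 l1 r1 l2 r2 by (rule bt)
  let ?D = "\<lambda>w. - dt w - lap w"
  have D: "- tensor \<alpha> \<beta> \<gamma>1 w - (tensor \<alpha>2 \<beta> \<gamma> w + tensor \<alpha> \<beta>2 \<gamma> w) = ?D w" for w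
    by (simp add: dt_def lap_def)
  obtain T where T: "T > 0" "\<And>z. T < \<bar>snd z\<bar> \<Longrightarrow> \<phi> z = 0 \<and> lap z = 0 \<and> dt z = 0"
    using support_time by metis
  obtain M where M: "\<And>z. \<bar>lap z\<bar> \<le> M" "\<And>z. \<bar>dt z\<bar> \<le> M" "\<And>z. \<bar>\<phi> z\<bar> \<le> M"
    using bounded by metis
  define A where "A j w = decay rate (snd w) * (barrier (p j) (fst w) * ?D w)" for j w
  define B where "B j w = decay 0 (snd w) * (green (p j) (fst w) * ?D w)" for j w
  define E where "E w = indicator (ball 0 1 \<times> {0..}) w * (u (fst w) (snd w) * ?D w)" for w
  have A1: "integrable lborel (A j)" if "j \<in> {1..N}" for j
    unfolding A_def by (rule barrier_weak(2)[OF pole[OF that] rate_le[OF that] less_imp_le[OF rate_pos]])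
  have A2: "(\<integral>x. barrier (p j) x * \<phi> (x, 0) \<partial>lborel) \<le> (\<integral>w. A j w \<partial>lborel)" if "j \<in> {1..N}" for j
    unfolding A_def by (rule barrier_weak(1)[OF pole[OF that] rate_le[OF that] less_imp_le[OF rate_pos]])
  have B1: "integrable lborel (B j)" if "j \<in> {1..N}" for j
    unfolding B_def by (rule green_weak(2)[OF pole[OF that]])
  have B2: "(\<integral>w. B j w \<partial>lborel) = (\<integral>x. green (p j) x * \<phi> (x, 0) \<partial>lborel) + kappa * (\<integral>t. decay 0 t * \<phi> (p j, t) \<partial>lborel)"
    if "j \<in> {1..N}" for j
    unfolding B_def by (rule green_weak(1)[OF pole[OF that]])
  \<comment> \<open>\<open>u\<close> is integrable on bounded time intervals only; the test function
    vanishes after \<open>T\<close>.\<close>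
  have E_int: "integrable lborel E"
  proof -
    have "integrable lborel (\<lambda>w. (indicator (ball 0 1 \<times> {0..T}) w *\<^sub>R (case w of (x, t) \<Rightarrow> u x t)) * ?D w)"
    proof (rule integrable_mult_bounded)
      show "integrable lborel (\<lambda>w. indicator (ball 0 1 \<times> {0..T}) w *\<^sub>R (case w of (x, t) \<Rightarrow> u x t))"
        using u_integrable[OF T(1)] by (simp add: set_integrable_def)
      show "?D \<in> borel_measurable lborel" using measurable by simp
      show "\<bar>?D w\<bar> \<le> M + M" for w
        using M[of w] by linarith
    qed
    also have "(\<lambda>w. (indicator (ball 0 1 \<times> {0..T}) w *\<^sub>R (case w of (x, t) \<Rightarrow> u x t)) * ?D w) = E"
    proof
      fix w
      show "(indicator (ball 0 1 \<times> {0..T}) w *\<^sub>R (case w of (x, t) \<Rightarrow> u x t)) * ?D w = E w"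
        using T(2)[of w] by (cases "T < \<bar>snd w\<bar>") (auto simp: E_def indicator_def split: prod.split)
    qed
    finally show ?thesis .
  qed
  have E_eq: "(\<integral>w. E w \<partial>lborel) = (\<Sum>j\<in>{1..N}. q j * (\<integral>t. decay 0 t * \<phi> (p j, t) \<partial>lborel))"
  proof -
    obtain R where R: "\<And>x. R < \<bar>x\<bar> \<Longrightarrow> \<gamma> x = 0"
      using smooth(7) unfolding smooth_compact_def by blast
    have "test_function (tensor \<alpha> \<beta> \<gamma>)"
      by (rule test_function_tensor[where ?l1.0 = l1 and ?r1.0 = r1 and ?l2.0 = l2 and ?r2.0 = r2
          and ?l3.0 = "- R" and ?r3.0 = R, OF smooth_reals(1,4,7) vanish _ disk]) (auto intro: R)
    from u_weak[OF this] have "(LINT w:ball 0 1 \<times> {0..}|lborel. u (fst w) (snd w) *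
        (- time_deriv (tensor \<alpha> \<beta> \<gamma>) w - space_laplacian (tensor \<alpha> \<beta> \<gamma>) w)) =
        (\<Sum>j\<in>{1..N}. q j * (LINT t:{0..}|lborel. \<phi> (p j, t)))"
      by (simp add: \<phi>_def)
    also have "(\<lambda>w. - time_deriv (tensor \<alpha> \<beta> \<gamma>) w - space_laplacian (tensor \<alpha> \<beta> \<gamma>) w) = ?D"
      unfolding time_deriv_tensor[OF smooth_reals(1,4) \<gamma>_deriv]
        space_laplacian_tensor[OF \<alpha>_deriv \<beta>_deriv smooth_reals(7)] dt_def lap_def ..
    finally show ?thesis
      by (simp add: E_def[abs_def] set_lebesgue_integral_def decay_def)
  qed
  have pointwise: "indicator (ball 0 1 \<times> {0..}) w *\<^sub>R (comparison \<sigma> w * ?D w) =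
      (\<Sum>j\<in>{1..N}. \<bar>q j\<bar> / kappa * A j w + \<sigma> * (q j / kappa) * B j w) - \<sigma> * E w" for w
  proof (cases "fst w \<in> ball 0 1")
    case False
    then show ?thesis
      by (auto simp: A_def B_def E_def support_disk)
  next
    case True
    show ?thesis
    proof (cases "0 \<le> snd w")
      case False
      then show ?thesis
        by (auto simp: A_def B_def E_def decay_def mem_Times_iff)
    next
      case t: True
      define X where "X = ?D w"
      have ind: "indicator (ball 0 1 \<times> {0..}) w = (1::real)"
        using True t by (simp add: mem_Times_iff)
      have AB: "A j w = exp (- rate * snd w) * (barrier (p j) (fst w) * X)" "B j w = green (p j) (fst w) * X" for j
        using t by (simp_all add: A_def B_def decay_def flip: X_def)
      have "(\<Sum>j\<in>{1..N}. \<bar>q j\<bar> / kappa * A j w + \<sigma> * (q j / kappa) * B j w) =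
          (\<Sum>j\<in>{1..N}. (exp (- rate * snd w) * (\<bar>q j\<bar> / kappa * barrier (p j) (fst w)) + \<sigma> * (q j / kappa * green (p j) (fst w))) * X)"
        by (intro sum.cong refl) (simp only: AB algebra_simps)
      also have "\<dots> = (exp (- rate * snd w) * \<Psi> (fst w) + \<sigma> * U (fst w)) * X"
        by (simp add: \<Psi>_def U_def sum.distrib sum_distrib_left flip: sum_distrib_right)
      finally show ?thesis
        by (simp add: ind comparison_def E_def algebra_simps flip: X_def)
    qed
  qed
  have sum_int: "integrable lborel (\<lambda>w. \<bar>q j\<bar> / kappa * A j w + \<sigma> * (q j / kappa) * B j w)" if "j \<in> {1..N}" for j
    using A1[OF that] B1[OF that] by (intro Bochner_Integration.integrable_add integrable_mult_right)
  have "(LINT w:ball 0 1 \<times> {0..}|lborel. comparison \<sigma> w * ?D w) =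
      (\<Sum>j\<in>{1..N}. \<integral>w. \<bar>q j\<bar> / kappa * A j w + \<sigma> * (q j / kappa) * B j w \<partial>lborel) - \<sigma> * (\<integral>w. E w \<partial>lborel)"
  proof -
    let ?C = "\<lambda>j w. \<bar>q j\<bar> / kappa * A j w + \<sigma> * (q j / kappa) * B j w"
    have "(\<integral>w. (\<Sum>j\<in>{1..N}. ?C j w) - \<sigma> * E w \<partial>lborel) = (\<integral>w. (\<Sum>j\<in>{1..N}. ?C j w) \<partial>lborel) - (\<integral>w. \<sigma> * E w \<partial>lborel)"
      by (intro Bochner_Integration.integral_diff Bochner_Integration.integrable_sum integrable_mult_right sum_int E_int)
    also have "(\<integral>w. (\<Sum>j\<in>{1..N}. ?C j w) \<partial>lborel) = (\<Sum>j\<in>{1..N}. \<integral>w. ?C j w \<partial>lborel)"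
      by (rule Bochner_Integration.integral_sum) (rule sum_int)
    finally show ?thesis
      unfolding set_lebesgue_integral_def pointwise by simp
  qed
  \<comment> \<open>Division by \<open>kappa\<close> gives \<open>U\<close> exactly the point
    sources of \<open>u\<close>, so the integrals along the lines above the sources cancel.\<close>
  also have "\<dots> = (\<Sum>j\<in>{1..N}. \<bar>q j\<bar> / kappa * (\<integral>w. A j w \<partial>lborel) +
      \<sigma> * (q j / kappa) * (\<integral>x. green (p j) x * \<phi> (x, 0) \<partial>lborel))"
  proof -
    have "(\<integral>w. \<bar>q j\<bar> / kappa * A j w + \<sigma> * (q j / kappa) * B j w \<partial>lborel) =
        \<bar>q j\<bar> / kappa * (\<integral>w. A j w \<partial>lborel) + \<sigma> * (q j / kappa) * (\<integral>x. green (p j) x * \<phi> (x, 0) \<partial>lborel) +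
        \<sigma> * (q j * (\<integral>t. decay 0 t * \<phi> (p j, t) \<partial>lborel))" if "j \<in> {1..N}" for j
    proof -
      have "(\<integral>w. \<bar>q j\<bar> / kappa * A j w + \<sigma> * (q j / kappa) * B j w \<partial>lborel) =
          \<bar>q j\<bar> / kappa * (\<integral>w. A j w \<partial>lborel) + \<sigma> * (q j / kappa) * (\<integral>w. B j w \<partial>lborel)"
        using A1[OF that] B1[OF that]
        by (simp only: Bochner_Integration.integral_add integrable_mult_right integral_mult_right_zero)
      then show ?thesis
        unfolding B2[OF that] using kappa_pos by (simp add: distrib_left)
    qed
    then show ?thesis
      unfolding E_eq by (simp add: sum.distrib sum_distrib_left)
  qed
  \<comment> \<open>\<open>\<sigma> * q j\<close> can have either sign, so the Green trace is
    estimated in absolute value, using \<open>0 \<le> green \<le> barrier\<close> off the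
    pole.\<close>
  also have "\<dots> \<ge> 0"
  proof (intro sum_nonneg)
    fix j assume j: "j \<in> {1..N}"
    have m0: "(\<lambda>x. \<phi> (x, 0)) \<in> borel_measurable borel" by (rule measurable_slices)
    have int0: "integrable lborel (\<lambda>x. g x * \<phi> (x, 0))" if "set_integrable lborel (ball 0 1) g" for g
    proof -
      have "integrable lborel (\<lambda>x. (indicator (ball 0 1) x *\<^sub>R g x) * \<phi> (x, 0))"
        by (rule integrable_mult_bounded[OF that[unfolded set_integrable_def] _ M(3)]) (use m0 in simp)
      also have "(\<lambda>x. (indicator (ball 0 1) x *\<^sub>R g x) * \<phi> (x, 0)) = (\<lambda>x. g x * \<phi> (x, 0))"
      proof
        fix x
        show "(indicator (ball 0 1) x *\<^sub>R g x) * \<phi> (x, 0) = g x * \<phi> (x, 0)"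
          by (cases "x \<in> ball 0 1") (simp_all add: support_disk)
      qed
      finally show ?thesis .
    qed
    have int_green: "integrable lborel (\<lambda>x. green (p j) x * \<phi> (x, 0))"
      and int_barrier: "integrable lborel (\<lambda>x. barrier (p j) x * \<phi> (x, 0))"
      by (intro int0 set_integrable_green pole[OF j])+
    have "\<bar>\<integral>x. green (p j) x * \<phi> (x, 0) \<partial>lborel\<bar> \<le> (\<integral>x. \<bar>green (p j) x * \<phi> (x, 0)\<bar> \<partial>lborel)"
      by (rule integral_abs_bound)
    also have "\<dots> \<le> (\<integral>x. barrier (p j) x * \<phi> (x, 0) \<partial>lborel)"
    proof (rule integral_mono_AE[OF _ int_barrier])
      show "integrable lborel (\<lambda>x. \<bar>green (p j) x * \<phi> (x, 0)\<bar>)"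
        using int_green by (rule integrable_abs)
      show "AE x in lborel. \<bar>green (p j) x * \<phi> (x, 0)\<bar> \<le> barrier (p j) x * \<phi> (x, 0)"
        using AE_lborel_singleton[of "p j"]
      proof eventually_elim
        case (elim x)
        show ?case
        proof (cases "x \<in> ball 0 1")
          case True
          then have "\<bar>green (p j) x\<bar> \<le> barrier (p j) x"
            using green_nonneg[OF pole_norm[OF j], of x] green_le_barrier[OF pole_norm[OF j], of x] elim by simp
          then show ?thesis
            using \<phi>_nonneg by (simp add: abs_mult mult_right_mono)
        qed (simp add: support_disk)
      qed
    qed
    also have "\<dots> \<le> (\<integral>w. A j w \<partial>lborel)"
      by (rule A2[OF j])
    finally have "\<bar>q j\<bar> / kappa * \<bar>\<integral>x. green (p j) x * \<phi> (x, 0) \<partial>lborel\<bar> \<le> \<bar>q j\<bar> / kappa * (\<integral>w. A j w \<partial>lborel)"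
      using kappa_pos by (intro mult_left_mono) auto
    moreover have "\<bar>\<sigma> * (q j / kappa) * (\<integral>x. green (p j) x * \<phi> (x, 0) \<partial>lborel)\<bar> =
        \<bar>q j\<bar> / kappa * \<bar>\<integral>x. green (p j) x * \<phi> (x, 0) \<partial>lborel\<bar>"
      using \<sigma> kappa_pos by (simp add: abs_mult abs_divide)
    ultimately show "0 \<le> \<bar>q j\<bar> / kappa * (\<integral>w. A j w \<partial>lborel) +
        \<sigma> * (q j / kappa) * (\<integral>x. green (p j) x * \<phi> (x, 0) \<partial>lborel)"
      by linarith
  qed
  finally show ?thesis
    unfolding D .
qed

lemma comparison_nonneg:
  assumes \<sigma>: "\<bar>\<sigma>\<bar> = 1" and x: "x \<in> ball 0 1 - P" and t: "0 < t"
  shows "0 \<le> comparison \<sigma> (x, t)"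
proof (rule weak_supersolution_nonneg[OF P _ _ _ comparison_weak[OF \<sigma>] x t])
  show "continuous_on ((cball 0 1 - P) \<times> {0..}) (comparison \<sigma>)"
    unfolding comparison_def using u_continuous
    by (intro continuous_intros continuous_on_compose2[OF continuous_on_U_\<Psi>(1)] continuous_on_compose2[OF continuous_on_U_\<Psi>(2)])
       (auto simp: case_prod_unfold)
  show "0 \<le> comparison \<sigma> (x, t)" if "cmod x = 1" "0 \<le> t" for x t
    using that by (simp add: comparison_def sphere_zero u_sphere)
  show "set_integrable lborel (ball 0 1 \<times> {0..T}) (comparison \<sigma>)" if T: "0 < T" for T
  proof -
    have ind: "indicator (ball 0 1 \<times> {0..T}) w = (indicator (ball 0 1) (fst w) * indicator {0..T} (snd w) :: real)" for w :: "complex \<times> real"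
      by (cases w) (simp add: indicator_def)
    have e: "integrable lborel (\<lambda>t. indicator {0..T} t * exp (- rate * t))"
      using borel_integrable_atLeastAtMost'[of 0 T "\<lambda>t. exp (- rate * t)"]
      by (simp add: set_integrable_def continuous_intros)
    have 1: "integrable lborel (\<lambda>w. (indicator (ball 0 1) (fst w) *\<^sub>R \<Psi> (fst w)) * (indicator {0..T} (snd w) * exp (- rate * snd w)))"
      using set_integrable_U_\<Psi>(2) e unfolding set_integrable_def by (rule integrable_lborel_prod_mult)
    have 2: "integrable lborel (\<lambda>w. (indicator (ball 0 1) (fst w) *\<^sub>R U (fst w)) * indicator {0..T} (snd w))"
      using set_integrable_U_\<Psi>(1) unfolding set_integrable_def by (rule integrable_lborel_prod_mult[OF _ integrable_indicator_Icc])
    have 3: "integrable lborel (\<lambda>w. indicator (ball 0 1 \<times> {0..T}) w *\<^sub>R (case w of (x, t) \<Rightarrow> u x t))"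
      using u_integrable[OF T] by (simp add: set_integrable_def)
    have "integrable lborel (\<lambda>w. (indicator (ball 0 1) (fst w) *\<^sub>R \<Psi> (fst w)) * (indicator {0..T} (snd w) * exp (- rate * snd w)) +
        \<sigma> * ((indicator (ball 0 1) (fst w) *\<^sub>R U (fst w)) * indicator {0..T} (snd w) -
        indicator (ball 0 1 \<times> {0..T}) w *\<^sub>R (case w of (x, t) \<Rightarrow> u x t)))" (is "integrable lborel ?h")
      by (intro Bochner_Integration.integrable_add integrable_mult_right Bochner_Integration.integrable_diff 1 2 3)
    also have "?h = (\<lambda>w. indicator (ball 0 1 \<times> {0..T}) w *\<^sub>R comparison \<sigma> w)"
      by (rule ext) (auto simp: comparison_def ind algebra_simps split: prod.split)
    finally show ?thesis
      by (simp only: set_integrable_def)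
  qed
qed

lemma abs_diff_le_barrier:
  assumes x: "x \<in> ball 0 1 - P" and t: "0 < t"
  shows "\<bar>U x - u x t\<bar> \<le> exp (- rate * t) * \<Psi> x"
  using comparison_nonneg[OF _ assms, of 1] comparison_nonneg[OF _ assms, of "-1"]
  unfolding comparison_def abs_le_iff by simp

end

section \<open>The low-frequency flux\<close>

lemma has_bochner_integral_exp:
  fixes a :: real
  assumes a: "0 < a"
  shows "has_bochner_integral lborel (\<lambda>t. indicator {0<..} t * exp (- a * t)) (1 / a)"
proof -
  have deriv: "((\<lambda>t. - (exp (- a * t) / a)) has_real_derivative exp (- a * t)) (at t)" for t
    using a by (auto intro!: derivative_eq_intros)
  have lim: "((\<lambda>t. - (exp (- a * t) / a)) \<longlongrightarrow> 0) at_top"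
  proof -
    have "filterlim (\<lambda>t. - a * t) at_bot at_top"
      using a by (intro filterlim_tendsto_neg_mult_at_bot[OF tendsto_const] filterlim_ident) auto
    then have "((\<lambda>t. exp (- a * t)) \<longlongrightarrow> 0) at_top"
      by (rule filterlim_compose[OF exp_at_bot])
    from tendsto_minus[OF tendsto_divide[OF this tendsto_const[of a]]] a show ?thesis
      by simp
  qed
  have "(\<integral>\<^sup>+t. ennreal (exp (- a * t)) * indicator {0..} t \<partial>lborel) = ennreal (0 - - (exp (- a * 0) / a))"
    by (rule nn_integral_FTC_atLeast[OF _ deriv _ lim]) auto
  then have "(\<integral>\<^sup>+t. ennreal (indicator {0..} t * exp (- a * t)) \<partial>lborel) = ennreal (1 / a)"
    by (simp add: ennreal_mult' mult.commute flip: ennreal_indicator)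
  moreover have "AE t in lborel. indicator {0..} t * exp (- a * t) = indicator {0<..} t * exp (- a * t)"
    using AE_lborel_singleton[of 0] by eventually_elim (auto simp: indicator_def)
  ultimately have "(\<integral>\<^sup>+t. ennreal (indicator {0<..} t * exp (- a * t)) \<partial>lborel) = ennreal (1 / a)"
    by (subst nn_integral_cong_AE[where v = "\<lambda>t. ennreal (indicator {0..} t * exp (- a * t))"]) (auto elim: eventually_mono)
  then show ?thesis
    using a by (intro has_bochner_integral_nn_integral) (auto intro!: borel_measurable_times borel_measurable_indicator)
qed

text \<open>The constant \<open>g\<close> transforms exactly to \<open>g / s\<close>. The transform
  of the remainder is bounded by \<open>D / c\<close> uniformly in \<open>s\<close>, so the factor
  \<open>s\<close> removes it in the limit. Measurability gives the Lebesgue integral its intended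
  meaning.\<close>

lemma laplace_transform_abelian:
  assumes h: "(\<lambda>t. indicator {0<..} t * h t) \<in> borel_measurable borel"
    and decay: "\<And>t. 0 < t \<Longrightarrow> \<bar>h t - g\<bar> \<le> D * exp (- c * t)" and c: "0 < c"
  shows "((\<lambda>s. s * laplace_transform h s) \<longlongrightarrow> g) (at_right 0)"
proof -
  have D: "0 \<le> D"
    using decay[of 1] by (smt (verit) exp_gt_zero mult_neg_pos)
  have bound: "\<bar>s * laplace_transform h s - g\<bar> \<le> s * (D / c)" if s: "0 < s" for s
  proof -
    let ?r = "\<lambda>t. indicator {0<..} t * (exp (- s * t) * (h t - g))"
    have r_eq: "?r t = exp (- s * t) * (indicator {0<..} t * h t) - g * (indicator {0<..} t * exp (- s * t))" for t
      by (simp add: algebra_simps)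
    have meas: "?r \<in> borel_measurable lborel"
      unfolding r_eq using h by (auto intro!: borel_measurable_diff borel_measurable_times borel_measurable_indicator)
    have r_bound: "\<bar>?r t\<bar> \<le> D * (indicator {0<..} t * exp (- c * t))" for t
    proof (cases "0 < t")
      case True
      have "exp (- s * t) * \<bar>h t - g\<bar> \<le> 1 * (D * exp (- c * t))"
        using decay[OF True] s True by (intro mult_mono) auto
      then show ?thesis
        using True by (simp add: abs_mult)
    qed simp
    note E = has_bochner_integral_exp[OF c] has_bochner_integral_exp[OF s]
    have int_D: "integrable lborel (\<lambda>t. D * (indicator {0<..} t * exp (- c * t)))"
      using integrable.intros[OF E(1)] by simp
    have int_r: "integrable lborel ?r"
      by (rule Bochner_Integration.integrable_bound[OF int_D meas]) (use r_bound D in \<open>auto simp: abs_mult\<close>)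
    have int_g: "integrable lborel (\<lambda>t. g * (indicator {0<..} t * exp (- s * t)))"
      using integrable.intros[OF E(2)] by simp
    have "laplace_transform h s = (\<integral>t. g * (indicator {0<..} t * exp (- s * t)) + ?r t \<partial>lborel)"
      unfolding laplace_transform_def set_lebesgue_integral_def
      by (rule Bochner_Integration.integral_cong) (simp_all add: algebra_simps)
    also have "\<dots> = g * (1 / s) + (\<integral>t. ?r t \<partial>lborel)"
      using int_g int_r has_bochner_integral_integral_eq[OF E(2)]
      by (simp only: Bochner_Integration.integral_add integral_mult_right_zero)
    finally have "s * laplace_transform h s - g = s * (\<integral>t. ?r t \<partial>lborel)"
      using s by (simp add: field_simps)
    moreover have "\<bar>\<integral>t. ?r t \<partial>lborel\<bar> \<le> (\<integral>t. D * (indicator {0<..} t * exp (- c * t)) \<partial>lborel)"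
    proof -
      have "\<bar>\<integral>t. ?r t \<partial>lborel\<bar> \<le> (\<integral>t. \<bar>?r t\<bar> \<partial>lborel)"
        by (rule integral_abs_bound)
      also have "\<dots> \<le> (\<integral>t. D * (indicator {0<..} t * exp (- c * t)) \<partial>lborel)"
        by (rule integral_mono[OF integrable_abs[OF int_r] int_D r_bound])
      finally show ?thesis .
    qed
    then have "\<bar>\<integral>t. ?r t \<partial>lborel\<bar> \<le> D * (1 / c)"
      using has_bochner_integral_integral_eq[OF E(1)] by (simp only: integral_mult_right_zero)
    then have "s * \<bar>\<integral>t. ?r t \<partial>lborel\<bar> \<le> s * (D * (1 / c))"
      using s by (intro mult_left_mono) auto
    ultimately show ?thesis
      using s by (simp add: abs_mult)
  qed
  have "((\<lambda>s. s * laplace_transform h s - g) \<longlongrightarrow> 0) (at_right 0)"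
  proof (rule Lim_null_comparison)
    show "\<forall>\<^sub>F s in at_right 0. norm (s * laplace_transform h s - g) \<le> s * (D / c)"
      using bound by (auto simp: eventually_at_filter)
    have "((\<lambda>s. s * (D / c)) \<longlongrightarrow> 0 * (D / c)) (at_right 0)"
      by (intro tendsto_intros)
    then show "((\<lambda>s. s * (D / c)) \<longlongrightarrow> 0) (at_right 0)" by simp
  qed
  then show ?thesis
    by (rule LIM_zero_cancel)
qed

section \<open>Radial derivatives at the circle\<close>

definition poisson :: "complex \<Rightarrow> real \<Rightarrow> real" where
  "poisson p \<theta> = (1 - (cmod p)\<^sup>2) / (cmod (cis \<theta> - p))\<^sup>2"

lemma radial_derivative_cmod:
  assumes nz: "a * cis \<theta> + b \<noteq> 0"
  defines "S1 \<equiv> 2 * (Re (a * cis \<theta> + b) * Re (a * cis \<theta>) + Im (a * cis \<theta> + b) * Im (a * cis \<theta>))"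
  shows "((\<lambda>r. cmod (a * (of_real r * cis \<theta>) + b)) has_real_derivative S1 / (2 * cmod (a * cis \<theta> + b))) (at 1)"
    "((\<lambda>r. ln (cmod (a * (of_real r * cis \<theta>) + b))) has_real_derivative S1 / (2 * (cmod (a * cis \<theta> + b))\<^sup>2)) (at 1)"
proof -
  let ?w = "cmod (a * cis \<theta> + b)"
  have w: "0 < ?w" using nz by simp
  have "((\<lambda>s. (cmod (a * (cis \<theta> + s *\<^sub>R cis \<theta>) + b))\<^sup>2 + 0) has_real_derivative S1) (at 0)"
    unfolding S1_def by (rule line_derivative_cmod_affine)
  then have "((\<lambda>r. (cmod (a * (of_real r * cis \<theta>) + b))\<^sup>2) has_real_derivative S1) (at (0 + 1))"
    by (subst DERIV_shift) (simp add: algebra_simps scaleR_conv_of_real)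
  then have sq: "((\<lambda>r. (cmod (a * (of_real r * cis \<theta>) + b))\<^sup>2) has_real_derivative S1) (at 1)"
    by simp
  have at1: "(cmod (a * (of_real 1 * cis \<theta>) + b))\<^sup>2 = ?w\<^sup>2" by simp
  have w2: "0 < ?w\<^sup>2" using w by simp
  have "((\<lambda>r. sqrt ((cmod (a * (of_real r * cis \<theta>) + b))\<^sup>2)) has_real_derivative inverse (sqrt (?w\<^sup>2)) / 2 * S1) (at 1)"
    by (rule DERIV_chain2[OF _ sq]) (use DERIV_real_sqrt[OF w2] at1 in simp)
  moreover have "(\<lambda>r. sqrt ((cmod (a * (of_real r * cis \<theta>) + b))\<^sup>2)) = (\<lambda>r. cmod (a * (of_real r * cis \<theta>) + b))"
    by (simp only: real_sqrt_abs abs_norm_cancel)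
  moreover have "inverse (sqrt (?w\<^sup>2)) / 2 * S1 = S1 / (2 * ?w)"
    by (simp only: real_sqrt_abs abs_norm_cancel divide_inverse inverse_mult_distrib mult_ac)
  ultimately show d: "((\<lambda>r. cmod (a * (of_real r * cis \<theta>) + b)) has_real_derivative S1 / (2 * ?w)) (at 1)"
    by (simp only:)
  have "((\<lambda>r. ln (cmod (a * (of_real r * cis \<theta>) + b))) has_real_derivative 1 / ?w * (S1 / (2 * ?w))) (at 1)"
    by (rule DERIV_chain2[OF _ d]) (use DERIV_ln_divide[OF w] in simp)
  then show "((\<lambda>r. ln (cmod (a * (of_real r * cis \<theta>) + b))) has_real_derivative S1 / (2 * ?w\<^sup>2)) (at 1)"
    by (simp only: power2_eq_square times_divide_times_eq mult_1 mult_ac)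
qed

text \<open>The moduli agree on the circle, so the two logarithmic derivatives share a denominator
  and their numerators differ by \<open>2 * ((cmod p)^2 - 1)\<close>. For the barrier only a finite
  derivative matters.\<close>

lemma radial_derivative_green:
  assumes p: "cmod p < 1"
  shows "((\<lambda>r. green p (of_real r * cis \<theta>)) has_real_derivative - poisson p \<theta>) (at 1)"
    "\<exists>D. ((\<lambda>r. barrier p (of_real r * cis \<theta>)) has_real_derivative D) (at 1)"
proof -
  have nz1: "- cnj p * cis \<theta> + 1 \<noteq> 0"
    using reflection_pos[OF p, of "cis \<theta>"] by auto
  have nz2: "1 * cis \<theta> + - p \<noteq> 0"
    using p by (metis add_diff_cancel_left' diff_add_cancel mult_1 norm_cis less_irrefl add.commute uminus_add_conv_diff eq_iff_diff_eq_0)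
  have eq: "(cmod (- cnj p * cis \<theta> + 1))\<^sup>2 = (cmod (1 * cis \<theta> + - p))\<^sup>2"
    using cmod_reflection_identity[of p "cis \<theta>"] by simp
  define A where "A = (cmod (1 * cis \<theta> + - p))\<^sup>2"
  have A: "A \<noteq> 0" using nz2 by (simp add: A_def)
  define L where "L a b = 2 * (Re (a * cis \<theta> + b) * Re (a * cis \<theta>) + Im (a * cis \<theta> + b) * Im (a * cis \<theta>))" for a b
  have "((\<lambda>r. green p (of_real r * cis \<theta>)) has_real_derivative L (- cnj p) 1 / (2 * A) - L 1 (- p) / (2 * A)) (at 1)"
    unfolding green_def A_def eq[symmetric] L_def
    using DERIV_diff[OF radial_derivative_cmod(2)[OF nz1] radial_derivative_cmod(2)[OF nz2]] eq by simp
  also have "L (- cnj p) 1 / (2 * A) - L 1 (- p) / (2 * A) = - poisson p \<theta>"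
  proof -
    have cs: "cos \<theta> * cos \<theta> + sin \<theta> * sin \<theta> = 1"
      using sin_cos_squared_add3[of \<theta>] by simp
    have gen: "(1 - (x * c + y * s)) * (- (x * c) - y * s) + (y * c - x * s) * (y * c - x * s) =
        (x\<^sup>2 + y\<^sup>2) * (c * c + s * s) - (x * c + y * s)"
      "(c - x) * c + (s - y) * s = (c * c + s * s) - (x * c + y * s)" for x y c s :: real
      by (simp_all add: power2_eq_square algebra_simps)
    have "L (- cnj p) 1 = 2 * ((1 - (Re p * cos \<theta> + Im p * sin \<theta>)) * (- (Re p * cos \<theta>) - Im p * sin \<theta>) +
        (Im p * cos \<theta> - Re p * sin \<theta>) * (Im p * cos \<theta> - Re p * sin \<theta>))"
      by (simp add: L_def)
    moreover have "L 1 (- p) = 2 * ((cos \<theta> - Re p) * cos \<theta> + (sin \<theta> - Im p) * sin \<theta>)"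
      by (simp add: L_def)
    ultimately have L: "L (- cnj p) 1 - L 1 (- p) = 2 * ((cmod p)\<^sup>2 - 1)"
      unfolding gen cs cmod_power2 by simp
    have "L (- cnj p) 1 / (2 * A) - L 1 (- p) / (2 * A) = 2 * ((cmod p)\<^sup>2 - 1) / (2 * A)"
      unfolding diff_divide_distrib[symmetric] L ..
    also have "\<dots> = - ((1 - (cmod p)\<^sup>2) / A)"
      by (simp only: mult_divide_mult_cancel_left_if minus_divide_left) simp
    finally show ?thesis
      by (simp add: poisson_def A_def)
  qed
  finally show g: "((\<lambda>r. green p (of_real r * cis \<theta>)) has_real_derivative - poisson p \<theta>) (at 1)" .
  show "\<exists>D. ((\<lambda>r. barrier p (of_real r * cis \<theta>)) has_real_derivative D) (at 1)"
    unfolding barrier_def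
    by (rule exI, rule DERIV_add[OF g DERIV_diff[OF radial_derivative_cmod(1)[OF nz1] radial_derivative_cmod(1)[OF nz2]]])
qed

section \<open>The flux at a fixed boundary point\<close>

context source_problem
begin

definition limit_flux :: "real \<Rightarrow> real" where
  "limit_flux \<theta> = - (\<Sum>j\<in>{1..N}. q j / kappa * poisson (p j) \<theta>)"

lemma radial_derivative_U: "((\<lambda>r. U (of_real r * cis \<theta>)) has_real_derivative limit_flux \<theta>) (at 1)"
proof -
  have "((\<lambda>r. U (of_real r * cis \<theta>)) has_real_derivative (\<Sum>j\<in>{1..N}. q j / kappa * (- poisson (p j) \<theta>))) (at 1)"
    unfolding U_def by (intro DERIV_sum DERIV_cmult radial_derivative_green(1) pole_norm)
  then show ?thesis
    by (simp add: limit_flux_def sum_negf)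
qed

lemma radial_derivative_\<Psi>: "\<exists>D. ((\<lambda>r. \<Psi> (of_real r * cis \<theta>)) has_real_derivative D) (at 1)"
proof -
  have "\<forall>j\<in>{1..N}. \<exists>D. ((\<lambda>r. barrier (p j) (of_real r * cis \<theta>)) has_real_derivative D) (at 1)"
    using radial_derivative_green(2) pole_norm by blast
  from bchoice[OF this] obtain D where "\<forall>j\<in>{1..N}. ((\<lambda>r. barrier (p j) (of_real r * cis \<theta>)) has_real_derivative D j) (at 1)" ..
  then have "((\<lambda>r. \<Psi> (of_real r * cis \<theta>)) has_real_derivative (\<Sum>j\<in>{1..N}. \<bar>q j\<bar> / kappa * D j)) (at 1)"
    unfolding \<Psi>_def by (intro DERIV_sum DERIV_cmult) blast
  then show ?thesis by blast
qed

lemma eventually_off_poles: "\<exists>r0<1. 0 < r0 \<and> (\<forall>r. r0 < r \<and> r < 1 \<longrightarrow> of_real r * cis \<theta> \<in> ball 0 1 - P)"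
proof -
  \<comment> \<open>The value 1/2 keeps the set nonempty and \<open>r\<close> positive, so that
    \<open>cmod (of_real r * cis \<theta>) = r\<close>.\<close>
  define r0 where "r0 = Max (insert (1/2) ((\<lambda>j. cmod (p j)) ` {1..N}))"
  have r0: "r0 < 1"
    using pole_norm unfolding r0_def by (subst Max_less_iff) auto
  have half: "1 / 2 \<le> r0"
    unfolding r0_def by (rule Max_ge) auto
  have le: "cmod (p j) \<le> r0" if "j \<in> {1..N}" for j
    unfolding r0_def using that by (intro Max_ge) auto
  have "of_real r * cis \<theta> \<in> ball 0 1 - P" if r: "r0 < r" "r < 1" for r
  proof
    have n: "cmod (of_real r * cis \<theta>) = r"
      using r half by (simp add: norm_mult)
    then show "of_real r * cis \<theta> \<in> ball 0 1"
      using r by simp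
    show "of_real r * cis \<theta> \<notin> P"
    proof
      assume "of_real r * cis \<theta> \<in> P"
      then obtain j where "j \<in> {1..N}" "of_real r * cis \<theta> = p j"
        by blast
      then show False
        using le[of j] n r by simp
    qed
  qed
  then show ?thesis
    using r0 half by (intro exI[of _ r0]) auto
qed

lemma flux_deriv:
  assumes "\<theta> \<in> {0..<2 * pi}" "0 < t"
  shows "((\<lambda>r. u (of_real r * cis \<theta>) t / (r - 1)) \<longlongrightarrow> f \<theta> t) (at_left 1)"
proof -
  have "((\<lambda>r. u (of_real r * cis \<theta>) t) has_real_derivative f \<theta> t) (at_left 1)"
    using flux assms by (simp add: boundary_flux_def)
  then show ?thesis
    using u_lateral[of "cis \<theta>" t] assms(2) by (simp add: has_field_derivative_iff)
qed

text \<open>All three functions vanish at the boundary point, so their radial difference quotients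
  are values divided by \<open>r - 1\<close>. The pointwise bound on \<open>U - u\<close> passes to
  the limit at fixed \<open>t\<close>, with a constant that does not depend on
  \<open>t\<close>.\<close>

lemma flux_decay:
  assumes \<theta>: "\<theta> \<in> {0..<2 * pi}"
  obtains D where "\<And>t. 0 < t \<Longrightarrow> \<bar>f \<theta> t - limit_flux \<theta>\<bar> \<le> D * exp (- rate * t)"
proof -
  obtain D where D: "((\<lambda>r. \<Psi> (of_real r * cis \<theta>)) has_real_derivative D) (at 1)"
    using radial_derivative_\<Psi> by blast
  have Psi1: "\<Psi> (of_real 1 * cis \<theta>) = 0" and U1: "U (of_real 1 * cis \<theta>) = 0"
    by (simp_all add: sphere_zero)
  have limPsi: "((\<lambda>r. \<Psi> (of_real r * cis \<theta>) / (r - 1)) \<longlongrightarrow> D) (at_left 1)"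
    using has_field_derivative_at_within[OF D, of "{..<1}"] Psi1 by (simp add: has_field_derivative_iff)
  have limU: "((\<lambda>r. U (of_real r * cis \<theta>) / (r - 1)) \<longlongrightarrow> limit_flux \<theta>) (at_left 1)"
    using has_field_derivative_at_within[OF radial_derivative_U[of \<theta>], of "{..<1}"] U1 by (simp add: has_field_derivative_iff)
  obtain r0 where r0: "r0 < 1" "\<And>r. r0 < r \<Longrightarrow> r < 1 \<Longrightarrow> of_real r * cis \<theta> \<in> ball 0 1 - P"
    using eventually_off_poles[of \<theta>] by blast
  have "\<bar>f \<theta> t - limit_flux \<theta>\<bar> \<le> \<bar>D\<bar> * exp (- rate * t)" if t: "0 < t" for t
  proof -
    have "((\<lambda>r. \<bar>u (of_real r * cis \<theta>) t / (r - 1) - U (of_real r * cis \<theta>) / (r - 1)\<bar>) \<longlongrightarrow> \<bar>f \<theta> t - limit_flux \<theta>\<bar>) (at_left 1)"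
      by (intro tendsto_intros flux_deriv[OF \<theta> t] limU)
    moreover have "((\<lambda>r. \<bar>\<Psi> (of_real r * cis \<theta>) / (r - 1)\<bar> * exp (- rate * t)) \<longlongrightarrow> \<bar>D\<bar> * exp (- rate * t)) (at_left 1)"
      by (intro tendsto_intros limPsi)
    moreover have "\<forall>\<^sub>F r in at_left 1. \<bar>u (of_real r * cis \<theta>) t / (r - 1) - U (of_real r * cis \<theta>) / (r - 1)\<bar> \<le>
        \<bar>\<Psi> (of_real r * cis \<theta>) / (r - 1)\<bar> * exp (- rate * t)"
      using eventually_at_left_real[OF r0(1)]
    proof eventually_elim
      case (elim r)
      define x where "x = of_real r * cis \<theta>"
      have "\<bar>U x - u x t\<bar> \<le> exp (- rate * t) * \<Psi> x"
        unfolding x_def using elim by (intro abs_diff_le_barrier r0(2) t) auto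
      also have "\<dots> \<le> exp (- rate * t) * \<bar>\<Psi> x\<bar>"
        by simp
      finally have "\<bar>U x - u x t\<bar> / \<bar>r - 1\<bar> \<le> exp (- rate * t) * \<bar>\<Psi> x\<bar> / \<bar>r - 1\<bar>"
        by (rule divide_right_mono) simp
      moreover have "\<bar>u x t / (r - 1) - U x / (r - 1)\<bar> = \<bar>U x - u x t\<bar> / \<bar>r - 1\<bar>"
        by (simp only: diff_divide_distrib[symmetric] abs_divide abs_minus_commute[of "U x"])
      ultimately show ?case
        unfolding x_def[symmetric] by (simp add: abs_divide mult.commute)
    qed
    ultimately show ?thesis
      by (intro tendsto_le[OF trivial_limit_at_left_real])
  qed
  then show ?thesis
    using that by blast
qed

text \<open>\<open>f\<close> is specified only as a pointwise derivative, so its measurability in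
  time comes from being a limit of difference quotients, each continuous in
  \<open>t\<close>.\<close>

lemma flux_measurable:
  assumes \<theta>: "\<theta> \<in> {0..<2 * pi}"
  shows "(\<lambda>t. indicator {0<..} t * f \<theta> t) \<in> borel_measurable borel"
proof -
  obtain r0 where r0: "r0 < 1" "0 < r0" "\<And>r. r0 < r \<Longrightarrow> r < 1 \<Longrightarrow> of_real r * cis \<theta> \<in> ball 0 1 - P"
    using eventually_off_poles[of \<theta>] by blast
  \<comment> \<open>The double successor makes the factor strictly less than 1, so every radius
    \<open>r n\<close> stays strictly above \<open>r0\<close>.\<close>
  define e where "e n = (1 - r0) * inverse (real (Suc (Suc n)))" for n
  define r where "r n = 1 - e n" for n
  have e: "0 < e n" "e n < 1 - r0" for n
  proof -
    have "0 < inverse (real (Suc (Suc n)))" "inverse (real (Suc (Suc n))) < 1"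
      by (simp_all add: inverse_less_1_iff)
    then show "0 < e n" "e n < 1 - r0"
      using r0(1) mult_strict_left_mono[of "inverse (real (Suc (Suc n)))" 1 "1 - r0"] by (simp_all add: e_def)
  qed
  have r: "r0 < r n" "r n < 1" for n
    using e[of n] by (simp_all add: r_def)
  have "r \<longlonglongrightarrow> 1 - (1 - r0) * 0"
    unfolding r_def e_def by (intro tendsto_intros LIMSEQ_Suc[OF LIMSEQ_inverse_real_of_nat])
  then have r_lim: "filterlim r (at_left 1) sequentially"
    using r(2) by (simp add: filterlim_at less_imp_neq)
  show ?thesis
  proof (rule borel_measurable_LIMSEQ_real)
    show "(\<lambda>n. indicator {0<..} t * (u (of_real (r n) * cis \<theta>) t / (r n - 1))) \<longlonglongrightarrow> indicator {0<..} t * f \<theta> t" for t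
    proof (cases "0 < t")
      case True
      then show ?thesis
        using filterlim_compose[OF flux_deriv[OF \<theta> True] r_lim] by simp
    qed simp
    show "(\<lambda>t. indicator {0<..} t * (u (of_real (r n) * cis \<theta>) t / (r n - 1))) \<in> borel_measurable borel" for n
    proof -
      have "of_real (r n) * cis \<theta> \<in> cball 0 1 - P"
        using r0(3)[OF r] ball_subset_cball by blast
      then have "continuous_on {0<..} (\<lambda>t. u (of_real (r n) * cis \<theta>) t / (r n - 1))"
        using r(2)[of n] by (intro continuous_intros continuous_on_subset[OF u_slice_continuous]) auto
      then have "(\<lambda>t. indicator {0<..} t *\<^sub>R (u (of_real (r n) * cis \<theta>) t / (r n - 1))) \<in> borel_measurable borel"
        by (intro borel_measurable_continuous_on_indicator) auto
      then show ?thesis by simp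
    qed
  qed
qed

lemma low_frequency_flux_eq:
  assumes \<theta>: "\<theta> \<in> {0..<2 * pi}"
  shows "low_frequency_flux f \<theta> = limit_flux \<theta>"
proof -
  obtain D where D: "\<And>t. 0 < t \<Longrightarrow> \<bar>f \<theta> t - limit_flux \<theta>\<bar> \<le> D * exp (- rate * t)"
    using flux_decay[OF \<theta>] by blast
  have "(normalized_flux f \<theta> \<longlongrightarrow> limit_flux \<theta>) (at_right 0)"
    unfolding normalized_flux_def[abs_def]
    by (rule laplace_transform_abelian[OF flux_measurable[OF \<theta>] D rate_pos])
  then show ?thesis
    unfolding low_frequency_flux_def by (rule tendsto_Lim[OF trivial_limit_at_right_real])
qed

end

section \<open>Hankel matrices of exponential sums\<close>

unbundle no vec_syntax

text \<open>These are the coefficients of a Lagrange basis polynomial, padded with zeros up to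
  length \<open>m\<close>.\<close>

lemma interpolation_coeffs:
  fixes x :: "'i \<Rightarrow> 'a::field"
  assumes finI: "finite I" and inj: "inj_on x I" and j: "j \<in> I" and m: "card I \<le> m"
  obtains a where "\<And>i. i \<in> I \<Longrightarrow> (\<Sum>c<m. a c * x i ^ c) = (if i = j then 1 else 0)"
proof -
  define P where "P = (\<Prod>i\<in>I - {j}. [:- x i, 1:])"
  have poly_P: "poly P y = (\<Prod>i\<in>I - {j}. y - x i)" for y
    by (simp add: P_def poly_prod)
  have nz: "poly P (x j) \<noteq> 0"
    using finI inj j by (auto simp: poly_P prod_zero_iff inj_on_def)
  have "degree P \<le> (\<Sum>i\<in>I - {j}. degree [:- x i, 1:])"
    unfolding P_def using degree_prod_sum_le[of "I - {j}" "\<lambda>i. [:- x i, 1:]"] finI by (simp add: o_def)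
  also have "\<dots> = card (I - {j})"
    by simp
  also have "\<dots> < m"
    using finI j m by (metis card_Diff1_less less_le_trans)
  finally have deg: "degree P < m" .
  define a where "a c = coeff P c / poly P (x j)" for c
  have "(\<Sum>c<m. a c * x i ^ c) = (if i = j then 1 else 0)" if i: "i \<in> I" for i
  proof -
    have "(\<Sum>c<m. coeff P c * x i ^ c) = (\<Sum>c\<le>degree P. coeff P c * x i ^ c)"
      using deg by (intro sum.mono_neutral_right) (auto simp: coeff_eq_0)
    also have "\<dots> = poly P (x i)"
      by (simp add: poly_altdef)
    finally have "(\<Sum>c<m. a c * x i ^ c) = poly P (x i) / poly P (x j)"
      by (simp add: a_def flip: sum_divide_distrib)
    also have "\<dots> = (if i = j then 1 else 0)"
      using nz finI i by (auto simp: poly_P)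
    finally show ?thesis .
  qed
  then show ?thesis
    by (rule that)
qed

text \<open>The matrix factors as Vandermonde times diagonal times transposed Vandermonde. Lagrange
  coefficients serve twice: as functionals separating the node vectors and as preimages of these
  vectors.\<close>

lemma rank_hankel_exponential_sum:
  fixes x W :: "'i \<Rightarrow> 'a::field"
  assumes finI: "finite I" and inj: "inj_on x I" and W: "\<And>i. i \<in> I \<Longrightarrow> W i \<noteq> 0" and m: "card I \<le> m"
  shows "vec_space.rank m (mat m m (\<lambda>(r, c). \<Sum>i\<in>I. W i * x i ^ (r + c))) = card I"
proof -
  interpret vec_space "TYPE('a)" m .
  define H where "H = mat m m (\<lambda>(r, c). \<Sum>i\<in>I. W i * x i ^ (r + c))"
  define v where "v i = vec m (\<lambda>r. x i ^ r)" for i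
  have H: "H \<in> carrier_mat m m"
    by (simp add: H_def)
  \<comment> \<open>The entry of index 1 recovers the node only if \<open>m \<ge> 2\<close>; for
    smaller \<open>m\<close> there is at most one node.\<close>
  have inj_v: "inj_on v I"
  proof (rule inj_onI)
    fix i j assume ij: "i \<in> I" "j \<in> I" and eq: "v i = v j"
    show "i = j"
    proof (cases "m \<ge> 2")
      case True
      then have "v k $ 1 = x k" for k
        by (simp add: v_def)
      then have "x i = x j"
        using eq by metis
      then show ?thesis using ij inj by (auto dest: inj_onD)
    next
      case False
      then have "card I \<le> 1" using m by simp
      then show ?thesis using ij assms(1) by (metis card_le_Suc0_iff_eq One_nat_def)
    qed
  qed
  define S where "S = v ` I"
  have S: "S \<subseteq> carrier_vec m" "finite S"
    using finI by (auto simp: S_def v_def)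
  have lincomb_S: "lincomb a S = vec m (\<lambda>r. \<Sum>i\<in>I. a (v i) * x i ^ r)" for a
  proof (rule eq_vecI)
    fix r assume r: "r < dim_vec (vec m (\<lambda>r. \<Sum>i\<in>I. a (v i) * x i ^ r))"
    then have "lincomb a S $ r = (\<Sum>u\<in>S. a u * u $ r)"
      using S by (simp add: lincomb_index)
    also have "\<dots> = (\<Sum>i\<in>I. a (v i) * v i $ r)"
      using inj_v by (simp add: S_def sum.reindex)
    finally show "lincomb a S $ r = vec m (\<lambda>r. \<Sum>i\<in>I. a (v i) * x i ^ r) $ r"
      using r by (simp add: v_def)
  qed (use S in \<open>simp add: lincomb_dim\<close>)
  have indpt: "lin_indpt S"
  proof
    assume "lin_dep S"
    then obtain a where a: "lincomb a S = 0\<^sub>v m" "\<exists>u\<in>S. a u \<noteq> 0"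
      using finite_lin_dep[OF S(2) _ S(1)] by auto
    then obtain j where j: "j \<in> I" "a (v j) \<noteq> 0"
      by (auto simp: S_def)
    obtain b where b: "\<And>i. i \<in> I \<Longrightarrow> (\<Sum>c<m. b c * x i ^ c) = (if i = j then 1 else 0)"
      using interpolation_coeffs[OF finI inj j(1) m] by blast
    have "(\<Sum>i\<in>I. a (v i) * x i ^ r) = 0" if "r < m" for r
      using arg_cong[OF a(1), of "\<lambda>u. u $ r"] that by (simp add: lincomb_S)
    \<comment> \<open>Pairing the vanishing combination with the coefficients \<open>b\<close> of
      the basis polynomial at node \<open>j\<close> isolates the coefficient of
      \<open>v j\<close>.\<close>
    then have "0 = (\<Sum>r<m. b r * (\<Sum>i\<in>I. a (v i) * x i ^ r))"
      by simp
    also have "\<dots> = (\<Sum>i\<in>I. a (v i) * (\<Sum>r<m. b r * x i ^ r))"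
      by (subst sum_distrib_left, subst sum.swap) (simp add: sum_distrib_left mult_ac)
    also have "\<dots> = a (v j)"
      using b finI j(1) by (simp add: if_distrib [of "(*) _"] cong: if_cong sum.cong)
    finally show False using j(2) by simp
  qed
  have cols: "set (cols H) \<subseteq> carrier_vec m"
    using H cols_dim by blast
  have sub1: "set (cols H) \<subseteq> span S"
  proof
    fix y assume "y \<in> set (cols H)"
    then obtain c where c: "c < m" "y = col H c"
      using H by (auto simp: cols_def)
    \<comment> \<open>Column \<open>c\<close> is the combination of node vectors with coefficients
      \<open>W i * x i ^ c\<close>. Linear combinations are indexed by vectors, hence the inverse of
      \<open>v\<close>.\<close>
    define a where "a u = W (the_inv_into I v u) * x (the_inv_into I v u) ^ c" for u
    have "y = lincomb a S"
      unfolding lincomb_S using c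
      by (intro eq_vecI)
        (auto simp: H_def a_def the_inv_into_f_f[OF inj_v] power_add mult_ac intro!: sum.cong)
    then show "y \<in> span S"
      using S by (auto simp: span_def)
  qed
  have sub2: "S \<subseteq> span (set (cols H))"
  proof
    fix y assume "y \<in> S"
    then obtain j where j: "j \<in> I" "y = v j"
      by (auto simp: S_def)
    obtain b where b: "\<And>i. i \<in> I \<Longrightarrow> (\<Sum>c<m. b c * x i ^ c) = (if i = j then 1 else 0)"
      using interpolation_coeffs[OF finI inj j(1) m] by blast
    \<comment> \<open>The matrix maps the Lagrange coefficients of node \<open>j\<close> to
      \<open>W j\<close> times \<open>v j\<close>; the division normalises, and here nonzero weights
      enter.\<close>
    define bv where "bv = vec m (\<lambda>c. b c / W j)"
    have "(H *\<^sub>v bv) $ r = v j $ r" if r: "r < m" for r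
    proof -
      have "(H *\<^sub>v bv) $ r = (\<Sum>c<m. (\<Sum>i\<in>I. W i * x i ^ (r + c)) * (b c / W j))"
        using r by (simp add: H_def bv_def scalar_prod_def atLeast0LessThan)
      also have "\<dots> = (\<Sum>i\<in>I. W i * x i ^ r / W j * (\<Sum>c<m. b c * x i ^ c))"
        by (subst sum_distrib_right, subst sum.swap)
           (simp add: sum_distrib_left power_add mult_ac)
      also have "\<dots> = v j $ r"
        using b finI j(1) W[OF j(1)] r by (simp add: if_distrib [of "(*) _"] v_def cong: if_cong sum.cong)
      finally show ?thesis .
    qed
    then have "H *\<^sub>v bv = v j"
      using H by (intro eq_vecI) (auto simp: v_def)
    then have "y \<in> col_space H"
      using col_space_eq[OF H] H j(2) by (auto simp: bv_def v_def)
    then show "y \<in> span (set (cols H))"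
      by (simp add: col_space_def)
  qed
  have "span (set (cols H)) = span S"
    using sub1 sub2 span_is_subset span_is_submodule S(1) cols by (meson subset_antisym)
  moreover have "vectorspace.dim class_ring (span_vs S) = card S"
    using dim_span[OF S, of S] indpt by (auto simp: maximal_def)
  moreover have "card S = card I"
    unfolding S_def using inj_v by (rule card_image)
  ultimately show ?thesis
    by (simp add: rank_def H_def)
qed

section \<open>Moments of the Poisson kernel\<close>

lemma integral_cis_multiple:
  fixes k :: int
  shows "(LINT \<theta>:{0..2*pi}|lborel. cis (of_int k * \<theta>)) = (if k = 0 then 2 * of_real pi else 0)"
proof (cases "k = 0")
  case True
  then show ?thesis
    by (simp add: set_integral_const scaleR_conv_of_real)
next
  case False
  let ?F = "\<lambda>\<theta>. cis (of_int k * \<theta>) / (\<i> * of_int k)"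
  have deriv: "(?F has_vector_derivative cis (of_int k * \<theta>)) (at \<theta> within A)" for \<theta> A
  proof -
    have "cis (of_int k * \<theta>) = exp (\<theta> *\<^sub>R (\<i> * of_int k))" for \<theta>
      by (simp add: cis_conv_exp scaleR_conv_of_real mult_ac)
    then have "((\<lambda>\<theta>. cis (of_int k * \<theta>)) has_vector_derivative (cis (of_int k * \<theta>) * (\<i> * of_int k))) (at \<theta> within A)"
      using exp_scaleR_has_vector_derivative_right[of "\<i> * of_int k" \<theta> A] by simp
    then have "(?F has_vector_derivative (cis (of_int k * \<theta>) * (\<i> * of_int k)) / (\<i> * of_int k)) (at \<theta> within A)"
      by (rule has_vector_derivative_divide)
    then show ?thesis
      using False by simp
  qed
  have "(LINT \<theta>:{0..2*pi}|lborel. cis (of_int k * \<theta>)) = ?F (2 * pi) - ?F 0"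
    unfolding set_lebesgue_integral_def
    by (rule integral_FTC_Icc) (auto intro!: deriv continuous_intros)
  also have "\<dots> = 0"
    using cis_multiple_2pi[of "of_int k"] by (simp add: mult_ac)
  finally show ?thesis
    using False by simp
qed

text \<open>Two geometric series for the nonpositive and the positive frequencies,
  \<open>1 / (1 - z) + cnj z / (1 - cnj z)\<close> with \<open>z = p * cis (- \<theta>)\<close>. The
  shift to \<open>Suc k\<close> counts the constant term once.\<close>

lemma poisson_sums:
  assumes p: "cmod p < 1"
  shows "(\<lambda>k. p ^ k * cis (- real k * \<theta>) + cnj p ^ Suc k * cis (real (Suc k) * \<theta>)) sums complex_of_real (poisson p \<theta>)"
proof -
  let ?e = "cis \<theta>"
  let ?z = "p * cis (- \<theta>)"
  have z: "cmod ?z < 1" "cmod (cnj ?z) < 1"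
    using p by (simp_all add: norm_mult)
  have "(\<lambda>k. ?z ^ k + cnj ?z * cnj ?z ^ k) sums (1 / (1 - ?z) + cnj ?z * (1 / (1 - cnj ?z)))"
    by (intro sums_add sums_mult geometric_sums z)
  also have "(\<lambda>k. ?z ^ k + cnj ?z * cnj ?z ^ k) = (\<lambda>k. p ^ k * cis (- real k * \<theta>) + cnj p ^ Suc k * cis (real (Suc k) * \<theta>))"
  proof
    fix k
    have "cnj ?z * cnj ?z ^ k = (cnj p * cis \<theta>) ^ Suc k"
      by (simp add: cis_cnj)
    also have "\<dots> = cnj p ^ Suc k * cis (real (Suc k) * \<theta>)"
      by (simp only: power_mult_distrib Complex.DeMoivre)
    finally have e: "cnj ?z * cnj ?z ^ k = cnj p ^ Suc k * cis (real (Suc k) * \<theta>)" .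
    show "?z ^ k + cnj ?z * cnj ?z ^ k = p ^ k * cis (- real k * \<theta>) + cnj p ^ Suc k * cis (real (Suc k) * \<theta>)"
      unfolding e by (simp only: power_mult_distrib Complex.DeMoivre) simp
  qed
  also have "1 / (1 - ?z) + cnj ?z * (1 / (1 - cnj ?z)) = complex_of_real (poisson p \<theta>)"
  proof -
    have nz: "1 - ?z \<noteq> 0" "1 - cnj ?z \<noteq> 0"
      using z by (metis norm_one less_irrefl right_minus_eq)+
    have m: "(1 - ?z) * (1 - cnj ?z) = of_real ((cmod (?e - p))\<^sup>2)"
    proof -
      have "?e - p = ?e * (1 - ?z)"
        by (simp add: algebra_simps cis_mult)
      then have "cmod (?e - p) = cmod (1 - ?z)"
        by (simp add: norm_mult)
      then show ?thesis
        using complex_norm_square[of "1 - ?z"] by simp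
    qed
    have n: "?z * cnj ?z = of_real ((cmod p)\<^sup>2)"
      using complex_norm_square[of ?z] by (simp add: norm_mult)
    have "1 / (1 - ?z) + cnj ?z * (1 / (1 - cnj ?z)) = (1 - ?z * cnj ?z) / ((1 - ?z) * (1 - cnj ?z))"
      using nz by (simp add: add_frac_eq) (simp add: algebra_simps)
    then show ?thesis
      unfolding m n poisson_def by simp
  qed
  finally show ?thesis .
qed

text \<open>Orthogonality selects frequency \<open>n\<close> from the Fourier series, and the
  geometric majorant \<open>2 * cmod p ^ k\<close> permits termwise integration.\<close>

lemma poisson_moment:
  assumes p: "cmod p < 1"
  shows "(LINT \<theta>:{0..2*pi}|lborel. complex_of_real (poisson p \<theta>) * cis (- real n * \<theta>)) = 2 * of_real pi * cnj p ^ n"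
proof -
  define g where "g k \<theta> = (p ^ k * cis (- real k * \<theta>) + cnj p ^ Suc k * cis (real (Suc k) * \<theta>)) * cis (- real n * \<theta>)" for k \<theta>
  have g_sums: "(\<lambda>k. g k \<theta>) sums (complex_of_real (poisson p \<theta>) * cis (- real n * \<theta>))" for \<theta>
    unfolding g_def by (intro sums_mult2 poisson_sums p)
  have g_bound: "cmod (g k \<theta>) \<le> 2 * cmod p ^ k" for k \<theta>
  proof -
    have "cmod (g k \<theta>) \<le> cmod p ^ k + cmod p ^ Suc k"
      unfolding g_def using norm_triangle_ineq[of "p ^ k * cis (- real k * \<theta>)" "cnj p ^ Suc k * cis (real (Suc k) * \<theta>)"]
      by (simp add: norm_mult norm_power)
    also have "\<dots> \<le> 2 * cmod p ^ k"
      using p by (simp add: mult_left_le_one_le)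
    finally show ?thesis .
  qed
  have cis_int: "set_integrable lborel {0..2*pi} (\<lambda>\<theta>. cis (of_int k * \<theta>))" for k :: int
    by (intro borel_integrable_atLeastAtMost' continuous_intros)
  have mult_int: "set_integrable lborel {0..2*pi} (\<lambda>\<theta>. c * cis (of_int k * \<theta>))" for c :: complex and k :: int
    by (intro set_integrable_mult_right cis_int)
  have g_cis: "g k \<theta> = p ^ k * cis (of_int (- int k - int n) * \<theta>) + cnj p ^ Suc k * cis (of_int (int (Suc k) - int n) * \<theta>)" for k \<theta>
    unfolding g_def by (simp add: distrib_right mult.assoc cis_mult) (simp add: algebra_simps)
  have g_int: "set_integrable lborel {0..2*pi} (g k)" for k
    unfolding g_cis[abs_def] by (intro set_integral_add(1) mult_int)
  have g_integral: "(LINT \<theta>:{0..2*pi}|lborel. g k \<theta>) =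
      p ^ k * (if - int k - int n = 0 then 2 * of_real pi else 0) + cnj p ^ Suc k * (if int (Suc k) - int n = 0 then 2 * of_real pi else 0)" for k
    unfolding g_cis integral_cis_multiple[symmetric]
    by (simp only: set_integral_add(2)[OF mult_int mult_int] set_integral_mult_right)
  let ?h = "\<lambda>k \<theta>. indicator {0..2*pi} \<theta> *\<^sub>R g k \<theta>"
  have "(\<integral>\<theta>. (\<Sum>k. ?h k \<theta>) \<partial>lborel) = (\<Sum>k. \<integral>\<theta>. ?h k \<theta> \<partial>lborel)"
  proof (rule integral_suminf)
    show "integrable lborel (?h k)" for k
      using g_int[of k] by (simp add: set_integrable_def)
    have "summable (\<lambda>k. norm (?h k \<theta>))" for \<theta>
    proof (rule summable_comparison_test')
      show "summable (\<lambda>k. 2 * cmod p ^ k)"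
        using p by (intro summable_mult summable_geometric) simp
      show "norm (norm (?h k \<theta>)) \<le> 2 * cmod p ^ k" for k
        using g_bound[of k \<theta>] by (auto simp: indicator_def)
    qed
    then show "AE \<theta> in lborel. summable (\<lambda>k. norm (?h k \<theta>))"
      by simp
    show "summable (\<lambda>k. \<integral>\<theta>. norm (?h k \<theta>) \<partial>lborel)"
    proof (rule summable_comparison_test')
      show "summable (\<lambda>k. 2 * cmod p ^ k * (2 * pi))"
        using p by (intro summable_mult summable_mult2 summable_geometric) simp
      show "norm (\<integral>\<theta>. norm (?h k \<theta>) \<partial>lborel) \<le> 2 * cmod p ^ k * (2 * pi)" for k
      proof -
        have "(\<integral>\<theta>. norm (?h k \<theta>) \<partial>lborel) \<le> (\<integral>\<theta>. 2 * cmod p ^ k * indicator {0..2*pi} \<theta> \<partial>lborel)"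
        proof (rule integral_mono)
          show "integrable lborel (\<lambda>\<theta>. norm (?h k \<theta>))"
            using g_int[of k] unfolding set_integrable_def by (rule integrable_norm)
          show "integrable lborel (\<lambda>\<theta>. 2 * cmod p ^ k * indicator {0..2*pi} \<theta>)"
            by (intro integrable_mult_right integrable_indicator_Icc)
          show "norm (?h k \<theta>) \<le> 2 * cmod p ^ k * indicator {0..2*pi} \<theta>" for \<theta>
            using g_bound[of k \<theta>] by (auto simp: indicator_def)
        qed
        then show ?thesis
          by simp
      qed
    qed
  qed
  also have "(\<lambda>\<theta>. \<Sum>k. ?h k \<theta>) = (\<lambda>\<theta>. indicator {0..2*pi} \<theta> *\<^sub>R (complex_of_real (poisson p \<theta>) * cis (- real n * \<theta>)))"
  proof
    fix \<theta>
    show "(\<Sum>k. ?h k \<theta>) = indicator {0..2*pi} \<theta> *\<^sub>R (complex_of_real (poisson p \<theta>) * cis (- real n * \<theta>))"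
      using sums_unique[OF sums_scaleR_right[OF g_sums]] by metis
  qed
  finally have "(LINT \<theta>:{0..2*pi}|lborel. complex_of_real (poisson p \<theta>) * cis (- real n * \<theta>)) =
      (\<Sum>k. LINT \<theta>:{0..2*pi}|lborel. g k \<theta>)"
    by (simp only: set_lebesgue_integral_def)
  also have "\<dots> = 2 * of_real pi * cnj p ^ n"
  \<comment> \<open>The surviving term is the one of index 0 in the first family if
    \<open>n = 0\<close>, and the one of index \<open>n - 1\<close> in the second family
    otherwise.\<close>
  proof (cases n)
    case 0
    have "(\<Sum>k. LINT \<theta>:{0..2*pi}|lborel. g k \<theta>) = (\<Sum>k\<in>{0}. LINT \<theta>:{0..2*pi}|lborel. g k \<theta>)"
      by (rule suminf_finite) (auto simp: g_integral 0)
    then show ?thesis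
      by (simp add: g_integral 0)
  next
    case (Suc m)
    have "(\<Sum>k. LINT \<theta>:{0..2*pi}|lborel. g k \<theta>) = (\<Sum>k\<in>{m}. LINT \<theta>:{0..2*pi}|lborel. g k \<theta>)"
      by (rule suminf_finite) (auto simp: g_integral Suc)
    then show ?thesis
      by (simp add: g_integral Suc)
  qed
  finally show ?thesis .
qed

lemma poisson_continuous:
  assumes p: "cmod p < 1"
  shows "continuous_on A (poisson p)"
proof -
  have "cis \<theta> \<noteq> p" for \<theta>
    using p by (metis norm_cis less_irrefl)
  then show ?thesis
    unfolding poisson_def[abs_def] by (intro continuous_intros) simp_all
qed

section \<open>Moments of the flux and the rank of their Hankel matrix\<close>

context source_problem
begin

lemma flux_moment_eq: "flux_moment f n = (\<Sum>j\<in>{1..N}. of_real (- q j / kappa) * cnj (p j) ^ n)"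
proof -
  have E: "exp (- \<i> * of_nat n * of_real \<theta>) = cis (- real n * \<theta>)" for \<theta>
    by (simp add: cis_conv_exp mult_ac)
  let ?h = "\<lambda>j \<theta>. of_real (- q j / kappa) * (complex_of_real (poisson (p j) \<theta>) * cis (- real n * \<theta>))"
  have int: "set_integrable lborel {0..2*pi} (?h j)" if "j \<in> {1..N}" for j
    by (intro set_integrable_mult_right borel_integrable_atLeastAtMost' continuous_intros
        continuous_on_compose2[OF poisson_continuous[OF pole_norm[OF that], of UNIV]]) auto
  define L where "L \<theta> = indicator {0..2*pi} \<theta> *\<^sub>R (complex_of_real (low_frequency_flux f \<theta>) * exp (- \<i> * of_nat n * of_real \<theta>))" for \<theta>
  define G where "G \<theta> = (\<Sum>j\<in>{1..N}. indicator {0..2*pi} \<theta> *\<^sub>R ?h j \<theta>)" for \<theta>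
  \<comment> \<open>At the angle \<open>2 * pi\<close> the flux condition says nothing about
    \<open>f\<close>, yet the moment integral includes this point. The discrepancy is isolated as an
    explicit function supported on a null set.\<close>
  have L_G: "L \<theta> = G \<theta> + indicator {2*pi} \<theta> *\<^sub>R (L (2*pi) - G (2*pi))" for \<theta>
  proof -
    consider "\<theta> = 2 * pi" | "\<theta> \<in> {0..<2*pi}" | "\<theta> \<noteq> 2 * pi" "\<theta> \<notin> {0..2*pi}" by force
    then show ?thesis
    proof cases
      case 2
      then have "L \<theta> = complex_of_real (limit_flux \<theta>) * cis (- real n * \<theta>)"
        unfolding L_def E low_frequency_flux_eq[OF 2] by simp
      also have "\<dots> = G \<theta>"
        using 2 by (simp add: G_def limit_flux_def sum_negf) (simp add: sum_distrib_right mult.assoc)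
      finally show ?thesis
        using 2 by simp
    qed (simp_all add: L_def G_def)
  qed
  have int: "integrable lborel (\<lambda>\<theta>. indicator {0..2*pi} \<theta> *\<^sub>R ?h j \<theta>)" if "j \<in> {1..N}" for j
    using int[OF that] by (simp only: set_integrable_def)
  have "integrable lborel G"
    unfolding G_def using int by (rule Bochner_Integration.integrable_sum)
  moreover have "integrable lborel (\<lambda>\<theta>. indicator {2*pi} \<theta> *\<^sub>R (L (2*pi) - G (2*pi)))"
    by (intro integrable_scaleR_left integrable_real_indicator) simp_all
  ultimately have "(\<integral>\<theta>. L \<theta> \<partial>lborel) = (\<integral>\<theta>. G \<theta> \<partial>lborel)"
    by (subst L_G) (simp add: Bochner_Integration.integral_add)
  then have "(LINT \<theta>:{0..2*pi}|lborel. complex_of_real (low_frequency_flux f \<theta>) * exp (- \<i> * of_nat n * of_real \<theta>)) =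
      (\<integral>\<theta>. (\<Sum>j\<in>{1..N}. indicator {0..2*pi} \<theta> *\<^sub>R ?h j \<theta>) \<partial>lborel)"
    unfolding set_lebesgue_integral_def L_def[abs_def] G_def[abs_def] .
  also have "\<dots> = (\<Sum>j\<in>{1..N}. \<integral>\<theta>. indicator {0..2*pi} \<theta> *\<^sub>R ?h j \<theta> \<partial>lborel)"
    by (rule Bochner_Integration.integral_sum) (rule int)
  also have "\<dots> = (\<Sum>j\<in>{1..N}. of_real (- q j / kappa) * (2 * of_real pi * cnj (p j) ^ n))"
  proof (rule sum.cong[OF refl])
    fix j assume "j \<in> {1..N}"
    then show "(\<integral>\<theta>. indicator {0..2*pi} \<theta> *\<^sub>R ?h j \<theta> \<partial>lborel) = of_real (- q j / kappa) * (2 * of_real pi * cnj (p j) ^ n)"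
      unfolding set_lebesgue_integral_def[symmetric]
      by (simp only: set_integral_mult_right poisson_moment[OF pole_norm])
  qed
  also have "\<dots> = 2 * of_real pi * (\<Sum>j\<in>{1..N}. of_real (- q j / kappa) * cnj (p j) ^ n)"
    unfolding sum_distrib_left by (rule sum.cong) (simp_all only: mult_ac)
  finally show ?thesis
    unfolding flux_moment_def by simp
qed

lemma rank_flux_hankel:
  assumes src: "distinct_nonzero_sources N p q" and m: "N \<le> m"
  shows "vec_space.rank m (flux_hankel f m) = N"
proof -
  have inj: "inj_on (\<lambda>j. cnj (p j)) {1..N}"
    using src unfolding distinct_nonzero_sources_def inj_on_def complex_cnj_cancel_iff by blast
  have nz: "complex_of_real (- q j / kappa) \<noteq> 0" if "j \<in> {1..N}" for j
    using src that kappa_pos unfolding distinct_nonzero_sources_def by simp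
  have "card {1..N} \<le> m"
    using m by simp
  note rank_hankel_exponential_sum[OF finite_atLeastAtMost inj nz this]
  then show ?thesis
    unfolding flux_hankel_def flux_moment_eq by simp
qed

end

theorem theorem2p1:
  fixes N :: nat and p :: "nat \<Rightarrow> complex" and q :: "nat \<Rightarrow> real"
    and u :: "complex \<Rightarrow> real \<Rightarrow> real" and f :: "real \<Rightarrow> real \<Rightarrow> real"
    and \<rho> \<phi> :: "nat \<Rightarrow> real" and lam :: "nat \<Rightarrow> complex" and w :: "nat \<Rightarrow> real"
  assumes data: "point_source_data N p q u f"
    and polar: "\<And>j. j \<in> {1..N} \<Longrightarrow> 0 \<le> \<rho> j \<and> \<rho> j < 1 \<and> p j = of_real (\<rho> j) * exp (\<i> * of_real (\<phi> j))"
    and lam_eq: "\<And>j. j \<in> {1..N} \<Longrightarrow> lam j = of_real (\<rho> j) * exp (- \<i> * of_real (\<phi> j))"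
    and w_eq: "\<And>j. j \<in> {1..N} \<Longrightarrow> w j = - q j / (2 * pi)"
  shows "(distinct_nonzero_sources N p q \<longleftrightarrow>
            (\<forall>i\<in>{1..N}. \<forall>j\<in>{1..N}. i \<noteq> j \<longrightarrow> lam i \<noteq> lam j) \<and> (\<forall>j\<in>{1..N}. w j \<noteq> 0)) \<and>
         (distinct_nonzero_sources N p q \<longrightarrow>
            (\<forall>m\<ge>1. N \<le> m \<longrightarrow> vec_space.rank m (flux_hankel f m) = N) \<and>
            (\<forall>N' p' q' u' f' m.
               point_source_data N' p' q' u' f' \<and> distinct_nonzero_sources N' p' q' \<and>
               1 \<le> m \<and> N \<le> m \<and> N' \<le> m \<and>
               vec_space.rank m (flux_hankel f m) = vec_space.rank m (flux_hankel f' m) \<longrightarrow>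
               N = N'))"
proof -
  \<comment> \<open>Quantified over all data, so that it applies to both configurations in the
    identifiability clause; at a common \<open>m\<close> equal ranks force equal source
    numbers.\<close>
  have rank: "vec_space.rank m (flux_hankel f m) = N"
    if "point_source_data N p q u f" "distinct_nonzero_sources N p q" "N \<le> m" for N p q u f m
    using source_problem.rank_flux_hankel[OF source_problem.intro] that by blast
  have lam: "lam j = cnj (p j)" if "j \<in> {1..N}" for j
    using polar[OF that] lam_eq[OF that] by (simp add: exp_cnj)
  have w: "w j \<noteq> 0 \<longleftrightarrow> q j \<noteq> 0" if "j \<in> {1..N}" for j
    using w_eq[OF that] by simp
  have "lam i \<noteq> lam j \<longleftrightarrow> p i \<noteq> p j" if "i \<in> {1..N}" "j \<in> {1..N}" for i j
    by (simp only: lam[OF that(1)] lam[OF that(2)] complex_cnj_cancel_iff not_False_eq_True)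
  then have "inj_on p {1..N} \<longleftrightarrow> (\<forall>i\<in>{1..N}. \<forall>j\<in>{1..N}. i \<noteq> j \<longrightarrow> lam i \<noteq> lam j)"
    unfolding inj_on_def by blast
  then have equiv: "distinct_nonzero_sources N p q \<longleftrightarrow>
      (\<forall>i\<in>{1..N}. \<forall>j\<in>{1..N}. i \<noteq> j \<longrightarrow> lam i \<noteq> lam j) \<and> (\<forall>j\<in>{1..N}. w j \<noteq> 0)"
    unfolding distinct_nonzero_sources_def using w by blast
  show ?thesis
  proof (intro conjI impI allI)
    show "distinct_nonzero_sources N p q \<longleftrightarrow>
      (\<forall>i\<in>{1..N}. \<forall>j\<in>{1..N}. i \<noteq> j \<longrightarrow> lam i \<noteq> lam j) \<and> (\<forall>j\<in>{1..N}. w j \<noteq> 0)"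
      by (fact equiv)
    assume src: "distinct_nonzero_sources N p q"
    show "vec_space.rank m (flux_hankel f m) = N" if "N \<le> m" for m
      by (fact rank[OF data src that])
    show "N = N'"
      if *: "point_source_data N' p' q' u' f' \<and> distinct_nonzero_sources N' p' q' \<and>
        1 \<le> m \<and> N \<le> m \<and> N' \<le> m \<and> vec_space.rank m (flux_hankel f m) = vec_space.rank m (flux_hankel f' m)"
      for N' p' q' u' f' m
      using rank[OF data src, of m] rank[of N' p' q' u' f' m] * by simp
  qed
qed

end
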